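(* For $h$ sufficiently small there exists a constant $C$, independent of the interface location, such that for every interface element $T$ (in either the curve or the line variant) $$|\phi_{i,T}|_{k,\infty,T}\le Ch^{-k},\qquad i\in\mathcal I,\ k=0,1,2,$$ where $|\cdot|_{k,\infty,T}=\max(|\cdot|_{k,\infty,T_p^+},|\cdot|_{k,\infty,T_p^-})$.
   Context: Standard setting. $\Omega\subset\mathbb R^2$ is a bounded domain that is a finite union of rectangles, separated by a curve $\Gamma$ into open subdomains $\Omega^+,\Omega^-$ with $\overline\Omega=\overline{\Omega^+}\cup\overline{\Omega^-}\cup\Gamma$; $\beta^\pm>0$ are constants and $\rho=\beta^-/\beta^+$. $\mathcal T_h$ is a Cartesian mesh of $\Omega$ made either of rectangles or of triangles (Cartesian rectangles cut along a diagonal), with maximal edge length $h$. An element $T$ is an interface element if its interior meets $\Gamma$. The mesh satisfies: (H1) $\Gamma$ does not intersect an edge of any element at more than two points unless the edge is part of $\Gamma$; (H2) if $\Gamma$ meets the boundary of an element at two points, they lie on different edges; (H3) $\Gamma$ is piecewise $C^2$ and $\Gamma\cap T$ is $C^2$ for every interface element $T$; (H4) $PC^2_{int}(T)$ is dense in $PH^2_{int}(T)$ for every interface element $T$. On an interface element $T$, $D,E$ are the two points of $\Gamma\cap\partial T$, $l$ is the segment $DE$, $\bar{\mathbf n}$ is a unit normal to $l$, and $T^\pm=T\cap\Omega^\pm$. IFE setting. Let $T$ be an interface element with edges $b_i$, $i\in\mathcal I=\{1,\dots,N\}$ ($N=3$ for triangles, $N=4$ for rectangles) and midpoints $M_i$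 of $b_i$. $\Pi_T=\mathrm{span}\{1,x,y\}$ (Crouzeix–Raviart, triangles) or $\Pi_T=\mathrm{span}\{1,x,y,x^2-y^2\}$ (rotated-$Q_1$, rectangles); $\psi_{i,T}\in\Pi_T$ are the standard shape functions with $\frac1{|b_j|}\int_{b_j}\psi_{i,T}\,ds=\delta_{ij}$. One of two variants is fixed: (curve) a point $F\in\Gamma\cap T$, $F\neq D,E$, $\mathbf v(F)=\mathbf n(F)$ the unit normal to $\Gamma$ at $F$ oriented so that $\bar{\mathbf n}\cdot\mathbf n(F)>0$, and $T_p^\pm=T^\pm$; (line) a point $F\in l$, $\mathbf v(F)=\bar{\mathbf n}$, and $T_p^\pm$ are the two parts into which $l$ cuts $T$, $T_p^s$ being the one on the same side of $l$ as $\partial T\cap \overline{T^s}$. An IFE function on $T$ is a function $\phi_T$ with $\phi_T|_{T_p^s}=\phi_T^s$, $\phi_T^s\in\Pi_T$ ($s=\pm$), satisfying (J1) $\phi_T^-=\phi_T^+$ on $l$, and additionally $\partial_{xx}\phi_T^-=\partial_{xx}\phi_T^+$ in the rotated-$Q_1$ case; (J2) $\beta^-\nabla\phi_T^-(F)\cdot\mathbf v(F)=\beta^+\nabla\phi_T^+(F)\cdot\mathbf v(F)$. $S_h^{int}(T)$ denotes the linear space of IFE functions on $T$, and $\phi_{i,T}$, $i\in\mathcal I$, are the IFE functions with $\frac1{|b_j|}\int_{b_j}\phi_{i,T}\,ds=\delta_{ij}$ (they exist and are unique for $h$ small enough).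
   Formalization: The meshes are assumed quasi-uniform (every cell side at least h/κ for a fixed κ ≥ 1, and C may depend on κ); without this the bound Ch^{-k} with the maximal edge length h fails on interface elements in very thin cells. *)

theory Defs
  imports "HOL-Analysis.Analysis"
begin

type_synonym pt = "real \<times> real"

definition dx :: "(pt \<Rightarrow> real) \<Rightarrow> pt \<Rightarrow> real" where
  "dx f = (\<lambda>(x, y). deriv (\<lambda>t. f (t, y)) x)"

definition dy :: "(pt \<Rightarrow> real) \<Rightarrow> pt \<Rightarrow> real" where
  "dy f = (\<lambda>(x, y). deriv (\<lambda>t. f (x, t)) y)"

definition grad :: "(pt \<Rightarrow> real) \<Rightarrow> pt \<Rightarrow> pt" where
  "grad f p = (dx f p, dy f p)"

definition sup_abs :: "pt set \<Rightarrow> (pt \<Rightarrow> real) \<Rightarrow> real" where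
  "sup_abs S g = Sup ((\<lambda>p. \<bar>g p\<bar>) ` S)"

definition seminorm_inf :: "nat \<Rightarrow> pt set \<Rightarrow> (pt \<Rightarrow> real) \<Rightarrow> real" where
  "seminorm_inf k S f =
     (if k = 0 then sup_abs S f
      else if k = 1 then max (sup_abs S (dx f)) (sup_abs S (dy f))
      else max (max (sup_abs S (dx (dx f))) (sup_abs S (dx (dy f))))
               (max (sup_abs S (dy (dx f))) (sup_abs S (dy (dy f)))))"

definition c2_arc :: "(real \<Rightarrow> pt) \<Rightarrow> bool" where
  "c2_arc \<gamma> \<longleftrightarrow> inj_on \<gamma> {0..1} \<and>
     (\<exists>\<gamma>1 \<gamma>2. (\<forall>t\<in>{0..1}. (\<gamma> has_vector_derivative \<gamma>1 t) (at t within {0..1})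
                 \<and> (\<gamma>1 has_vector_derivative \<gamma>2 t) (at t within {0..1})
                 \<and> \<gamma>1 t \<noteq> 0)
             \<and> continuous_on {0..1} \<gamma>2)"

definition piecewise_C2 :: "pt set \<Rightarrow> bool" where
  "piecewise_C2 \<Gamma> \<longleftrightarrow> (\<exists>A. finite A \<and> (\<forall>\<gamma>\<in>A. c2_arc \<gamma>) \<and> \<Gamma> = (\<Union>\<gamma>\<in>A. \<gamma> ` {0..1}))"

definition ife_setting :: "pt set \<Rightarrow> pt set \<Rightarrow> pt set \<Rightarrow> pt set \<Rightarrow> bool" where
  "ife_setting \<Omega> \<Omega>p \<Omega>m \<Gamma> \<longleftrightarrow>
     open \<Omega> \<and> connected \<Omega> \<and> bounded \<Omega> \<and> \<Omega> \<noteq> {} \<and>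
     (\<exists>R. finite R \<and> (\<forall>r\<in>R. \<exists>a b. r = cbox a b) \<and> \<Omega> = interior (\<Union>R)) \<and>
     open \<Omega>p \<and> open \<Omega>m \<and> connected \<Omega>p \<and> connected \<Omega>m \<and> \<Omega>p \<noteq> {} \<and> \<Omega>m \<noteq> {} \<and>
     \<Omega>p \<subseteq> \<Omega> \<and> \<Omega>m \<subseteq> \<Omega> \<and> \<Omega>p \<inter> \<Omega>m = {} \<and> \<Omega> - \<Gamma> = \<Omega>p \<union> \<Omega>m \<and>
     closure \<Omega> = closure \<Omega>p \<union> closure \<Omega>m \<union> \<Gamma> \<and>
     piecewise_C2 \<Gamma>"

definition is_normal :: "pt set \<Rightarrow> pt set \<Rightarrow> pt \<Rightarrow> pt \<Rightarrow> bool" where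
  "is_normal \<Gamma> T F n \<longleftrightarrow> norm n = 1 \<and>
     (\<forall>\<gamma> t. c2_arc \<gamma> \<and> \<gamma> ` {0..1} = \<Gamma> \<inter> T \<and> t \<in> {0..1} \<and> \<gamma> t = F
        \<longrightarrow> inner n (vector_derivative \<gamma> (at t within {0..1})) = 0)"

definition cells :: "real list \<Rightarrow> real list \<Rightarrow> pt set \<Rightarrow> (nat \<times> nat) set" where
  "cells xs ys \<Omega> = {(i, j). Suc i < length xs \<and> Suc j < length ys \<and>
      cbox (xs ! i, ys ! j) (xs ! Suc i, ys ! Suc j) \<subseteq> closure \<Omega>}"

definition cartesian_mesh :: "real list \<Rightarrow> real list \<Rightarrow> pt set \<Rightarrow> bool" where
  "cartesian_mesh xs ys \<Omega> \<longleftrightarrow> sorted_wrt (<) xs \<and> sorted_wrt (<) ys \<and>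
     (\<Union>(i, j)\<in>cells xs ys \<Omega>. cbox (xs ! i, ys ! j) (xs ! Suc i, ys ! Suc j)) = closure \<Omega>"

text \<open>Elements are given by their vertex lists (counterclockwise); edge b_i joins vertex i to vertex i+1.\<close>
definition rect_elem :: "real \<Rightarrow> real \<Rightarrow> real \<Rightarrow> real \<Rightarrow> pt list" where
  "rect_elem x0 y0 x1 y1 = [(x0, y0), (x1, y0), (x1, y1), (x0, y1)]"

definition tri_elems :: "real \<Rightarrow> real \<Rightarrow> real \<Rightarrow> real \<Rightarrow> bool \<Rightarrow> pt list set" where
  "tri_elems x0 y0 x1 y1 d =
     (if d then {[(x0, y0), (x1, y0), (x1, y1)], [(x0, y0), (x1, y1), (x0, y1)]}
      else {[(x0, y0), (x1, y0), (x0, y1)], [(x1, y0), (x1, y1), (x0, y1)]})"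

definition mesh_elements :: "bool \<Rightarrow> real list \<Rightarrow> real list \<Rightarrow> (nat \<Rightarrow> nat \<Rightarrow> bool) \<Rightarrow> pt set \<Rightarrow> pt list set" where
  "mesh_elements rect xs ys dg \<Omega> =
     (\<Union>(i, j)\<in>cells xs ys \<Omega>.
        if rect then {rect_elem (xs ! i) (ys ! j) (xs ! Suc i) (ys ! Suc j)}
        else tri_elems (xs ! i) (ys ! j) (xs ! Suc i) (ys ! Suc j) (dg i j))"

definition elem_set :: "pt list \<Rightarrow> pt set" where
  "elem_set vs = convex hull (set vs)"

definition edges :: "pt list \<Rightarrow> (pt \<times> pt) list" where
  "edges vs = map (\<lambda>i. (vs ! i, vs ! ((i + 1) mod length vs))) [0..<length vs]"

definition mesh_size :: "bool \<Rightarrow> real list \<Rightarrow> real list \<Rightarrow> (nat \<Rightarrow> nat \<Rightarrow> bool) \<Rightarrow> pt set \<Rightarrow> real" where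
  "mesh_size rect xs ys dg \<Omega> =
     Max (\<Union>vs\<in>mesh_elements rect xs ys dg \<Omega>. (\<lambda>(P, Q). dist P Q) ` set (edges vs))"

definition quasi_uniform :: "real \<Rightarrow> real list \<Rightarrow> real list \<Rightarrow> pt set \<Rightarrow> real \<Rightarrow> bool" where
  "quasi_uniform \<kappa> xs ys \<Omega> h \<longleftrightarrow>
     (\<forall>(i, j)\<in>cells xs ys \<Omega>. xs ! Suc i - xs ! i \<ge> h / \<kappa> \<and> ys ! Suc j - ys ! j \<ge> h / \<kappa>)"

definition interface_elem :: "pt set \<Rightarrow> pt list \<Rightarrow> bool" where
  "interface_elem \<Gamma> vs \<longleftrightarrow> interior (elem_set vs) \<inter> \<Gamma> \<noteq> {}"

definition mesh_hyps :: "pt set \<Rightarrow> pt list set \<Rightarrow> bool" where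
  "mesh_hyps \<Gamma> Th \<longleftrightarrow> (\<forall>vs\<in>Th.
      (\<forall>(P, Q)\<in>set (edges vs). closed_segment P Q \<subseteq> \<Gamma> \<or>
          (finite (\<Gamma> \<inter> closed_segment P Q) \<and> card (\<Gamma> \<inter> closed_segment P Q) \<le> 2)) \<and>
      (\<forall>D E. D \<noteq> E \<and> \<Gamma> \<inter> frontier (elem_set vs) = {D, E} \<longrightarrow>
          \<not> (\<exists>(P, Q)\<in>set (edges vs). D \<in> closed_segment P Q \<and> E \<in> closed_segment P Q)) \<and>
      (interface_elem \<Gamma> vs \<longrightarrow>
          (\<exists>\<gamma>. c2_arc \<gamma> \<and> \<gamma> ` {0..1} = \<Gamma> \<inter> elem_set vs) \<and>
          (\<exists>D E. D \<noteq> E \<and> \<Gamma> \<inter> frontier (elem_set vs) = {D, E})))"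

definition Pi_T :: "bool \<Rightarrow> (pt \<Rightarrow> real) set" where
  "Pi_T rect = (if rect
     then {\<lambda>(x, y). a + b * x + c * y + d * (x\<^sup>2 - y\<^sup>2) | a b c d. True}
     else {\<lambda>(x, y). a + b * x + c * y | a b c. True})"

text \<open>Configuration of an interface element: D, E, unit normal nbar of l = DE, pieces
  Tp = T_p^+, Tm = T_p^-, point F and direction v, in the curve or the line variant.\<close>
definition ife_config :: "pt set \<Rightarrow> pt set \<Rightarrow> pt set \<Rightarrow> pt list \<Rightarrow> pt \<Rightarrow> pt \<Rightarrow> pt
    \<Rightarrow> pt set \<Rightarrow> pt set \<Rightarrow> pt \<Rightarrow> pt \<Rightarrow> bool" where
  "ife_config \<Gamma> \<Omega>p \<Omega>m vs D E nbar Tp Tm F v \<longleftrightarrow>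
     (let T = elem_set vs in
      D \<noteq> E \<and> \<Gamma> \<inter> frontier T = {D, E} \<and> norm nbar = 1 \<and> inner nbar (E - D) = 0 \<and>
      ((Tp = T \<inter> \<Omega>p \<and> Tm = T \<inter> \<Omega>m \<and> F \<in> \<Gamma> \<inter> T \<and> F \<notin> {D, E} \<and>
          is_normal \<Gamma> T F v \<and> inner nbar v > 0)
       \<or>
       (F \<in> closed_segment D E \<and> v = nbar \<and>
          (\<exists>\<sigma>\<in>{1, -1::real}.
             Tp = {p \<in> T. \<sigma> * inner (p - D) nbar > 0} \<and>
             Tm = {p \<in> T. \<sigma> * inner (p - D) nbar < 0} \<and>
             (\<forall>q\<in>frontier T \<inter> closure (T \<inter> \<Omega>p). \<sigma> * inner (q - D) nbar \<ge> 0) \<and>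
             (\<forall>q\<in>frontier T \<inter> closure (T \<inter> \<Omega>m). \<sigma> * inner (q - D) nbar \<le> 0)))))"

definition pw_fun :: "pt set \<Rightarrow> (pt \<Rightarrow> real) \<Rightarrow> (pt \<Rightarrow> real) \<Rightarrow> pt \<Rightarrow> real" where
  "pw_fun Tp fp fm = (\<lambda>p. if p \<in> closure Tp then fp p else fm p)"

definition edge_avg :: "(pt \<Rightarrow> real) \<Rightarrow> pt \<times> pt \<Rightarrow> real" where
  "edge_avg f e = (case e of (P, Q) \<Rightarrow> integral {0..1} (\<lambda>t. f (P + t *\<^sub>R (Q - P))))"

definition ife_basis :: "bool \<Rightarrow> real \<Rightarrow> real \<Rightarrow> pt list \<Rightarrow> pt \<Rightarrow> pt \<Rightarrow> pt set \<Rightarrow> pt \<Rightarrow> pt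
    \<Rightarrow> nat \<Rightarrow> (pt \<Rightarrow> real) \<Rightarrow> (pt \<Rightarrow> real) \<Rightarrow> bool" where
  "ife_basis rect \<beta>p \<beta>m vs D E Tp F v i fp fm \<longleftrightarrow>
     i < length vs \<and> fp \<in> Pi_T rect \<and> fm \<in> Pi_T rect \<and>
     (\<forall>p\<in>closed_segment D E. fm p = fp p) \<and>
     (rect \<longrightarrow> (\<forall>p. dx (dx fm) p = dx (dx fp) p)) \<and>
     \<beta>m * inner (grad fm F) v = \<beta>p * inner (grad fp F) v \<and>
     (\<forall>j<length vs. edge_avg (pw_fun Tp fp fm) (edges vs ! j) = (if j = i then 1 else 0))"

end

theory Submission
  imports Defs
begin

text \<open>
  On an interface element write \<open>\<phi>\<^sup>- = \<phi>\<^sup>+ + c L\<close>, where \<open>L(p) = n \<bullet> (p - D)\<close> vanishes on the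
  line through \<open>D\<close> and \<open>E\<close>. On the element boundary the two signs of \<open>L\<close> see one piece each, so
  the edge averages determine \<open>\<phi>\<^sup>+\<close> up to \<open>c\<close> times the interpolant of a sum of parts of \<open>L\<close>, and the flux
  jump condition becomes a scalar equation \<open>c (1 + (\<beta>\<^sup>+ / \<beta>\<^sup>- - 1) (t + O(h))) = O(1 / h)\<close>. Here \<open>t\<close> is the normal derivative at
  \<open>F\<close> of the nonconforming interpolant of \<open>L\<^sup>+\<close> (or of \<open>L\<^sup>-\<close>, \<open>L\<close>, 0), and everything rests on \<open>0 \<le> t \<le> 1\<close>
  up to \<open>O(h)\<close>. Since the interpolants of \<open>L\<^sup>+\<close> and \<open>L\<^sup>-\<close> add up to \<open>L\<close>, only \<open>t \<ge> 0\<close> is needed: for triangles it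
  is monotonicity of averages, for rectangles a polynomial inequality in the corner values of \<open>L\<close>. The \<open>O(h)\<close> errors are
  uniform because an arc inside a finite union of smooth arcs inherits their curvature bound, so it is
  \<open>O(h\<^sup>2)\<close>-close to its chord.
\<close>

section \<open>Curvature of subarcs of a piecewise smooth curve\<close>

text \<open>The interval [0, 1] for \<open>t\<close> is what matters: with r =
  \<open>\<beta>p / \<beta>m\<close>, the factor 1 + (r - 1) t is then a convex combination of 1 and
  r, hence at least min 1 r > 0 whatever the contrast, and h is taken so small that the O(h) terms
  consume at most half of it. Two obstacles shape the rest. Nothing fixes which piece is seen on
  which side of the chord, so the traces on the boundary are described by two free bits and a single
  estimate serves all four combinations. In the curve variant, moreover, \<open>F\<close> need not
  lie on the chord and its normal need not be the chord normal. Controlling both defects requires a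
  curvature bound for the arc inside an element, an arc known only as a point set contained in
  \<open>\<Gamma>\<close>. Curvature can be read off from points alone, independently of the
  parametrization, and is therefore inherited. The curvature bound enters the threshold for h, not
  the final constant, which depends on \<open>\<kappa>\<close> and r only.\<close>

definition cross2 :: "pt \<Rightarrow> pt \<Rightarrow> real" where
  "cross2 p q = fst p * snd q - snd p * fst q"

lemma cross2_minus: "cross2 (p - q) r = cross2 p r - cross2 q r"
  by (simp add: cross2_def algebra_simps)

lemma cross2_scaleR [simp]: "cross2 (k *\<^sub>R p) q = k * cross2 p q" "cross2 p (k *\<^sub>R q) = k * cross2 p q"
  by (simp_all add: cross2_def algebra_simps)

lemma inner_pt: "inner (p :: pt) q = fst p * fst q + snd p * snd q"
  by (simp add: inner_prod_def)

lemma lagrange_pt: "(inner p q)\<^sup>2 + (cross2 p q)\<^sup>2 = (norm (p::pt))\<^sup>2 * (norm q)\<^sup>2"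
  unfolding power2_norm_eq_inner inner_pt cross2_def by (simp add: power2_eq_square algebra_simps)

lemma bounded_linear_cross2: "bounded_linear (\<lambda>p. cross2 p q)"
proof -
  have "bounded_linear (\<lambda>p::pt. fst p * snd q - snd p * fst q)"
    by (intro bounded_linear_sub bounded_linear_mult_const bounded_linear_fst bounded_linear_snd bounded_linear_compose[OF bounded_linear_mult_left])
  then show ?thesis unfolding cross2_def .
qed

lemma has_real_derivative_cross2:
  assumes "(g has_vector_derivative g') (at t within S)"
  shows "((\<lambda>t. cross2 (g t) q) has_real_derivative cross2 g' q) (at t within S)"
  using bounded_linear.has_vector_derivative[OF bounded_linear_cross2 assms]
  by (simp add: has_real_derivative_iff_has_vector_derivative)

lemma has_real_derivative_inner_left:
  assumes "(g has_vector_derivative g') (at t within S)"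
  shows "((\<lambda>t. inner (g t) q) has_real_derivative inner g' q) (at t within S)"
  using bounded_linear.has_vector_derivative[OF bounded_linear_inner_left assms]
  by (simp add: has_real_derivative_iff_has_vector_derivative)

text \<open>Taylor's formula with Peano remainder. As \<open>f1\<close> is differentiable only at
  \<open>t\<close>, the mean value inequality is applied to \<open>f\<close> minus its parabola,
  whose derivative is o(|x - t|).\<close>

lemma second_order_limit:
  fixes f f1 :: "real \<Rightarrow> real"
  assumes S: "convex S" and t: "t \<in> S"
    and f: "\<And>s. s \<in> S \<Longrightarrow> (f has_real_derivative f1 s) (at s within S)"
    and f1: "(f1 has_real_derivative f2) (at t within S)" and z: "f1 t = 0"
  shows "((\<lambda>s. (f s - f t) / (s - t)\<^sup>2) \<longlongrightarrow> f2 / 2) (at t within S)"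
proof (rule tendstoI)
  fix e :: real assume e: "e > 0"
  have "((\<lambda>s. (f1 s - f1 t) / (s - t)) \<longlongrightarrow> f2) (at t within S)"
    using f1 by (simp add: has_field_derivative_iff)
  then have "\<forall>\<^sub>F s in at t within S. dist ((f1 s - f1 t) / (s - t)) f2 < e/2"
    using e by (intro tendstoD) auto
  then obtain d where d: "d > 0"
    and D: "\<And>s. s \<in> S \<Longrightarrow> s \<noteq> t \<Longrightarrow> dist s t < d \<Longrightarrow> dist ((f1 s - f1 t) / (s - t)) f2 < e/2"
    unfolding eventually_at by blast
  have D': "\<bar>f1 s - f2 * (s - t)\<bar> \<le> e/2 * \<bar>s - t\<bar>" if "s \<in> S" "dist s t < d" for s
  proof (cases "s = t")
    case False
    have "f1 s - f2 * (s - t) = (f1 s / (s - t) - f2) * (s - t)"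
      using False by (simp add: field_simps)
    then have "\<bar>f1 s - f2 * (s - t)\<bar> = \<bar>f1 s / (s - t) - f2\<bar> * \<bar>s - t\<bar>" by (simp add: abs_mult)
    then show ?thesis using D[OF that(1) False that(2)] z
      by (simp add: dist_real_def mult_right_mono flip: times_divide_eq_left)
  qed (use z in simp)
  have "dist ((f s - f t) / (s - t)\<^sup>2) (f2 / 2) < e" if s: "s \<in> S" "s \<noteq> t" "dist s t < d" for s
  proof -
    define g where "g x = f x - f2 / 2 * (x - t)\<^sup>2" for x
    have sub: "closed_segment t s \<subseteq> S" using S t s by (simp add: closed_segment_subset)
    have "norm (g s - g t) \<le> (e/2 * \<bar>s - t\<bar>) * norm (s - t)"
    proof (rule field_differentiable_bound[of "closed_segment t s" g "\<lambda>x. f1 x - f2 * (x - t)"])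
      fix x assume x: "x \<in> closed_segment t s"
      have "(g has_real_derivative f1 x - f2 * (x - t)) (at x within S)"
        unfolding g_def using sub x
        by (auto intro!: derivative_eq_intros f)
      then show "(g has_field_derivative f1 x - f2 * (x - t)) (at x within closed_segment t s)"
        using sub by (rule DERIV_subset)
      have xt: "\<bar>x - t\<bar> \<le> \<bar>s - t\<bar>"
        using x by (auto simp: closed_segment_eq_real_ivl split: if_splits)
      then have "\<bar>f1 x - f2 * (x - t)\<bar> \<le> e/2 * \<bar>x - t\<bar>"
        using D'[of x] x sub s by (auto simp: dist_real_def)
      also have "\<dots> \<le> e/2 * \<bar>s - t\<bar>" using xt e by (intro mult_left_mono) auto
      finally show "norm (f1 x - f2 * (x - t)) \<le> e/2 * \<bar>s - t\<bar>" by simp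
    qed auto
    then have "\<bar>f s - f t - f2 / 2 * (s - t)\<^sup>2\<bar> \<le> e/2 * (s - t)\<^sup>2"
      by (simp add: g_def power2_eq_square algebra_simps abs_mult_self_eq flip: abs_mult)
    moreover have "(f s - f t) / (s - t)\<^sup>2 - f2 / 2 = (f s - f t - f2 / 2 * (s - t)\<^sup>2) / (s - t)\<^sup>2"
      using s by (simp add: field_simps)
    ultimately have "\<bar>(f s - f t) / (s - t)\<^sup>2 - f2 / 2\<bar> \<le> e/2"
      using s by (simp add: abs_divide divide_le_eq)
    then show ?thesis using e by (simp add: dist_real_def)
  qed
  then show "\<forall>\<^sub>F s in at t within S. dist ((f s - f t) / (s - t)\<^sup>2) (f2 / 2) < e"
    unfolding eventually_at using d by blast
qed

text \<open>The derivatives hidden by the existential in \<open>c2_arc\<close> become arguments, so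
  that curvature can be expressed in them.\<close>

definition c2_param :: "(real \<Rightarrow> pt) \<Rightarrow> (real \<Rightarrow> pt) \<Rightarrow> (real \<Rightarrow> pt) \<Rightarrow> bool" where
  "c2_param \<gamma> \<gamma>1 \<gamma>2 \<longleftrightarrow> inj_on \<gamma> {0..1} \<and>
     (\<forall>t\<in>{0..1}. (\<gamma> has_vector_derivative \<gamma>1 t) (at t within {0..1})
        \<and> (\<gamma>1 has_vector_derivative \<gamma>2 t) (at t within {0..1}) \<and> \<gamma>1 t \<noteq> 0)
     \<and> continuous_on {0..1} \<gamma>2"

lemma c2_arc_iff: "c2_arc \<gamma> \<longleftrightarrow> (\<exists>\<gamma>1 \<gamma>2. c2_param \<gamma> \<gamma>1 \<gamma>2)"
  unfolding c2_arc_def c2_param_def by blast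

lemma c2_paramD:
  assumes "c2_param \<gamma> \<gamma>1 \<gamma>2"
  shows "inj_on \<gamma> {0..1}"
    and "t \<in> {0..1} \<Longrightarrow> (\<gamma> has_vector_derivative \<gamma>1 t) (at t within {0..1})"
    and "t \<in> {0..1} \<Longrightarrow> (\<gamma>1 has_vector_derivative \<gamma>2 t) (at t within {0..1})"
    and "t \<in> {0..1} \<Longrightarrow> \<gamma>1 t \<noteq> 0"
    and "continuous_on {0..1} \<gamma>" "continuous_on {0..1} \<gamma>1" "continuous_on {0..1} \<gamma>2"
  using assms unfolding c2_param_def
  by (auto simp: continuous_on_eq_continuous_within intro!: has_vector_derivative_continuous)

text \<open>Crossing a chord with the tangent removes its first-order part; over the squared
  parameter increment there remains half the curvature numerator. Sequences are used because two
  arcs will be compared only along common points.\<close>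

lemma chord_limits:
  assumes c: "c2_param \<gamma> \<gamma>1 \<gamma>2" and t: "t \<in> {0..1}"
    and s: "\<And>n. s n \<in> {0..1}" "\<And>n. s n \<noteq> t" "s \<longlonglongrightarrow> t"
  shows "(\<lambda>n. (1 / (s n - t)) *\<^sub>R (\<gamma> (s n) - \<gamma> t)) \<longlonglongrightarrow> \<gamma>1 t"
    and "(\<lambda>n. cross2 (\<gamma> (s n) - \<gamma> t) (\<gamma>1 t) / (s n - t)\<^sup>2) \<longlonglongrightarrow> cross2 (\<gamma>2 t) (\<gamma>1 t) / 2"
proof -
  have fl: "filterlim s (at t within {0..1}) sequentially"
    unfolding filterlim_at using s by (auto intro!: always_eventually)
  have "((\<lambda>y. (1 / (y - t)) *\<^sub>R (\<gamma> y - \<gamma> t)) \<longlongrightarrow> \<gamma>1 t) (at t within {0..1})"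
  proof -
    have "((\<lambda>y. (f (\<gamma> y) - f (\<gamma> t)) / (y - t)) \<longlongrightarrow> f (\<gamma>1 t)) (at t within {0..1})"
      if "bounded_linear f" for f :: "pt \<Rightarrow> real"
      using bounded_linear.has_vector_derivative[OF that c2_paramD(2)[OF c t]]
      by (simp flip: has_real_derivative_iff_has_vector_derivative add: has_field_derivative_iff)
    from tendsto_Pair[OF this[OF bounded_linear_fst] this[OF bounded_linear_snd]]
    show ?thesis by (simp add: scaleR_prod_def)
  qed
  from filterlim_compose[OF this fl]
  show "(\<lambda>n. (1 / (s n - t)) *\<^sub>R (\<gamma> (s n) - \<gamma> t)) \<longlonglongrightarrow> \<gamma>1 t" .
  have "((\<lambda>y. (cross2 (\<gamma> y) (\<gamma>1 t) - cross2 (\<gamma> t) (\<gamma>1 t)) / (y - t)\<^sup>2) \<longlongrightarrow> cross2 (\<gamma>2 t) (\<gamma>1 t) / 2)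
      (at t within {0..1})"
    using t by (intro second_order_limit[of "{0..1}" t _ "\<lambda>s. cross2 (\<gamma>1 s) (\<gamma>1 t)"]
        has_real_derivative_cross2 c2_paramD[OF c])
      (auto simp: cross2_def)
  from filterlim_compose[OF this fl]
  show "(\<lambda>n. cross2 (\<gamma> (s n) - \<gamma> t) (\<gamma>1 t) / (s n - t)\<^sup>2) \<longlonglongrightarrow> cross2 (\<gamma>2 t) (\<gamma>1 t) / 2"
    by (simp add: cross2_minus)
qed

text \<open>Curvature |cross2 (\<gamma>2) (\<gamma>1)| / |\<gamma>1|^3 is a property of the points:
  two arcs that share a sequence of points with its limit share the chords \<open>w n\<close>.
  Scaled by either parameter, these chords tend to either tangent, so the tangents are parallel, and
  the two second-order limits differ by the limit of the squared ratio of parameter increments. The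
  equation is cleared of denominators.\<close>

lemma curvature_unique:
  assumes c: "c2_param \<gamma> \<gamma>1 \<gamma>2" and t: "t \<in> {0..1}"
    and s: "\<And>n. s n \<in> {0..1}" "\<And>n. s n \<noteq> t" "s \<longlonglongrightarrow> t"
    and c': "c2_param \<delta> \<delta>1 \<delta>2" and t': "t' \<in> {0..1}"
    and s': "\<And>n. s' n \<in> {0..1}" "\<And>n. s' n \<noteq> t'" "s' \<longlonglongrightarrow> t'"
    and eq: "\<And>n. \<gamma> (s n) = \<delta> (s' n)" "\<gamma> t = \<delta> t'"
  shows "\<bar>cross2 (\<gamma>2 t) (\<gamma>1 t)\<bar> * norm (\<delta>1 t') ^ 3 = \<bar>cross2 (\<delta>2 t') (\<delta>1 t')\<bar> * norm (\<gamma>1 t) ^ 3"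
proof -
  define w where "w n = \<gamma> (s n) - \<gamma> t" for n
  define u where "u n = (1 / (s n - t)) *\<^sub>R w n" for n
  define v where "v n = (1 / (s' n - t')) *\<^sub>R w n" for n
  define r where "r n = (s' n - t') / (s n - t)" for n
  have w: "w n = \<delta> (s' n) - \<delta> t'" for n using eq by (simp add: w_def)
  have u: "u \<longlonglongrightarrow> \<gamma>1 t" unfolding u_def w_def by (rule chord_limits(1)[OF c t s])
  have v: "v \<longlonglongrightarrow> \<delta>1 t'" unfolding v_def w by (rule chord_limits(1)[OF c' t' s'])
  have A: "(\<lambda>n. cross2 (w n) (\<gamma>1 t) / (s n - t)\<^sup>2) \<longlonglongrightarrow> cross2 (\<gamma>2 t) (\<gamma>1 t) / 2"
    using chord_limits(2)[OF c t s] by (simp add: w_def)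
  have B: "(\<lambda>n. cross2 (w n) (\<delta>1 t') / (s' n - t')\<^sup>2) \<longlonglongrightarrow> cross2 (\<delta>2 t') (\<delta>1 t') / 2"
    using chord_limits(2)[OF c' t' s'] by (simp add: w)
  have g0: "\<gamma>1 t \<noteq> 0" and d0: "\<delta>1 t' \<noteq> 0" using c2_paramD(4) c c' t t' by auto
  have "(\<lambda>n. cross2 (u n) (v n)) \<longlonglongrightarrow> cross2 (\<gamma>1 t) (\<delta>1 t')"
    unfolding cross2_def using u v by (intro tendsto_intros)
  moreover have "cross2 (u n) (v n) = 0" for n by (simp add: u_def v_def cross2_def)
  ultimately have par: "cross2 (\<gamma>1 t) (\<delta>1 t') = 0" by (simp add: LIMSEQ_const_iff)
  define k where "k = inner (\<gamma>1 t) (\<delta>1 t') / (norm (\<gamma>1 t))\<^sup>2"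
  have nz: "fst (\<gamma>1 t) * fst (\<gamma>1 t) + snd (\<gamma>1 t) * snd (\<gamma>1 t) \<noteq> 0"
    using g0 by (simp add: prod_eq_iff sum_squares_eq_zero_iff)
  have k: "\<delta>1 t' = k *\<^sub>R \<gamma>1 t"
    unfolding prod_eq_iff k_def power2_norm_eq_inner inner_pt fst_scaleR snd_scaleR
    using par nz unfolding cross2_def by (auto simp: field_simps; algebra)
  \<comment> \<open>Only the square of the ratio is needed, so the relative orientation of the two
    arcs never has to be decided.\<close>
  have r2: "(\<lambda>n. (r n)\<^sup>2) \<longlonglongrightarrow> (norm (\<gamma>1 t))\<^sup>2 / (norm (\<delta>1 t'))\<^sup>2"
  proof -
    have "(\<lambda>n. (norm (u n))\<^sup>2 / (norm (v n))\<^sup>2) \<longlonglongrightarrow> (norm (\<gamma>1 t))\<^sup>2 / (norm (\<delta>1 t'))\<^sup>2"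
      using u v d0 by (intro tendsto_intros) auto
    moreover have "(norm (u n))\<^sup>2 / (norm (v n))\<^sup>2 = (r n)\<^sup>2" for n
    proof -
      have "w n \<noteq> 0"
        using inj_onD[OF c2_paramD(1)[OF c], of "s n" t] s(1,2)[of n] t by (auto simp: w_def)
      then show ?thesis using s(2)[of n] s'(2)[of n]
        by (simp add: u_def v_def r_def power_mult_distrib power_divide field_simps)
    qed
    ultimately show ?thesis by simp
  qed
  have "(\<lambda>n. cross2 (w n) (\<delta>1 t') / (s' n - t')\<^sup>2 * (r n)\<^sup>2) \<longlonglongrightarrow>
      cross2 (\<delta>2 t') (\<delta>1 t') / 2 * ((norm (\<gamma>1 t))\<^sup>2 / (norm (\<delta>1 t'))\<^sup>2)"
    by (intro tendsto_mult B r2)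
  moreover have "(\<lambda>n. k * (cross2 (w n) (\<gamma>1 t) / (s n - t)\<^sup>2)) \<longlonglongrightarrow> k * (cross2 (\<gamma>2 t) (\<gamma>1 t) / 2)"
    by (intro tendsto_intros A)
  moreover have "cross2 (w n) (\<delta>1 t') / (s' n - t')\<^sup>2 * (r n)\<^sup>2 = k * (cross2 (w n) (\<gamma>1 t) / (s n - t)\<^sup>2)" for n
    using s(2)[of n] s'(2)[of n] by (simp add: k r_def power_divide)
  ultimately have "k * (cross2 (\<gamma>2 t) (\<gamma>1 t) / 2) = cross2 (\<delta>2 t') (\<delta>1 t') / 2 * ((norm (\<gamma>1 t))\<^sup>2 / (norm (\<delta>1 t'))\<^sup>2)"
    by (simp only:) (rule LIMSEQ_unique)
  then have "k * cross2 (\<gamma>2 t) (\<gamma>1 t) * (norm (\<delta>1 t'))\<^sup>2 = cross2 (\<delta>2 t') (\<delta>1 t') * (norm (\<gamma>1 t))\<^sup>2"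
    using d0 by (simp add: field_simps)
  then have E: "\<bar>k\<bar> * \<bar>cross2 (\<gamma>2 t) (\<gamma>1 t)\<bar> * (norm (\<delta>1 t'))\<^sup>2 = \<bar>cross2 (\<delta>2 t') (\<delta>1 t')\<bar> * (norm (\<gamma>1 t))\<^sup>2"
    by (metis abs_mult abs_of_nonneg zero_le_power2)
  have nk: "norm (\<delta>1 t') = \<bar>k\<bar> * norm (\<gamma>1 t)" by (simp add: k)
  have "\<bar>cross2 (\<gamma>2 t) (\<gamma>1 t)\<bar> * norm (\<delta>1 t') ^ 3
      = \<bar>cross2 (\<gamma>2 t) (\<gamma>1 t)\<bar> * (norm (\<delta>1 t'))\<^sup>2 * norm (\<delta>1 t')"
    by (simp add: power3_eq_cube power2_eq_square)
  also have "\<dots> = (\<bar>k\<bar> * \<bar>cross2 (\<gamma>2 t) (\<gamma>1 t)\<bar> * (norm (\<delta>1 t'))\<^sup>2) * norm (\<gamma>1 t)"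
    by (subst (2) nk) (simp add: algebra_simps)
  also have "\<dots> = \<bar>cross2 (\<delta>2 t') (\<delta>1 t')\<bar> * norm (\<gamma>1 t) ^ 3"
    unfolding E by (simp add: power3_eq_cube power2_eq_square)
  finally show ?thesis .
qed

lemma c2_param_curvature_bound:
  assumes c: "c2_param \<gamma> \<gamma>1 \<gamma>2"
  shows "\<exists>K. \<forall>t\<in>{0..1}. \<bar>cross2 (\<gamma>2 t) (\<gamma>1 t)\<bar> \<le> K * norm (\<gamma>1 t) ^ 3"
proof -
  have "continuous_on {0..1} (\<lambda>t. cross2 (\<gamma>2 t) (\<gamma>1 t) / norm (\<gamma>1 t) ^ 3)"
    unfolding cross2_def using c2_paramD[OF c] by (intro continuous_intros) auto
  then have "bounded ((\<lambda>t. cross2 (\<gamma>2 t) (\<gamma>1 t) / norm (\<gamma>1 t) ^ 3) ` {0..1})"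
    by (intro compact_imp_bounded compact_continuous_image) auto
  then obtain K where K: "\<And>t. t \<in> {0..1} \<Longrightarrow> \<bar>cross2 (\<gamma>2 t) (\<gamma>1 t) / norm (\<gamma>1 t) ^ 3\<bar> \<le> K"
    unfolding bounded_iff ball_simps real_norm_def by blast
  show ?thesis
  proof (intro exI ballI)
    fix t :: real assume t: "t \<in> {0..1}"
    show "\<bar>cross2 (\<gamma>2 t) (\<gamma>1 t)\<bar> \<le> K * norm (\<gamma>1 t) ^ 3"
      using K[OF t] c2_paramD(4)[OF c t] by (simp add: abs_divide divide_le_eq)
  qed
qed

text \<open>Infinite pigeonhole along a sequence tending to \<open>t\<close>; the sets
  \<open>X a\<close> need no topology.\<close>

lemma limit_point_in_finite_cover:
  fixes t :: real
  assumes A: "finite A" and t: "t \<in> {0..1}" and cov: "\<And>x. x \<in> {0..1} \<Longrightarrow> \<exists>a\<in>A. x \<in> X a"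
  obtains a s where "a \<in> A" "\<And>n::nat. s n \<in> {0..1}" "\<And>n. s n \<in> X a" "\<And>n. s n \<noteq> t" "s \<longlonglongrightarrow> t"
proof -
  have "t islimpt {0..1::real}" using t by simp
  then obtain f where f: "\<And>n::nat. f n \<in> {0..1} - {t}" "f \<longlonglongrightarrow> t"
    unfolding islimpt_sequential by blast
  have "\<forall>n. \<exists>a. a \<in> A \<and> f n \<in> X a" using cov f by blast
  then obtain a where a: "\<And>n. a n \<in> A" "\<And>n. f n \<in> X (a n)" by metis
  have "\<exists>k\<in>UNIV. infinite {n \<in> UNIV. a n = a k}"
    using finite_subset[of "range a" A] A a by (intro pigeonhole_infinite) auto
  then obtain k where k: "infinite {n. a n = a k}" by auto
  obtain r :: "nat \<Rightarrow> nat" where r: "strict_mono r" "\<And>n. r n \<in> {n. a n = a k}"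
    using infinite_enumerate[OF k] by blast
  show ?thesis
  proof (rule that[of "a k" "f \<circ> r"])
    show "(f \<circ> r) n \<in> X (a k)" for n using a(2)[of "r n"] r(2)[of n] by auto
    show "(f \<circ> r) n \<in> {0..1}" "(f \<circ> r) n \<noteq> t" for n using f(1)[of "r n"] by auto
    show "(f \<circ> r) \<longlonglongrightarrow> t" using LIMSEQ_subseq_LIMSEQ[OF f(2) r(1)] .
  qed (rule a)
qed

text \<open>Each parameter is a limit of parameters mapped into a single arc of the finite family; there the
  subarc and that arc have the same second-order limit, hence the same curvature.\<close>

lemma subarc_curvature_bound:
  assumes "piecewise_C2 \<Gamma>"
  obtains K where "K \<ge> 0" "\<And>\<gamma> \<gamma>1 \<gamma>2 t. c2_param \<gamma> \<gamma>1 \<gamma>2 \<Longrightarrow> \<gamma> ` {0..1} \<subseteq> \<Gamma> \<Longrightarrow> t \<in> {0..1} \<Longrightarrow>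
     \<bar>cross2 (\<gamma>2 t) (\<gamma>1 t)\<bar> \<le> K * norm (\<gamma>1 t) ^ 3"
proof -
  obtain A where A: "finite A" "\<And>\<delta>. \<delta> \<in> A \<Longrightarrow> c2_arc \<delta>" "\<Gamma> = (\<Union>\<delta>\<in>A. \<delta> ` {0..1})"
    using assms unfolding piecewise_C2_def by auto
  have "\<forall>\<delta>. \<exists>\<delta>1 \<delta>2 K. \<delta> \<in> A \<longrightarrow> c2_param \<delta> \<delta>1 \<delta>2 \<and>
      (\<forall>t\<in>{0..1}. \<bar>cross2 (\<delta>2 t) (\<delta>1 t)\<bar> \<le> K * norm (\<delta>1 t) ^ 3)"
  proof
    fix \<delta>
    show "\<exists>\<delta>1 \<delta>2 K. \<delta> \<in> A \<longrightarrow> c2_param \<delta> \<delta>1 \<delta>2 \<and>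
      (\<forall>t\<in>{0..1}. \<bar>cross2 (\<delta>2 t) (\<delta>1 t)\<bar> \<le> K * norm (\<delta>1 t) ^ 3)"
    proof (cases "\<delta> \<in> A")
      case True
      then obtain \<delta>1 \<delta>2 where c: "c2_param \<delta> \<delta>1 \<delta>2" using A(2) c2_arc_iff by blast
      show ?thesis using c2_param_curvature_bound[OF c] c by blast
    qed blast
  qed
  then obtain d1 d2 k where d: "\<And>\<delta>. \<delta> \<in> A \<Longrightarrow> c2_param \<delta> (d1 \<delta>) (d2 \<delta>)"
    and k: "\<And>\<delta> t. \<delta> \<in> A \<Longrightarrow> t \<in> {0..1} \<Longrightarrow> \<bar>cross2 (d2 \<delta> t) (d1 \<delta> t)\<bar> \<le> k \<delta> * norm (d1 \<delta> t) ^ 3"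
    unfolding choice_iff by blast
  define K where "K = (\<Sum>\<delta>\<in>A. \<bar>k \<delta>\<bar>)"
  have kK: "k \<delta> \<le> K" if "\<delta> \<in> A" for \<delta>
    using member_le_sum[of \<delta> A "\<lambda>\<delta>. \<bar>k \<delta>\<bar>"] that A(1) unfolding K_def by fastforce
  show ?thesis
  proof (rule that[of K])
    show "K \<ge> 0" unfolding K_def by (intro sum_nonneg) auto
    fix \<gamma> \<gamma>1 \<gamma>2 and t :: real
    assume c: "c2_param \<gamma> \<gamma>1 \<gamma>2" and sub: "\<gamma> ` {0..1} \<subseteq> \<Gamma>" and t: "t \<in> {0..1}"
    have cov: "\<exists>\<delta>\<in>A. x \<in> {x. \<gamma> x \<in> \<delta> ` {0..1}}" if "x \<in> {0..1}" for x
    proof -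
      have "\<gamma> x \<in> (\<Union>\<delta>\<in>A. \<delta> ` {0..1})" using sub that unfolding A(3)[symmetric] by blast
      then show ?thesis by blast
    qed
    obtain \<delta> s where \<delta>: "\<delta> \<in> A" and s: "\<And>n::nat. s n \<in> {0..1}" "\<And>n. s n \<in> {x. \<gamma> x \<in> \<delta> ` {0..1}}"
      "\<And>n. s n \<noteq> t" "s \<longlonglongrightarrow> t"
      using limit_point_in_finite_cover[OF A(1) t, of "\<lambda>\<delta>. {x. \<gamma> x \<in> \<delta> ` {0..1}}", OF cov] by blast
    obtain s' where s': "\<And>n. s' n \<in> {0..1}" "\<And>n. \<gamma> (s n) = \<delta> (s' n)"
      using s(2) unfolding mem_Collect_eq image_iff by metis
    obtain t' r where t': "t' \<in> {0..1}" and r: "strict_mono r" "(s' \<circ> r) \<longlonglongrightarrow> t'"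
      using compact_Icc[of 0 "1::real"] s'(1) unfolding compact_def by metis
    have rs: "(s \<circ> r) \<longlonglongrightarrow> t" using LIMSEQ_subseq_LIMSEQ[OF s(4) r(1)] .
    have "(\<lambda>n. \<gamma> ((s \<circ> r) n)) \<longlonglongrightarrow> \<gamma> t"
      using rs s(1) t unfolding o_def by (intro continuous_on_tendsto_compose[OF c2_paramD(5)[OF c]]) auto
    moreover have "(\<lambda>n. \<delta> ((s' \<circ> r) n)) \<longlonglongrightarrow> \<delta> t'"
      using r(2) s'(1) t' unfolding o_def by (intro continuous_on_tendsto_compose[OF c2_paramD(5)[OF d[OF \<delta>]]]) auto
    ultimately have eq: "\<gamma> t = \<delta> t'" using s'(2) LIMSEQ_unique by simp
    \<comment> \<open>A parameter equal to \<open>t'\<close> would put \<open>\<gamma> (s n)\<close>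
      at \<open>\<gamma> t\<close>, against injectivity of \<gamma>. This makes the sequence on the
      second arc admissible for the curvature comparison.\<close>
    have ne: "s' n \<noteq> t'" for n
      using inj_onD[OF c2_paramD(1)[OF c], of "s n" t] s(1,3)[of n] t s'(2)[of n] eq by auto
    have E: "\<bar>cross2 (\<gamma>2 t) (\<gamma>1 t)\<bar> * norm (d1 \<delta> t') ^ 3 = \<bar>cross2 (d2 \<delta> t') (d1 \<delta> t')\<bar> * norm (\<gamma>1 t) ^ 3"
      by (rule curvature_unique[OF c t _ _ rs d[OF \<delta>] t' _ _ r(2)]) (use s s' ne eq in auto)
    also have "\<dots> \<le> (k \<delta> * norm (d1 \<delta> t') ^ 3) * norm (\<gamma>1 t) ^ 3"
      using k[OF \<delta> t'] by (intro mult_right_mono) auto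
    finally have "\<bar>cross2 (\<gamma>2 t) (\<gamma>1 t)\<bar> * norm (d1 \<delta> t') ^ 3 \<le> (k \<delta> * norm (\<gamma>1 t) ^ 3) * norm (d1 \<delta> t') ^ 3"
      by (simp add: mult_ac)
    then have "\<bar>cross2 (\<gamma>2 t) (\<gamma>1 t)\<bar> \<le> k \<delta> * norm (\<gamma>1 t) ^ 3"
      using c2_paramD(4)[OF d[OF \<delta>] t'] by simp
    also have "\<dots> \<le> K * norm (\<gamma>1 t) ^ 3" using kK[OF \<delta>] by (intro mult_right_mono) auto
    finally show "\<bar>cross2 (\<gamma>2 t) (\<gamma>1 t)\<bar> \<le> K * norm (\<gamma>1 t) ^ 3" .
  qed
qed

section \<open>Short arcs: tangents and chords stay close to one direction\<close>

lemma derivative_le_imp_increment_le: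
  fixes f g :: "real \<Rightarrow> real"
  assumes ab: "a \<le> b"
    and f: "\<And>x. x \<in> {a..b} \<Longrightarrow> (f has_real_derivative f' x) (at x within {a..b})"
    and g: "\<And>x. x \<in> {a..b} \<Longrightarrow> (g has_real_derivative g' x) (at x within {a..b})"
    and le: "\<And>x. x \<in> {a..b} \<Longrightarrow> \<bar>f' x\<bar> \<le> g' x"
  shows "\<bar>f b - f a\<bar> \<le> g b - g a"
proof -
  have mono: "k a \<le> k b" if k: "\<And>x. x \<in> {a..b} \<Longrightarrow> (k has_real_derivative k' x) (at x within {a..b})"
    and pos: "\<And>x. x \<in> {a..b} \<Longrightarrow> 0 \<le> k' x" for k k' :: "real \<Rightarrow> real"
  proof (rule DERIV_nonneg_imp_increasing_open[OF ab])
    fix x assume x: "a < x" "x < b"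
    then have "at x within {a..b} = at x" by (intro at_within_interior) auto
    then show "\<exists>y. (k has_real_derivative y) (at x) \<and> 0 \<le> y" using k[of x] pos[of x] x by auto
    next
    show "continuous_on {a..b} k"
      unfolding continuous_on_eq_continuous_within using k DERIV_continuous by blast
  qed
  have "g a - f a \<le> g b - f b"
    by (rule mono[of _ "\<lambda>x. g' x - f' x"]) (use f g le in \<open>auto intro!: derivative_intros simp: abs_le_iff\<close>)
  moreover have "g a + f a \<le> g b + f b"
    by (rule mono[of _ "\<lambda>x. g' x + f' x"])
      (use f g le in \<open>auto intro!: derivative_intros simp: abs_le_iff minus_le_iff add.commute\<close>, smt (verit, best) le atLeastAtMost_iff)
  ultimately show ?thesis by linarith
qed

text \<open>Take for \<open>w\<close> the initial unit tangent and follow the slope q / p of the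
  tangent in its frame. As long as |q| \<le> p, the derivative of the slope is at most 4 K p, which
  is the derivative of 4 K times the abscissa; as the abscissa varies by at most \<delta>, the slope
  stays below 4 K \<delta> < 1. A continuity argument then shows that the cone |q| \<le> p is never
  left.\<close>

lemma short_arc_is_flat:
  assumes c: "c2_param \<gamma> \<gamma>1 \<gamma>2"
    and K: "\<And>t. t \<in> {0..1} \<Longrightarrow> \<bar>cross2 (\<gamma>2 t) (\<gamma>1 t)\<bar> \<le> K * norm (\<gamma>1 t) ^ 3" "K \<ge> 0"
    and diam: "\<And>s t. s \<in> {0..1} \<Longrightarrow> t \<in> {0..1} \<Longrightarrow> dist (\<gamma> s) (\<gamma> t) \<le> \<delta>"
    and small: "4 * K * \<delta> < 1"
  obtains w where "norm w = 1"
    "\<And>t. t \<in> {0..1} \<Longrightarrow> inner (\<gamma>1 t) w > 0"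
    "\<And>t. t \<in> {0..1} \<Longrightarrow> \<bar>cross2 (\<gamma>1 t) w\<bar> \<le> 4 * K * \<delta> * inner (\<gamma>1 t) w"
proof -
  define w where "w = (1 / norm (\<gamma>1 0)) *\<^sub>R \<gamma>1 0"
  define p where "p t = inner (\<gamma>1 t) w" for t
  define q where "q t = cross2 (\<gamma>1 t) w" for t
  have nw: "norm w = 1" using c2_paramD(4)[OF c, of 0] by (simp add: w_def)
  have pq: "(p t)\<^sup>2 + (q t)\<^sup>2 = (norm (\<gamma>1 t))\<^sup>2" for t
    using lagrange_pt[of "\<gamma>1 t" w] nw by (simp add: p_def q_def)
  have cp: "continuous_on {0..1} p" and cq: "continuous_on {0..1} q"
    unfolding p_def q_def cross2_def using c2_paramD(6)[OF c] by (auto intro!: continuous_intros)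
  \<comment> \<open>The cone condition on [0, b] returns a strictly better bound at b; this
    improvement closes the continuity argument below.\<close>
  have slope: "\<bar>q b\<bar> \<le> 4 * K * \<delta> * p b" and pos: "p b > 0"
    if b: "b \<in> {0..1}" and pos': "\<And>s. s \<in> {0..b} \<Longrightarrow> p s > 0 \<and> \<bar>q s\<bar> \<le> p s" for b
  proof -
    have "\<bar>q b / p b - q 0 / p 0\<bar> \<le> 4 * K * inner (\<gamma> b) w - 4 * K * inner (\<gamma> 0) w"
    proof (rule derivative_le_imp_increment_le)
      fix s assume s: "s \<in> {0..b}"
      then have s1: "s \<in> {0..1}" using b by auto
      have ps: "p s > 0" "\<bar>q s\<bar> \<le> p s" using pos'[OF s] by auto
      have "((\<lambda>s. 4 * K * inner (\<gamma> s) w) has_real_derivative 4 * K * p s) (at s within {0..1})"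
        using has_real_derivative_inner_left[OF c2_paramD(2)[OF c s1], of w]
        unfolding p_def by (intro DERIV_cmult) auto
      then show "((\<lambda>s. 4 * K * inner (\<gamma> s) w) has_real_derivative 4 * K * p s) (at s within {0..b})"
        by (rule DERIV_subset) (use b in auto)
      have "((\<lambda>s. q s / p s) has_real_derivative
          (cross2 (\<gamma>2 s) w * p s - q s * inner (\<gamma>2 s) w) / (p s * p s)) (at s within {0..1})"
        using ps unfolding p_def q_def
        by (intro DERIV_divide has_real_derivative_cross2 has_real_derivative_inner_left c2_paramD(3)[OF c s1]) auto
      then show "((\<lambda>s. q s / p s) has_real_derivative
          (cross2 (\<gamma>2 s) w * p s - q s * inner (\<gamma>2 s) w) / (p s * p s)) (at s within {0..b})"
        by (rule DERIV_subset) (use b in auto)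
      \<comment> \<open>The numerator of the quotient rule is the curvature numerator, because w is
        a unit vector.\<close>
      have "cross2 (\<gamma>2 s) w * p s - q s * inner (\<gamma>2 s) w = cross2 (\<gamma>2 s) (\<gamma>1 s) * (norm w)\<^sup>2"
        unfolding power2_norm_eq_inner p_def q_def cross2_def inner_pt by (simp add: algebra_simps)
      then have e: "cross2 (\<gamma>2 s) w * p s - q s * inner (\<gamma>2 s) w = cross2 (\<gamma>2 s) (\<gamma>1 s)" using nw by simp
      \<comment> \<open>In the cone, |\<gamma>1|^2 \<le> 2 p^2 and |\<gamma>1| \<le> 2 p; their
        product is the origin of the factor 4.\<close>
      have "(norm (\<gamma>1 s))\<^sup>2 \<le> 2 * (p s)\<^sup>2"
        using pq[of s] ps abs_le_square_iff[of "q s" "p s"] by simp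
      moreover have "norm (\<gamma>1 s) \<le> 2 * p s"
        by (rule power2_le_imp_le) (use calculation ps in \<open>auto simp: power_mult_distrib intro: order_trans\<close>)
      ultimately have "(norm (\<gamma>1 s))\<^sup>2 * norm (\<gamma>1 s) \<le> (2 * (p s)\<^sup>2) * (2 * p s)"
        by (intro mult_mono) auto
      then have "norm (\<gamma>1 s) ^ 3 \<le> 4 * p s ^ 3"
        by (simp add: power3_eq_cube power2_eq_square)
      then have "K * norm (\<gamma>1 s) ^ 3 \<le> K * (4 * p s ^ 3)"
        using K(2) by (rule mult_left_mono)
      then have "\<bar>cross2 (\<gamma>2 s) (\<gamma>1 s)\<bar> \<le> 4 * K * p s * (p s * p s)"
        using K(1)[OF s1] by (simp add: power3_eq_cube)
      then show "\<bar>(cross2 (\<gamma>2 s) w * p s - q s * inner (\<gamma>2 s) w) / (p s * p s)\<bar> \<le> 4 * K * p s"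
        unfolding e using ps by (simp add: abs_divide divide_le_eq)
    qed (use b in auto)
    moreover have "q 0 = 0" by (simp add: q_def w_def cross2_def)
    moreover have "inner (\<gamma> b) w - inner (\<gamma> 0) w \<le> \<delta>"
      using norm_cauchy_schwarz[of "\<gamma> b - \<gamma> 0" w] diam[of b 0] b nw by (simp add: inner_diff_left dist_norm)
    then have "4 * K * inner (\<gamma> b) w - 4 * K * inner (\<gamma> 0) w \<le> 4 * K * \<delta>"
      using K(2) by (metis (no_types, opaque_lifting) mult_left_mono mult_nonneg_nonneg right_diff_distrib zero_le_numeral)
    ultimately have "\<bar>q b / p b\<bar> \<le> 4 * K * \<delta>" by simp
    moreover show "p b > 0" using pos'[of b] b by auto
    ultimately show "\<bar>q b\<bar> \<le> 4 * K * \<delta> * p b" by (simp add: abs_divide divide_le_eq)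
  qed
  have all: "\<bar>q t\<bar> < p t" if "t \<in> {0..1}" for t
  proof (rule ccontr)
    \<comment> \<open>The infimum b of \<open>B\<close> is the first parameter at which the tangent
      reaches the edge of the cone. By closedness the cone condition still holds at b, so the
      improved bound applies there and contradicts b being in \<open>B\<close>.\<close>
    define B where "B = {t \<in> {0..1}. p t \<le> \<bar>q t\<bar>}"
    assume "\<not> ?thesis"
    then have ne: "B \<noteq> {}" using that by (auto simp: B_def)
    have cl: "closed B" unfolding B_def
      by (intro continuous_on_closed_Collect_le) (auto intro!: continuous_intros cp cq)
    have bb: "bdd_below B" by (rule bdd_belowI[of _ 0]) (auto simp: B_def)
    define b where "b = Inf B"
    have bB: "b \<in> B" unfolding b_def using closed_contains_Inf[OF ne bb cl] .
    then have b: "b \<in> {0..1}" "p b \<le> \<bar>q b\<bar>" by (auto simp: B_def)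
    have less: "\<bar>q s\<bar> < p s" if "s \<in> {0..<b}" for s
      using cInf_lower[OF _ bb, of s] that b(1) by (force simp: B_def b_def)
    have "q 0 = 0" "p 0 > 0" using c2_paramD(4)[OF c, of 0]
      by (auto simp: q_def p_def w_def cross2_def simp flip: power2_norm_eq_inner)
    then have b0: "b > 0" using b by (cases "b = 0") auto
    have le: "\<bar>q b\<bar> \<le> p b"
    proof -
      have "b \<in> closure {0..<b}" using b0 by simp
      moreover have "closed {t \<in> {0..1}. \<bar>q t\<bar> \<le> p t}"
        by (intro continuous_on_closed_Collect_le) (auto intro!: continuous_intros cp cq)
      moreover have "{0..<b} \<subseteq> {t \<in> {0..1}. \<bar>q t\<bar> \<le> p t}" using less b by force
      ultimately show ?thesis using closure_minimal by blast
    qed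
    have pb: "p b > 0"
    proof (rule ccontr)
      assume "\<not> p b > 0"
      then have "p b = 0" "q b = 0" using le by auto
      then show False using pq[of b] c2_paramD(4)[OF c b(1)] by simp
    qed
    have "\<bar>q b\<bar> \<le> 4 * K * \<delta> * p b"
    proof (rule slope[OF b(1)])
      fix s assume "s \<in> {0..b}"
      then consider "s = b" | "s \<in> {0..<b}" by fastforce
      then show "p s > 0 \<and> \<bar>q s\<bar> \<le> p s"
        using le pb less[of s] by cases auto
    qed
    also have "\<dots> < 1 * p b" using small pb by (intro mult_strict_right_mono) auto
    finally show False using b by simp
  qed
  show ?thesis
  proof (rule that[OF nw])
    fix t :: real assume t: "t \<in> {0..1}"
    have pos: "p s > 0 \<and> \<bar>q s\<bar> \<le> p s" if "s \<in> {0..t}" for s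
      using all[of s] that t by auto
    show "inner (\<gamma>1 t) w > 0" using pos[of t] t by (simp add: p_def)
    show "\<bar>cross2 (\<gamma>1 t) w\<bar> \<le> 4 * K * \<delta> * inner (\<gamma>1 t) w"
      using slope[OF t pos] by (simp add: p_def q_def)
  qed
qed

text \<open>For a unit vector w, \<open>inner p w\<close> and \<open>cross2 p w\<close> are
  coordinates of p in an orthonormal frame; slopes and small angles are ratios of the two.\<close>

lemma inner_pt_frame:
  assumes "norm (w::pt) = 1"
  shows "inner p q = inner p w * inner q w + cross2 p w * cross2 q w"
    and "cross2 p q = cross2 p w * inner q w - inner p w * cross2 q w"
proof -
  have w: "fst w * fst w + snd w * snd w = 1"
    using assms power2_norm_eq_inner[of w] by (simp add: inner_pt)
  show "inner p q = inner p w * inner q w + cross2 p w * cross2 q w"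
    using w unfolding inner_pt cross2_def by algebra
  show "cross2 p q = cross2 p w * inner q w - inner p w * cross2 q w"
    using w unfolding inner_pt cross2_def by algebra
qed

text \<open>A quarter turn exchanges the two coordinates up to sign, so a normal to a direction of
  slope at most \<theta> is equally close to the normal of \<open>w\<close>.\<close>

lemma perpendicular_slope:
  assumes w: "norm (w::pt) = 1" and n: "inner n p = 0" and p: "p \<noteq> 0"
    and le: "\<bar>cross2 p w\<bar> \<le> \<theta> * \<bar>inner p w\<bar>"
  shows "\<bar>inner n w\<bar> \<le> \<theta> * \<bar>cross2 n w\<bar>"
proof -
  have "inner p w \<noteq> 0"
    using le p lagrange_pt[of p w] w by auto
  moreover have "\<bar>inner n w\<bar> * \<bar>inner p w\<bar> = \<bar>cross2 n w\<bar> * \<bar>cross2 p w\<bar>"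
    using n inner_pt_frame(1)[OF w, of n p] by (simp flip: abs_mult)
  then have "\<bar>inner n w\<bar> * \<bar>inner p w\<bar> \<le> (\<theta> * \<bar>cross2 n w\<bar>) * \<bar>inner p w\<bar>"
    using mult_left_mono[OF le, of "\<bar>cross2 n w\<bar>"] by (simp add: mult_ac)
  ultimately show ?thesis by simp
qed

text \<open>The slope bound for tangents integrates to one for chords; the absolute value on the
  right makes the order of the end points irrelevant.\<close>

lemma flat_arc_chord:
  assumes c: "c2_param \<gamma> \<gamma>1 \<gamma>2"
    and flat: "\<And>t. t \<in> {0..1} \<Longrightarrow> \<bar>cross2 (\<gamma>1 t) w\<bar> \<le> \<theta> * inner (\<gamma>1 t) w"
    and ab: "a \<in> {0..1}" "b \<in> {0..1}" and th: "\<theta> \<ge> 0"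
  shows "\<bar>cross2 (\<gamma> b - \<gamma> a) w\<bar> \<le> \<theta> * \<bar>inner (\<gamma> b - \<gamma> a) w\<bar>"
proof -
  have *: "\<bar>cross2 (\<gamma> b - \<gamma> a) w\<bar> \<le> \<theta> * inner (\<gamma> b - \<gamma> a) w"
    if ab: "a \<in> {0..1}" "b \<in> {0..1}" and le: "a \<le> b" for a b
  proof -
    have "\<bar>cross2 (\<gamma> b) w - cross2 (\<gamma> a) w\<bar> \<le> \<theta> * inner (\<gamma> b) w - \<theta> * inner (\<gamma> a) w"
    proof (rule derivative_le_imp_increment_le[OF le])
      fix s assume "s \<in> {a..b}"
      then have s: "s \<in> {0..1}" using ab by auto
      show "((\<lambda>s. cross2 (\<gamma> s) w) has_real_derivative cross2 (\<gamma>1 s) w) (at s within {a..b})"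
        by (rule DERIV_subset[OF has_real_derivative_cross2[OF c2_paramD(2)[OF c s]]]) (use ab in auto)
      show "((\<lambda>s. \<theta> * inner (\<gamma> s) w) has_real_derivative \<theta> * inner (\<gamma>1 s) w) (at s within {a..b})"
        by (rule DERIV_cmult[OF DERIV_subset[OF has_real_derivative_inner_left[OF c2_paramD(2)[OF c s]]]])
          (use ab in auto)
      show "\<bar>cross2 (\<gamma>1 s) w\<bar> \<le> \<theta> * inner (\<gamma>1 s) w" by (rule flat[OF s])
    qed
    then show ?thesis by (simp add: cross2_minus inner_diff_left right_diff_distrib)
  qed
  have swap: "\<bar>cross2 (\<gamma> a - \<gamma> b) w\<bar> = \<bar>cross2 (\<gamma> b - \<gamma> a) w\<bar>"
    "\<bar>inner (\<gamma> a - \<gamma> b) w\<bar> = \<bar>inner (\<gamma> b - \<gamma> a) w\<bar>"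
    by (simp_all add: cross2_minus inner_diff_left abs_minus_commute)
  show ?thesis
  proof (cases "a \<le> b")
    case True
    have "\<theta> * inner (\<gamma> b - \<gamma> a) w \<le> \<theta> * \<bar>inner (\<gamma> b - \<gamma> a) w\<bar>" using th by (intro mult_left_mono) auto
    then show ?thesis using *[OF ab True] by linarith
  next
    case False
    have "\<theta> * inner (\<gamma> a - \<gamma> b) w \<le> \<theta> * \<bar>inner (\<gamma> b - \<gamma> a) w\<bar>"
      unfolding swap(2)[symmetric] using th by (intro mult_left_mono) auto
    then show ?thesis using *[OF ab(2,1)] False unfolding swap by simp
  qed
qed

text \<open>Chords and tangents in a set of diameter \<delta> have slope at most \<theta> =
  O(\<delta>) in one frame, and the normals \<open>n\<close> and \<open>v\<close> are within the
  same slope of its second axis. Hence \<open>F\<close> is O(\<delta>^2) away from the line DE, and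
  the part of \<open>v\<close> along the chord is O(\<delta>) times its part along \<open>n\<close>.
  \<open>K\<close> depends on \<Gamma> alone.\<close>

lemma interface_nearly_straight:
  assumes "piecewise_C2 \<Gamma>"
  obtains K where "K > 0"
    "\<And>T \<gamma> D E F n v \<delta>. c2_arc \<gamma> \<Longrightarrow> \<gamma> ` {0..1} = \<Gamma> \<inter> T \<Longrightarrow>
      (\<And>p q. p \<in> T \<Longrightarrow> q \<in> T \<Longrightarrow> dist p q \<le> \<delta>) \<Longrightarrow> K * \<delta> \<le> 1 \<Longrightarrow>
      D \<in> \<Gamma> \<inter> T \<Longrightarrow> E \<in> \<Gamma> \<inter> T \<Longrightarrow> D \<noteq> E \<Longrightarrow> F \<in> \<Gamma> \<inter> T \<Longrightarrow> norm n = 1 \<Longrightarrow> inner n (E - D) = 0 \<Longrightarrow>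
      is_normal \<Gamma> T F v \<Longrightarrow> inner n v > 0 \<Longrightarrow>
      \<bar>inner n (F - D)\<bar> \<le> K * \<delta>\<^sup>2 \<and> \<bar>cross2 v n\<bar> \<le> K * \<delta> * inner n v"
proof -
  obtain K0 where K0: "K0 \<ge> 0" "\<And>\<gamma> \<gamma>1 \<gamma>2 t. c2_param \<gamma> \<gamma>1 \<gamma>2 \<Longrightarrow> \<gamma> ` {0..1} \<subseteq> \<Gamma> \<Longrightarrow> t \<in> {0..1} \<Longrightarrow>
     \<bar>cross2 (\<gamma>2 t) (\<gamma>1 t)\<bar> \<le> K0 * norm (\<gamma>1 t) ^ 3"
    using subarc_curvature_bound[OF assms] by blast
  \<comment> \<open>With \<theta> = 4 K0 \<delta> this gives 4 \<theta> \<le> K \<delta>, hence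
    \<theta> \<le> 1/4 under K \<delta> \<le> 1; the summand 1 keeps K positive for a straight
    interface.\<close>
  define K where "K = 16 * (K0 + 1)"
  show ?thesis
  proof (rule that[of K])
    show "K > 0" using K0 by (simp add: K_def)
    fix T \<gamma> D E F n v \<delta>
    assume arc: "c2_arc \<gamma>" and im: "\<gamma> ` {0..1} = \<Gamma> \<inter> T"
      and diam: "\<And>p q. p \<in> T \<Longrightarrow> q \<in> T \<Longrightarrow> dist p q \<le> \<delta>" and small: "K * \<delta> \<le> 1"
      and D: "D \<in> \<Gamma> \<inter> T" and E: "E \<in> \<Gamma> \<inter> T" and DE: "D \<noteq> E" and F: "F \<in> \<Gamma> \<inter> T"
      and n: "norm n = 1" "inner n (E - D) = 0"
      and v: "is_normal \<Gamma> T F v" and nv: "inner n v > 0"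
    obtain \<gamma>1 \<gamma>2 where c: "c2_param \<gamma> \<gamma>1 \<gamma>2" using arc c2_arc_iff by blast
    have d0: "\<delta> \<ge> 0" using diam[of D D] D by simp
    have inT: "\<gamma> t \<in> T" if "t \<in> {0..1}" for t using im that by blast
    define \<theta> where "\<theta> = 4 * K0 * \<delta>"
    have th: "0 \<le> \<theta>" "4 * \<theta> \<le> K * \<delta>" "\<theta> \<le> 1/4"
      using K0(1) d0 small by (auto simp: \<theta>_def K_def algebra_simps)
    obtain w where w: "norm w = 1" and pos: "\<And>t. t \<in> {0..1} \<Longrightarrow> inner (\<gamma>1 t) w > 0"
      and flat: "\<And>t. t \<in> {0..1} \<Longrightarrow> \<bar>cross2 (\<gamma>1 t) w\<bar> \<le> \<theta> * inner (\<gamma>1 t) w"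
    proof -
      have "\<gamma> ` {0..1} \<subseteq> \<Gamma>" using im by blast
      note k = K0(2)[OF c this]
      have "4 * K0 * \<delta> < 1" using th(3) by (simp add: \<theta>_def)
      from short_arc_is_flat[OF c k K0(1) diam[OF inT inT] this]
      obtain w where "norm w = 1" "\<And>t. t \<in> {0..1} \<Longrightarrow> inner (\<gamma>1 t) w > 0"
        "\<And>t. t \<in> {0..1} \<Longrightarrow> \<bar>cross2 (\<gamma>1 t) w\<bar> \<le> 4 * K0 * \<delta> * inner (\<gamma>1 t) w"
        by blast
      then show ?thesis using that unfolding \<theta>_def by blast
    qed
    obtain a b f where abf: "a \<in> {0..1}" "b \<in> {0..1}" "f \<in> {0..1}" "D = \<gamma> a" "E = \<gamma> b" "F = \<gamma> f"
    proof -
      have "D \<in> \<gamma> ` {0..1}" "E \<in> \<gamma> ` {0..1}" "F \<in> \<gamma> ` {0..1}" using D E F im by auto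
      then show ?thesis using that by auto
    qed
    have chord: "\<bar>cross2 (\<gamma> t - \<gamma> s) w\<bar> \<le> \<theta> * \<bar>inner (\<gamma> t - \<gamma> s) w\<bar>" if "s \<in> {0..1}" "t \<in> {0..1}" for s t
      using flat_arc_chord[OF c flat that th(1)] .
    have N: "\<bar>inner n w\<bar> \<le> \<theta> * \<bar>cross2 n w\<bar>"
      by (rule perpendicular_slope[OF w n(2)]) (use DE chord abf in auto)
    have vd: "vector_derivative \<gamma> (at f within {0..1}) = \<gamma>1 f"
      using abf(3) c2_paramD(2)[OF c abf(3)] by (intro vector_derivative_within_cbox[of 0 1 f, unfolded cbox_interval]) auto
    have nrm: "norm v = 1" "\<And>\<gamma> t. c2_arc \<gamma> \<and> \<gamma> ` {0..1} = \<Gamma> \<inter> T \<and> t \<in> {0..1} \<and> \<gamma> t = F \<Longrightarrow>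
        inner v (vector_derivative \<gamma> (at t within {0..1})) = 0"
      using v unfolding is_normal_def by blast+
    have v': "norm v = 1" "inner v (\<gamma>1 f) = 0"
      using nrm(1) nrm(2)[of \<gamma> f] arc im abf vd by simp_all
    have V: "\<bar>inner v w\<bar> \<le> \<theta> * \<bar>cross2 v w\<bar>"
      using flat[OF abf(3)] pos[OF abf(3)] c2_paramD(4)[OF c abf(3)] by (intro perpendicular_slope[OF w v'(2)]) auto
    have le1: "\<bar>cross2 p w\<bar> \<le> 1" "\<bar>inner p w\<bar> \<le> 1" if "norm p = 1" for p
    proof -
      have "(inner p w)\<^sup>2 + (cross2 p w)\<^sup>2 = 1" using lagrange_pt[of p w] that w by simp
      then have "(cross2 p w)\<^sup>2 \<le> 1\<^sup>2" "(inner p w)\<^sup>2 \<le> 1\<^sup>2" by (smt (verit) zero_le_power2 one_power2)+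
      then show "\<bar>cross2 p w\<bar> \<le> 1" "\<bar>inner p w\<bar> \<le> 1" by (auto simp: abs_square_le_1)
    qed
    have fd: "\<bar>inner (F - D) w\<bar> \<le> \<delta>"
      using Cauchy_Schwarz_ineq2[of "F - D" w] w diam[of F D] F D by (simp add: dist_norm)
    have "\<bar>inner n (F - D)\<bar> \<le> \<bar>inner n w\<bar> * \<bar>inner (F - D) w\<bar> + \<bar>cross2 n w\<bar> * \<bar>cross2 (F - D) w\<bar>"
      unfolding inner_pt_frame(1)[OF w, of n "F - D"] by (simp flip: abs_mult)
    also have "\<dots> \<le> \<theta> * \<delta> + 1 * (\<theta> * \<delta>)"
    proof (intro add_mono mult_mono)
      show "\<bar>inner n w\<bar> \<le> \<theta>" using N mult_left_mono[OF le1(1)[OF n(1)] th(1)] by linarith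
      show "\<bar>cross2 (F - D) w\<bar> \<le> \<theta> * \<delta>"
        using chord[of a f] abf mult_left_mono[OF fd th(1)] by simp
    qed (use fd le1[OF n(1)] th in auto)
    also have "\<dots> \<le> 4 * \<theta> * \<delta>" using th d0 by (simp add: mult_right_mono)
    also have "\<dots> \<le> K * \<delta> * \<delta>" using th d0 by (intro mult_right_mono) auto
    finally have 1: "\<bar>inner n (F - D)\<bar> \<le> K * \<delta>\<^sup>2" by (simp add: power2_eq_square mult.assoc)
    \<comment> \<open>\<open>inner n v\<close> equals plus or minus B up to B / 16. The orientation
      hypothesis \<open>inner n v > 0\<close> excludes the minus sign, which leaves
      \<open>inner n v\<close> comparable to B.\<close>
    define B where "B = \<bar>cross2 n w\<bar> * \<bar>cross2 v w\<bar>"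
    have B0: "B \<ge> 0" by (simp add: B_def)
    have nw: "\<bar>inner n w * inner v w\<bar> \<le> \<theta> * (\<theta> * B)"
      using mult_mono[OF N V] th by (simp add: abs_mult B_def mult_ac)
    also have "\<dots> \<le> 1/4 * (1/4 * B)" using th B0 by (intro mult_mono) auto
    finally have nw: "\<bar>inner n w * inner v w\<bar> \<le> B / 16" by simp
    have "cross2 n w * cross2 v w \<le> - B \<or> B \<le> cross2 n w * cross2 v w"
      unfolding B_def by (simp flip: abs_mult) linarith
    then have B: "15/16 * B \<le> inner n v"
      using nw nv B0 unfolding inner_pt_frame(1)[OF w, of n v] by linarith
    have "\<bar>cross2 v n\<bar> \<le> \<bar>cross2 v w\<bar> * \<bar>inner n w\<bar> + \<bar>inner v w\<bar> * \<bar>cross2 n w\<bar>"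
      unfolding inner_pt_frame(2)[OF w, of v n] by (simp flip: abs_mult)
    also have "\<dots> \<le> \<bar>cross2 v w\<bar> * (\<theta> * \<bar>cross2 n w\<bar>) + (\<theta> * \<bar>cross2 v w\<bar>) * \<bar>cross2 n w\<bar>"
      using N V by (intro add_mono mult_mono) auto
    also have "\<dots> = 2 * \<theta> * B" by (simp add: B_def algebra_simps)
    also have "\<dots> \<le> 4 * \<theta> * (15/16 * B)" using th B0 mult_nonneg_nonneg[OF th(1) B0] by (simp add: algebra_simps)
    also have "\<dots> \<le> K * \<delta> * inner n v" by (rule mult_mono[OF th(2) B]) (use th B0 in auto)
    finally show "\<bar>inner n (F - D)\<bar> \<le> K * \<delta>\<^sup>2 \<and> \<bar>cross2 v n\<bar> \<le> K * \<delta> * inner n v" using 1 by simp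
  qed
qed

section \<open>Traces of the pieces on the element boundary\<close>

lemma piecewise_C2_closed:
  assumes "piecewise_C2 \<Gamma>"
  shows "closed \<Gamma>"
proof -
  obtain A where A: "finite A" "\<forall>\<gamma>\<in>A. c2_arc \<gamma>" "\<Gamma> = (\<Union>\<gamma>\<in>A. \<gamma> ` {0..1})"
    using assms unfolding piecewise_C2_def by auto
  have "closed (\<gamma> ` {0..1})" if "\<gamma> \<in> A" for \<gamma>
  proof -
    have "continuous_on {0..1} \<gamma>"
      using A(2) that unfolding c2_arc_def continuous_on_eq_continuous_within
      by (blast intro: has_vector_derivative_continuous)
    then show ?thesis by (intro compact_imp_closed compact_continuous_image) auto
  qed
  then show ?thesis unfolding A(3) using A(1) by blast
qed

text \<open>\<Omega> is the interior of a closed set, so an open set inside its closure is inside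
  \<Omega> itself. A domain with slits would not allow this.\<close>

lemma interior_minus_interface_subset:
  assumes "ife_setting \<Omega> \<Omega>p \<Omega>m \<Gamma>" and T: "T \<subseteq> closure \<Omega>"
  shows "interior T - \<Gamma> \<subseteq> \<Omega>p \<union> \<Omega>m"
proof -
  obtain R where R: "finite R" "\<forall>r\<in>R. \<exists>a b. r = cbox a b" "\<Omega> = interior (\<Union>R)"
    and \<Omega>: "\<Omega> - \<Gamma> = \<Omega>p \<union> \<Omega>m"
    using assms(1) unfolding ife_setting_def by blast
  have "closed (\<Union>R)" using R(1,2) by (intro closed_Union) auto
  then have "closure \<Omega> \<subseteq> \<Union>R" unfolding R(3) by (intro closure_minimal interior_subset)
  then have "interior T \<subseteq> \<Omega>" by (subst R(3)) (intro interior_mono subset_trans[OF T])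
  then show ?thesis using \<Omega> by blast
qed

text \<open>\<open>C\<close> may run along the boundary of T, whose points need not belong to
  \<open>P\<close> or \<open>M\<close>. Near a point of \<open>C\<close> the curve is absent, and a
  small ball meets the interior of the convex set T in a convex set, which lies in only one of
  \<open>P\<close> and \<open>M\<close>. So each point of \<open>C\<close> is in exactly one of the
  two closures, and these would otherwise disconnect \<open>C\<close>.\<close>

lemma connected_in_one_side:
  fixes T :: "'a::euclidean_space set"
  assumes P: "open P" and M: "open M" and dis: "P \<inter> M = {}"
    and T: "convex T" "interior T \<noteq> {}" and sub: "interior T - \<Gamma> \<subseteq> P \<union> M" and \<Gamma>: "closed \<Gamma>"
    and C: "connected C" "C \<subseteq> T - \<Gamma>"
  shows "C \<subseteq> closure (T \<inter> P) \<or> C \<inter> closure (T \<inter> P) = {}"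
proof -
  have *: "(x \<in> closure (T \<inter> P)) \<noteq> (x \<in> closure (T \<inter> M))" if x: "x \<in> C" for x
  proof -
    obtain e where e: "e > 0" "ball x e \<inter> \<Gamma> = {}"
    proof -
      have "x \<in> - \<Gamma>" "open (- \<Gamma>)" using \<Gamma> C(2) x by auto
      then obtain e where "e > 0" "ball x e \<subseteq> - \<Gamma>" using open_contains_ball by blast
      then show ?thesis using that[of e] by blast
    qed
    define B where "B = ball x e \<inter> interior T"
    have BPM: "B \<subseteq> P \<union> M" using sub e(2) by (auto simp: B_def)
    have xT: "x \<in> closure (interior T)"
      using convex_closure_interior[OF T] C(2) x closure_subset by blast
    have "connected B" unfolding B_def by (intro convex_connected convex_Int convex_ball convex_interior T)
    then have one: "B \<inter> P = {} \<or> B \<inter> M = {}"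
      using connectedD[OF _ P M, of B] dis BPM by blast
    have in_cl: "x \<in> closure (T \<inter> Q)" if "B \<subseteq> Q" for Q
      unfolding closure_approachable
    proof (intro allI impI)
      fix d :: real assume "d > 0"
      then obtain y where "y \<in> interior T" "dist y x < min d e"
        using xT e(1) unfolding closure_approachable by (metis min_less_iff_conj)
      then show "\<exists>y\<in>T \<inter> Q. dist y x < d"
        using that interior_subset by (intro bexI[of _ y]) (auto simp: B_def dist_commute)
    qed
    have not_in: "x \<notin> closure (T \<inter> Q)" if Q: "open Q" "B \<inter> Q = {}" for Q
    proof
      assume "x \<in> closure (T \<inter> Q)"
      then obtain y where y: "y \<in> T" "y \<in> Q" "dist y x < e"
        using e(1) unfolding closure_approachable by blast
      have "y \<in> closure (interior T)" using convex_closure_interior[OF T] y closure_subset by blast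
      moreover have "open (Q \<inter> ball x e)" "y \<in> Q \<inter> ball x e" using Q y by (auto simp: dist_commute)
      ultimately have "Q \<inter> ball x e \<inter> interior T \<noteq> {}"
        by (metis open_Int_closure_eq_empty disjoint_iff)
      then show False using Q(2) by (auto simp: B_def)
    qed
    show ?thesis
    proof (cases "B \<inter> M = {}")
      case True
      then have "B \<subseteq> P" using BPM by blast
      then show ?thesis using in_cl not_in[OF M True] by blast
    next
      case False
      then have "B \<inter> P = {}" using one by blast
      moreover from this have "B \<subseteq> M" using BPM by blast
      ultimately show ?thesis using in_cl not_in[OF P] by blast
    qed
  qed
  then have "C \<subseteq> closure (T \<inter> P) \<union> closure (T \<inter> M)" "closure (T \<inter> P) \<inter> closure (T \<inter> M) \<inter> C = {}" by blast+
  with C(1) have "closure (T \<inter> P) \<inter> C = {} \<or> closure (T \<inter> M) \<inter> C = {}"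
    unfolding connected_closed by blast
  with * show ?thesis by blast
qed

text \<open>\<open>P\<close> is the vertex at the right angle and \<open>a\<close>, \<open>b\<close>
  are signed legs, which covers all four triangles obtained from the two diagonals. Adjacency is up
  to orientation because their cyclic orders differ.\<close>

definition tri_shape :: "pt list \<Rightarrow> pt \<Rightarrow> real \<Rightarrow> real \<Rightarrow> bool" where
  "tri_shape vs P a b \<longleftrightarrow> set vs = {P, P + (a, 0), P + (0, b)} \<and> a \<noteq> 0 \<and> b \<noteq> 0 \<and>
     (\<forall>U\<in>set vs. \<forall>V\<in>set vs. U \<noteq> V \<longrightarrow> (U, V) \<in> set (edges vs) \<or> (V, U) \<in> set (edges vs))"

lemma edges_set3: "set (edges [p, q, r]) = {(p, q), (q, r), (r, p)}"
proof -
  have "[0..<3] = [0, 1, 2::nat]" by (simp add: upt_rec)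
  then show ?thesis by (simp add: edges_def)
qed
lemma edges_set4: "set (edges [p, q, r, s]) = {(p, q), (q, r), (r, s), (s, p)}"
proof -
  have "[0..<4] = [0, 1, 2, 3::nat]" by (simp add: upt_rec)
  then show ?thesis by (simp add: edges_def)
qed

lemma edges_in_set: "(U, V) \<in> set (edges vs) \<Longrightarrow> U \<in> set vs \<and> V \<in> set vs"
proof -
  assume "(U, V) \<in> set (edges vs)"
  then obtain i where "i < length vs" "U = vs ! i" "V = vs ! ((i + 1) mod length vs)"
    unfolding edges_def by (auto simp del: mod_Suc)
  moreover from this have "(i + 1) mod length vs < length vs" by (intro mod_less_divisor) linarith
  ultimately show ?thesis by simp
qed

lemma tri_elems_shape:
  assumes "vs \<in> tri_elems x0 y0 x1 y1 d" "x0 < x1" "y0 < y1"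
  obtains P a b where "tri_shape vs P a b" "\<bar>a\<bar> = x1 - x0" "\<bar>b\<bar> = y1 - y0" "set vs \<subseteq> cbox (x0, y0) (x1, y1)"
proof -
  consider "vs = [(x0, y0), (x1, y0), (x1, y1)]" | "vs = [(x0, y0), (x1, y1), (x0, y1)]"
    | "vs = [(x0, y0), (x1, y0), (x0, y1)]" | "vs = [(x1, y0), (x1, y1), (x0, y1)]"
    using assms(1) by (auto simp: tri_elems_def split: if_splits)
  then show ?thesis
  proof cases
    case 1 show ?thesis
      by (rule that[of "(x1, y0)" "x0 - x1" "y1 - y0"])
        (use assms in \<open>auto simp: 1 tri_shape_def edges_set3 cbox_Pair_eq\<close>)
  next
    case 2 show ?thesis
      by (rule that[of "(x0, y1)" "x1 - x0" "y0 - y1"])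
        (use assms in \<open>auto simp: 2 tri_shape_def edges_set3 cbox_Pair_eq\<close>)
  next
    case 3 show ?thesis
      by (rule that[of "(x0, y0)" "x1 - x0" "y1 - y0"])
        (use assms in \<open>auto simp: 3 tri_shape_def edges_set3 cbox_Pair_eq\<close>)
  next
    case 4 show ?thesis
      by (rule that[of "(x1, y1)" "x0 - x1" "y0 - y1"])
        (use assms in \<open>auto simp: 4 tri_shape_def edges_set3 cbox_Pair_eq\<close>)
  qed
qed

section \<open>Elements of a quasi-uniform mesh and their bounding cells\<close>

lemma finite_mesh_elements: "finite (mesh_elements rect xs ys dg \<Omega>)"
proof -
  have "finite (cells xs ys \<Omega>)"
    by (rule finite_subset[of _ "{..<length xs} \<times> {..<length ys}"]) (auto simp: cells_def)
  then show ?thesis unfolding mesh_elements_def tri_elems_def by (auto split: if_splits)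
qed

lemma edge_le_mesh_size:
  assumes "vs \<in> mesh_elements rect xs ys dg \<Omega>" "(U, V) \<in> set (edges vs) \<or> (V, U) \<in> set (edges vs)"
  shows "dist U V \<le> mesh_size rect xs ys dg \<Omega>"
  unfolding mesh_size_def
  using assms finite_mesh_elements by (intro Max_ge) (force simp: dist_commute)+

lemma mesh_element_shape:
  assumes h: "h = mesh_size rect xs ys dg \<Omega>"
    and vs: "vs \<in> mesh_elements rect xs ys dg \<Omega>" and m: "cartesian_mesh xs ys \<Omega>"
    and q: "quasi_uniform \<kappa> xs ys \<Omega> h"
  obtains x0 y0 x1 y1 where "x0 < x1" "y0 < y1" "h / \<kappa> \<le> x1 - x0" "h / \<kappa> \<le> y1 - y0" "x1 - x0 \<le> h" "y1 - y0 \<le> h"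
    "elem_set vs \<subseteq> cbox (x0, y0) (x1, y1)" "elem_set vs \<subseteq> closure \<Omega>"
    "if rect then vs = rect_elem x0 y0 x1 y1 else \<exists>P a b. tri_shape vs P a b \<and> \<bar>a\<bar> = x1 - x0 \<and> \<bar>b\<bar> = y1 - y0"
proof -
  obtain i j where ij: "(i, j) \<in> cells xs ys \<Omega>" and v: "vs \<in> (if rect then {rect_elem (xs ! i) (ys ! j) (xs ! Suc i) (ys ! Suc j)}
        else tri_elems (xs ! i) (ys ! j) (xs ! Suc i) (ys ! Suc j) (dg i j))"
    using vs unfolding mesh_elements_def by (elim UN_E, unfold split_paired_all prod.case) rule
  define x0 x1 y0 y1 where xy: "x0 = xs ! i" "x1 = xs ! Suc i" "y0 = ys ! j" "y1 = ys ! Suc j"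
  have lt: "x0 < x1" "y0 < y1"
    using ij m unfolding cells_def cartesian_mesh_def xy by (simp_all add: sorted_wrt_nth_less)
  have qq: "h / \<kappa> \<le> x1 - x0" "h / \<kappa> \<le> y1 - y0" using bspec[OF q[unfolded quasi_uniform_def] ij] by (simp_all add: xy)
  have cell: "cbox (x0, y0) (x1, y1) \<subseteq> closure \<Omega>" using ij unfolding cells_def xy by simp
  note le = edge_le_mesh_size[OF vs, folded h]
  have hull: "elem_set vs \<subseteq> cbox (x0, y0) (x1, y1)" if "set vs \<subseteq> cbox (x0, y0) (x1, y1)"
    unfolding elem_set_def using that by (intro hull_minimal) (auto simp: convex_box)
  show ?thesis
  proof (cases rect)
    case True
    then have v: "vs = rect_elem x0 y0 x1 y1" using v by (simp add: xy)
    have h: "elem_set vs \<subseteq> cbox (x0, y0) (x1, y1)"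
      by (rule hull) (use lt in \<open>auto simp: v rect_elem_def cbox_Pair_eq\<close>)
    show ?thesis
    proof (rule that[OF lt qq])
      show "x1 - x0 \<le> h" using le[of "(x0,y0)" "(x1,y0)"] lt
        by (simp add: v rect_elem_def edges_set4 dist_Pair_Pair dist_real_def)
      show "y1 - y0 \<le> h" using le[of "(x1,y0)" "(x1,y1)"] lt
        by (simp add: v rect_elem_def edges_set4 dist_Pair_Pair dist_real_def)
    qed (use True v h cell in auto)
  next
    case False
    then have "vs \<in> tri_elems x0 y0 x1 y1 (dg i j)" using v by (simp add: xy)
    from tri_elems_shape[OF this lt] obtain P a b where
      P: "tri_shape vs P a b" "\<bar>a\<bar> = x1 - x0" "\<bar>b\<bar> = y1 - y0" "set vs \<subseteq> cbox (x0, y0) (x1, y1)" by blast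
    show ?thesis
    proof (rule that[OF lt qq])
      have "P \<noteq> P + (a, 0)" "P \<noteq> P + (0, b)" using P(1) by (auto simp: tri_shape_def prod_eq_iff)
      then have "dist P (P + (a, 0)) \<le> h" "dist P (P + (0, b)) \<le> h"
        using P(1) le[of P "P + (a, 0)"] le[of P "P + (0, b)"] unfolding tri_shape_def by blast+
      then show "x1 - x0 \<le> h" "y1 - y0 \<le> h" using P(2,3) by (simp_all add: dist_norm norm_prod_def)
      have "\<exists>P a b. tri_shape vs P a b \<and> \<bar>a\<bar> = x1 - x0 \<and> \<bar>b\<bar> = y1 - y0" using P(1-3) by blast
      then show "if rect then vs = rect_elem x0 y0 x1 y1
          else \<exists>P a b. tri_shape vs P a b \<and> \<bar>a\<bar> = x1 - x0 \<and> \<bar>b\<bar> = y1 - y0"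
        using False by (simp only: if_False)
    qed (use hull[OF P(4)] cell in auto)
  qed
qed

text \<open>The functional \<open>u\<close> supports the polygon along the edge, and interior points
  lie strictly below its maximum.\<close>

lemma edge_in_frontier:
  assumes half: "\<And>z. z \<in> set vs \<Longrightarrow> inner u z \<le> k" and u: "u \<noteq> 0"
    and UV: "U \<in> set vs" "V \<in> set vs" "inner u U = k" "inner u V = k"
    and p: "p \<in> closed_segment U V"
  shows "p \<in> frontier (elem_set vs)"
proof -
  have "closed_segment U V \<subseteq> elem_set vs"
    unfolding elem_set_def using UV by (intro closed_segment_subset hull_inc convex_convex_hull) auto
  then have "p \<in> elem_set vs" using p by blast
  have "elem_set vs \<subseteq> {z. inner u z \<le> k}" unfolding elem_set_def
    using half by (intro hull_minimal) (auto simp: convex_halfspace_le)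
  then have "interior (elem_set vs) \<subseteq> {z. inner u z < k}"
    using interior_mono[of "elem_set vs" "{z. inner u z \<le> k}"] u by simp
  moreover have "inner u p = k"
  proof -
    obtain t where "p = (1 - t) *\<^sub>R U + t *\<^sub>R V" using p unfolding closed_segment_def by blast
    then have "inner u p = (1 - t) * inner u U + t * inner u V"
      by (simp only: inner_add_right inner_scaleR_right)
    then show ?thesis by (simp add: UV algebra_simps)
  qed
  ultimately have "p \<notin> interior (elem_set vs)" by blast
  then show ?thesis using \<open>p \<in> elem_set vs\<close> closure_subset unfolding frontier_def by blast
qed

lemma tri_edges_in_frontier:
  assumes t: "tri_shape vs P a b" and e: "(U, V) \<in> set (edges vs)" and p: "p \<in> closed_segment U V"
  shows "p \<in> frontier (elem_set vs)"
proof -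
  have vs: "set vs = {P, P + (a, 0), P + (0, b)}" and ab: "a \<noteq> 0" "b \<noteq> 0" using t by (auto simp: tri_shape_def)
  have UV: "U \<in> set vs" "V \<in> set vs" using edges_in_set[OF e] by auto
  have sq: "a * a > 0" "b * b > 0" using ab by (auto simp: zero_less_mult_iff)
  have *: "\<exists>u k. u \<noteq> 0 \<and> (\<forall>z\<in>set vs. inner u z \<le> k) \<and> inner u U = k \<and> inner u V = k"
  proof -
    \<comment> \<open>An edge is recognized by a vertex that it misses. The supporting functionals
      are constant on the two legs and, for (1/a, 1/b), on the hypotenuse, where it exceeds its
      value at \<open>P\<close> by 1.\<close>
    consider "U \<noteq> P + (0, b)" "V \<noteq> P + (0, b)" | "U \<noteq> P + (a, 0)" "V \<noteq> P + (a, 0)" | "U \<noteq> P" "V \<noteq> P"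
      using UV vs ab by (fastforce simp: prod_eq_iff)
    then show ?thesis
    proof cases
      case 1
      then show ?thesis using UV ab sq unfolding vs
        by (intro exI[of _ "(0::real, - b)"] exI[of _ "inner (0, - b) P"]) (auto simp: inner_add_right zero_prod_def)
    next
      case 2
      then show ?thesis using UV ab sq unfolding vs
        by (intro exI[of _ "(- a, 0::real)"] exI[of _ "inner (- a, 0) P"]) (auto simp: inner_add_right zero_prod_def)
    next
      case 3
      then show ?thesis using UV ab unfolding vs
        by (intro exI[of _ "(1 / a, 1 / b)"] exI[of _ "inner (1 / a, 1 / b) P + 1"]) (auto simp: inner_add_right zero_prod_def)
    qed
  qed
  then show ?thesis using edge_in_frontier[of vs _ _ U V p] UV p by blast
qed

lemma rect_edges_in_frontier:
  assumes xy: "x0 < x1" "y0 < y1" and vs: "vs = rect_elem x0 y0 x1 y1"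
    and e: "(U, V) \<in> set (edges vs)" and p: "p \<in> closed_segment U V"
  shows "p \<in> frontier (elem_set vs)"
proof -
  have *: "\<exists>u k. u \<noteq> 0 \<and> (\<forall>z\<in>set vs. inner u z \<le> k) \<and> inner u U = k \<and> inner u V = k"
  proof -
    consider "U = (x0, y0)" "V = (x1, y0)" | "U = (x1, y0)" "V = (x1, y1)" | "U = (x1, y1)" "V = (x0, y1)"
      | "U = (x0, y1)" "V = (x0, y0)"
      using e unfolding vs rect_elem_def edges_set4 by blast
    then show ?thesis
    proof cases
      case 1
      then show ?thesis using xy unfolding vs rect_elem_def
        by (intro exI[of _ "(0::real, - 1::real)"] exI[of _ "- y0"]) (auto simp: zero_prod_def)
    next
      case 2
      then show ?thesis using xy unfolding vs rect_elem_def
        by (intro exI[of _ "(1::real, 0::real)"] exI[of _ "x1"]) (auto simp: zero_prod_def)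
    next
      case 3
      then show ?thesis using xy unfolding vs rect_elem_def
        by (intro exI[of _ "(0::real, 1::real)"] exI[of _ "y1"]) (auto simp: zero_prod_def)
    next
      case 4
      then show ?thesis using xy unfolding vs rect_elem_def
        by (intro exI[of _ "(- 1::real, 0::real)"] exI[of _ "- x0"]) (auto simp: zero_prod_def)
    qed
  qed
  then show ?thesis using edge_in_frontier[of vs _ _ U V p] edges_in_set[OF e] p by blast
qed

section \<open>One side of the chord line sees one piece of the element\<close>

lemma affine_pos_endpoint:
  fixes n :: pt
  assumes p: "p \<in> closed_segment U V" and pos: "inner n (p - D) > 0"
  shows "inner n (U - D) > 0 \<or> inner n (V - D) > 0"
proof (rule ccontr)
  assume "\<not> ?thesis"
  then have "closed_segment U V \<subseteq> {z. inner n z \<le> inner n D}"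
    by (intro closed_segment_subset) (auto simp: inner_diff_right convex_halfspace_le)
  then show False using p pos by (auto simp: inner_diff_right)
qed

text \<open>Every point of an edge where the affine function is positive is joined, inside that set, to a vertex.\<close>

lemma edges_const_if_adjacent:
  fixes n :: pt
  assumes const: "\<And>U V p q. (U, V) \<in> set (edges vs) \<Longrightarrow> p \<in> closed_segment U V \<Longrightarrow> q \<in> closed_segment U V \<Longrightarrow>
      inner n (p - D) > 0 \<Longrightarrow> inner n (q - D) > 0 \<Longrightarrow> Q p = Q q"
    and vert: "\<And>U V. U \<in> set vs \<Longrightarrow> V \<in> set vs \<Longrightarrow> inner n (U - D) > 0 \<Longrightarrow> inner n (V - D) > 0 \<Longrightarrow> Q U = Q V"
  shows "\<exists>e::bool. \<forall>(U, V)\<in>set (edges vs). \<forall>p\<in>closed_segment U V. inner n (p - D) > 0 \<longrightarrow> Q p = e"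
proof (cases "\<exists>W\<in>set vs. inner n (W - D) > 0")
  case True
  then obtain W where W: "W \<in> set vs" "inner n (W - D) > 0" by blast
  have "Q p = Q W" if e: "(U, V) \<in> set (edges vs)" and p: "p \<in> closed_segment U V" "inner n (p - D) > 0" for U V p
    using affine_pos_endpoint[OF p]
  proof
    assume "inner n (U - D) > 0"
    then show ?thesis using const[OF e p(1) ends_in_segment(1) p(2)] vert[of U W] edges_in_set[OF e] W by simp
  next
    assume "inner n (V - D) > 0"
    then show ?thesis using const[OF e p(1) ends_in_segment(2) p(2)] vert[of V W] edges_in_set[OF e] W by simp
  qed
  then show ?thesis by blast
next
  case False
  then have "\<not> inner n (p - D) > 0" if "(U, V) \<in> set (edges vs)" "p \<in> closed_segment U V" for U V p
    using affine_pos_endpoint[OF that(2)] edges_in_set[OF that(1)] by blast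
  then show ?thesis by blast
qed

lemma tri_edges_const:
  fixes n :: pt
  assumes t: "tri_shape vs P a b"
    and const: "\<And>U V p q. (U, V) \<in> set (edges vs) \<Longrightarrow> p \<in> closed_segment U V \<Longrightarrow> q \<in> closed_segment U V \<Longrightarrow>
      inner n (p - D) > 0 \<Longrightarrow> inner n (q - D) > 0 \<Longrightarrow> Q p = Q q"
  shows "\<exists>e::bool. \<forall>(U, V)\<in>set (edges vs). \<forall>p\<in>closed_segment U V. inner n (p - D) > 0 \<longrightarrow> Q p = e"
proof (rule edges_const_if_adjacent[OF const])
  fix U V assume UV: "U \<in> set vs" "V \<in> set vs" "inner n (U - D) > 0" "inner n (V - D) > 0"
  show "Q U = Q V"
  proof (cases "U = V")
    case False
    then have "(U, V) \<in> set (edges vs) \<or> (V, U) \<in> set (edges vs)" using t UV unfolding tri_shape_def by blast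
    then show ?thesis using const[of U V U V] const[of V U V U] UV by auto
  qed simp
qed

lemma rect_edges_const:
  fixes n :: pt
  assumes vs: "vs = rect_elem x0 y0 x1 y1"
    and const: "\<And>U V p q. (U, V) \<in> set (edges vs) \<Longrightarrow> p \<in> closed_segment U V \<Longrightarrow> q \<in> closed_segment U V \<Longrightarrow>
      inner n (p - D) > 0 \<Longrightarrow> inner n (q - D) > 0 \<Longrightarrow> Q p = Q q"
  shows "\<exists>e::bool. \<forall>(U, V)\<in>set (edges vs). \<forall>p\<in>closed_segment U V. inner n (p - D) > 0 \<longrightarrow> Q p = e"
proof (rule edges_const_if_adjacent[OF const])
  let ?L = "\<lambda>p. inner n (p - D)"
  have adj: "Q U = Q V" if "(U, V) \<in> set (edges vs)" "?L U > 0" "?L V > 0" for U V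
    using const[of U V U V] that by auto
  have e: "((x0, y0), (x1, y0)) \<in> set (edges vs)" "((x1, y0), (x1, y1)) \<in> set (edges vs)"
    "((x1, y1), (x0, y1)) \<in> set (edges vs)" "((x0, y1), (x0, y0)) \<in> set (edges vs)"
    by (simp_all add: vs rect_elem_def edges_set4)
  \<comment> \<open>Both diagonals have the same sum of corner values. If two opposite corners are
    positive, so is one of the remaining corners, and the two are linked through it.\<close>
  have sum: "?L (x0, y0) + ?L (x1, y1) = ?L (x1, y0) + ?L (x0, y1)"
    by (cases n, cases D) (simp add: algebra_simps)
  fix U V assume UV: "U \<in> set vs" "V \<in> set vs" "?L U > 0" "?L V > 0"
  have "U \<in> {(x0, y0), (x1, y0), (x1, y1), (x0, y1)}" "V \<in> {(x0, y0), (x1, y0), (x1, y1), (x0, y1)}"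
    using UV by (auto simp: vs rect_elem_def)
  moreover have "Q (x0, y0) = Q (x1, y1)" if "?L (x0, y0) > 0" "?L (x1, y1) > 0"
  proof -
    have "?L (x1, y0) > 0 \<or> ?L (x0, y1) > 0" using that sum by linarith
    then show ?thesis using adj[OF e(1)] adj[OF e(2)] adj[OF e(3)] adj[OF e(4)] that by auto
  qed
  moreover have "Q (x1, y0) = Q (x0, y1)" if "?L (x1, y0) > 0" "?L (x0, y1) > 0"
  proof -
    have "?L (x0, y0) > 0 \<or> ?L (x1, y1) > 0" using that sum by linarith
    then show ?thesis using adj[OF e(1)] adj[OF e(2)] adj[OF e(3)] adj[OF e(4)] that by auto
  qed
  ultimately show "Q U = Q V"
    using UV adj[OF e(1)] adj[OF e(2)] adj[OF e(3)] adj[OF e(4)] by auto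
qed

text \<open>On the boundary the curve passes only through \<open>D\<close> and \<open>E\<close>,
  where the affine function \<open>inner n (p - D)\<close> vanishes. Each side of the chord line
  therefore sees a single piece, and \<open>e1\<close>, \<open>e2\<close> record for the positive
  and the negative side whether it is the minus piece, the value 1 meaning yes. On the chord line
  itself both formulas agree.\<close>

lemma ife_edge_values:
  fixes n :: pt
  assumes set: "ife_setting \<Omega> \<Omega>p \<Omega>m \<Gamma>" and int: "interface_elem \<Gamma> vs"
    and sub: "elem_set vs \<subseteq> closure \<Omega>"
    and front: "\<And>U V p. (U, V) \<in> set (edges vs) \<Longrightarrow> p \<in> closed_segment U V \<Longrightarrow> p \<in> frontier (elem_set vs)"
    and const: "\<And>n D Q. (\<And>U V p q. (U, V) \<in> set (edges vs) \<Longrightarrow> p \<in> closed_segment U V \<Longrightarrow> q \<in> closed_segment U V \<Longrightarrow>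
        inner n (p - D) > 0 \<Longrightarrow> inner n (q - D) > 0 \<Longrightarrow> Q p = Q q) \<Longrightarrow>
      \<exists>e::bool. \<forall>(U, V)\<in>set (edges vs). \<forall>p\<in>closed_segment U V. inner n (p - D) > 0 \<longrightarrow> Q p = e"
    and cfg: "ife_config \<Gamma> \<Omega>p \<Omega>m vs D E n Tp Tm F v"
    and fm: "\<And>p. fm p = fp p + c * inner n (p - D)"
  obtains e1 e2 :: real where "e1 \<in> {0, 1}" "e2 \<in> {0, 1}"
    "\<And>U V p. (U, V) \<in> set (edges vs) \<Longrightarrow> p \<in> closed_segment U V \<Longrightarrow>
      pw_fun Tp fp fm p = fp p + c * (e1 * max 0 (inner n (p - D)) + e2 * min 0 (inner n (p - D)))"
proof -
  define T where "T = elem_set vs"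
  let ?L = "\<lambda>p. inner n (p - D)"
  have convT: "convex T" by (simp add: T_def elem_set_def)
  have "compact T" by (simp add: T_def elem_set_def finite_imp_compact_convex_hull)
  then have clT: "closed T" by (rule compact_imp_closed)
  have edgeT: "p \<in> T" if "(U, V) \<in> set (edges vs)" "p \<in> closed_segment U V" for U V p
    using front[OF that] clT unfolding T_def[symmetric] frontier_def by auto
  have cfg': "\<Gamma> \<inter> frontier T = {D, E}" "inner n (E - D) = 0"
    "(Tp = T \<inter> \<Omega>p \<or> (\<exists>\<sigma>\<in>{1, -1::real}. Tp = {p \<in> T. \<sigma> * inner (p - D) n > 0}))"
    using cfg unfolding ife_config_def Let_def T_def[symmetric] by blast+
  \<comment> \<open>The factor s = 1 or -1 treats both sides of the chord line at once.\<close>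
  have "\<exists>e. \<forall>(U, V)\<in>set (edges vs). \<forall>p\<in>closed_segment U V. inner (s *\<^sub>R n) (p - D) > 0 \<longrightarrow> (p \<in> closure Tp) = e"
    if s: "s \<in> {1, -1}" for s :: real
    using cfg'(3)
  proof
    assume Tp: "Tp = T \<inter> \<Omega>p"
    have o: "open \<Omega>p" "open \<Omega>m" "\<Omega>p \<inter> \<Omega>m = {}" and \<Gamma>: "closed \<Gamma>"
      using set piecewise_C2_closed unfolding ife_setting_def by auto
    have it: "interior T \<noteq> {}" using int by (auto simp: interface_elem_def T_def)
    show ?thesis
    proof (rule const)
      fix U V p q assume e: "(U, V) \<in> set (edges vs)" and p: "p \<in> closed_segment U V" and q: "q \<in> closed_segment U V"
        and pos: "inner (s *\<^sub>R n) (p - D) > 0" "inner (s *\<^sub>R n) (q - D) > 0"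
      have seg: "closed_segment p q \<subseteq> closed_segment U V" using p q by (simp add: closed_segment_subset)
      have "closed_segment p q \<subseteq> {z. inner (s *\<^sub>R n) z > inner (s *\<^sub>R n) D}"
        using pos by (intro closed_segment_subset convex_halfspace_gt) (auto simp: inner_diff_right)
      then have "z \<noteq> D \<and> z \<noteq> E" if "z \<in> closed_segment p q" for z
        using that cfg'(2) by (force simp: inner_diff_right)
      moreover have "z \<in> frontier T" if "z \<in> closed_segment p q" for z
        using that seg front[OF e] unfolding T_def by blast
      ultimately have "closed_segment p q \<subseteq> T - \<Gamma>"
        using cfg'(1) seg edgeT[OF e] by blast
      from connected_in_one_side[OF o convT it _ \<Gamma> connected_segment(1) this]
      have "closed_segment p q \<subseteq> closure (T \<inter> \<Omega>p) \<or> closed_segment p q \<inter> closure (T \<inter> \<Omega>p) = {}"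
        using interior_minus_interface_subset[OF set sub] unfolding T_def by blast
      then show "(p \<in> closure Tp) = (q \<in> closure Tp)"
        unfolding Tp using ends_in_segment[of p q] by blast
    qed
  next
    assume "\<exists>\<sigma>\<in>{1, -1::real}. Tp = {p \<in> T. \<sigma> * inner (p - D) n > 0}"
    then obtain \<sigma> :: real where \<sigma>: "\<sigma> \<in> {1, -1}" and Tp: "Tp = {p \<in> T. \<sigma> * inner (p - D) n > 0}" by blast
    have "closed {p. 0 \<le> \<sigma> * inner (p - D) n}"
      by (intro closed_Collect_le continuous_intros)
    then have cl: "closure Tp \<subseteq> {p. 0 \<le> \<sigma> * inner (p - D) n}"
      unfolding Tp by (intro closure_minimal) auto
    have "(p \<in> closure Tp) = (\<sigma> = s)"
      if "(U, V) \<in> set (edges vs)" "p \<in> closed_segment U V" "inner (s *\<^sub>R n) (p - D) > 0" for U V p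
    proof (cases "\<sigma> = s")
      case True
      then have "p \<in> Tp" using that edgeT[OF that(1,2)] by (simp add: Tp inner_commute)
      then show ?thesis using True closure_subset by blast
    next
      case False
      then have "\<sigma> * inner (p - D) n < 0" using that(3) s \<sigma> by (auto simp: inner_commute)
      then show ?thesis using cl False by force
    qed
    then show ?thesis by blast
  qed
  from this[of 1] this[of "-1"] obtain u1 u2 where
    u1: "\<And>U V p. (U, V) \<in> set (edges vs) \<Longrightarrow> p \<in> closed_segment U V \<Longrightarrow> ?L p > 0 \<Longrightarrow> (p \<in> closure Tp) = u1"
    and u2: "\<And>U V p. (U, V) \<in> set (edges vs) \<Longrightarrow> p \<in> closed_segment U V \<Longrightarrow> ?L p < 0 \<Longrightarrow> (p \<in> closure Tp) = u2"
    by (auto 0 3 simp: split_beta)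
  show ?thesis
  proof (rule that[of "if u1 then 0 else 1" "if u2 then 0 else 1"])
    fix U V p assume e: "(U, V) \<in> set (edges vs)" "p \<in> closed_segment U V"
    consider "?L p > 0" | "?L p < 0" | "?L p = 0" by linarith
    then show "pw_fun Tp fp fm p = fp p + c * ((if u1 then 0 else 1) * max 0 (?L p) + (if u2 then 0 else 1) * min 0 (?L p))"
    proof cases
      case 1 then show ?thesis using u1[OF e] by (simp add: pw_fun_def fm)
    next
      case 2 then show ?thesis using u2[OF e] by (simp add: pw_fun_def fm)
    next
      case 3 then show ?thesis by (simp add: pw_fun_def fm)
    qed
  qed auto
qed

section \<open>Averages of the kink along an edge and the rectangle inequality\<close>

definition pos_avg :: "real \<Rightarrow> real \<Rightarrow> real" where
  "pos_avg u v = integral {0..1} (\<lambda>t. max 0 (u + t * (v - u)))"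

definition neg_avg :: "real \<Rightarrow> real \<Rightarrow> real" where
  "neg_avg u v = integral {0..1} (\<lambda>t. min 0 (u + t * (v - u)))"

lemma integral_linear_01: "integral {0..1} (\<lambda>t. u + t * (v - u)) = (u + v) / (2::real)"
proof -
  have "((\<lambda>t. u + t * (v - u)) has_integral (u * 1 + 1\<^sup>2 / 2 * (v - u)) - (u * 0 + 0\<^sup>2 / 2 * (v - u))) {0..1}"
    by (intro fundamental_theorem_of_calculus)
      (auto intro!: derivative_eq_intros simp flip: has_real_derivative_iff_has_vector_derivative)
  then show ?thesis by (simp add: integral_unique field_simps)
qed

lemma pos_avg_add_neg_avg: "pos_avg u v + neg_avg u v = (u + v) / 2"
proof -
  have "pos_avg u v + neg_avg u v = integral {0..1} (\<lambda>t. max 0 (u + t * (v - u)) + min 0 (u + t * (v - u)))"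
    unfolding pos_avg_def neg_avg_def
    by (intro integral_add[symmetric] integrable_continuous_real continuous_intros)
  also have "\<dots> = integral {0..1} (\<lambda>t. u + t * (v - u))"
    by (intro integral_cong) (auto simp: max_def min_def)
  finally show ?thesis by (simp add: integral_linear_01)
qed

lemma neg_avg_eq: "neg_avg u v = - pos_avg (- u) (- v)"
proof -
  have "neg_avg u v = integral {0..1} (\<lambda>t. - max 0 (- u + t * (- v - - u)))"
    unfolding neg_avg_def by (intro integral_cong) (auto simp: max_def min_def algebra_simps)
  then show ?thesis by (simp add: pos_avg_def)
qed

lemma pos_avg_mono:
  assumes "u \<le> u'" "v \<le> v'"
  shows "pos_avg u v \<le> pos_avg u' v'"
  unfolding pos_avg_def
proof (intro integral_le integrable_continuous_real continuous_intros)
  fix t :: real assume t: "t \<in> {0..1}"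
  then have "(1 - t) * u + t * v \<le> (1 - t) * u' + t * v'"
    using assms by (intro add_mono mult_left_mono) auto
  then show "max 0 (u + t * (v - u)) \<le> max 0 (u' + t * (v' - u'))" by (simp add: algebra_simps)
qed

lemma pos_avg_nonpos: "u \<le> 0 \<Longrightarrow> v \<le> 0 \<Longrightarrow> pos_avg u v = 0"
proof -
  assume uv: "u \<le> 0" "v \<le> 0"
  have "pos_avg u v = integral {0..1::real} (\<lambda>t. 0)"
    unfolding pos_avg_def
  proof (rule integral_cong)
    fix t :: real assume t: "t \<in> {0..1}"
    then have "(1 - t) * u + t * v \<le> 0"
      using uv by (intro add_nonpos_nonpos mult_nonneg_nonpos) auto
    then show "max 0 (u + t * (v - u)) = 0" by (simp add: algebra_simps)
  qed
  then show ?thesis by simp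
qed

lemma pos_avg_nonneg: "u \<ge> 0 \<Longrightarrow> v \<ge> 0 \<Longrightarrow> pos_avg u v = (u + v) / 2"
  using pos_avg_add_neg_avg[of u v] pos_avg_nonpos[of "- u" "- v"] neg_avg_eq[of u v] by simp

lemma pos_avg_ge_0: "0 \<le> pos_avg u v"
  using pos_avg_mono[of "min u 0" u "min v 0" v] pos_avg_nonpos[of "min u 0" "min v 0"] by simp

lemma pos_avg_le: "u \<le> k \<Longrightarrow> v \<le> k \<Longrightarrow> 0 \<le> k \<Longrightarrow> pos_avg u v \<le> k"
  using pos_avg_mono[of u k v k] pos_avg_nonneg[of k k] by simp

lemma integral_reverse_01:
  fixes f :: "real \<Rightarrow> real"
  assumes "continuous_on {0..1} f"
  shows "integral {0..1} (\<lambda>t. f (1 - t)) = integral {0..1} f"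
proof -
  have "(f has_integral integral {0..1} f) (cbox 0 1)"
    using assms by (simp add: integrable_continuous_real integrable_integral)
  from has_integral_affinity[OF this, of "-1" 1]
  have "((\<lambda>t. f (1 - t)) has_integral integral {0..1} f) {0..1}" by simp
  then show ?thesis by (rule integral_unique)
qed

lemma pos_avg_commute: "pos_avg u v = pos_avg v u"
proof -
  have "pos_avg u v = integral {0..1} (\<lambda>t. max 0 (u + (1 - t) * (v - u)))"
    unfolding pos_avg_def
    by (rule integral_reverse_01[symmetric]) (intro continuous_intros)
  also have "\<dots> = pos_avg v u"
    unfolding pos_avg_def by (intro integral_cong) (simp add: algebra_simps)
  finally show ?thesis .
qed

text \<open>The graph of the positive part is a triangle of base v / (v - u) and height v. The
  product form also covers u = v = 0.\<close>

lemma pos_avg_mixed: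
  assumes "u \<le> 0" "0 \<le> v"
  shows "pos_avg u v * (2 * (v - u)) = v\<^sup>2"
proof (cases "u = v")
  case False
  then have uv: "v - u > 0" using assms by simp
  define s where "s = - u / (v - u)"
  have s: "0 \<le> s" "s \<le> 1" "u + s * (v - u) = 0" using assms uv by (auto simp: s_def field_simps)
  let ?f = "\<lambda>t. max 0 (u + t * (v - u))"
  define G where "G t = u * t + t\<^sup>2 / 2 * (v - u)" for t :: real
  have "integral {0..s} ?f + integral {s..1} ?f = pos_avg u v"
    unfolding pos_avg_def using s
    by (intro Henstock_Kurzweil_Integration.integral_combine integrable_continuous_real continuous_intros)
  moreover have "integral {0..s} ?f = integral {0..s} (\<lambda>t. 0)"
  proof (rule integral_cong)
    fix t assume "t \<in> {0..s}"
    then have "t * (v - u) \<le> s * (v - u)" using uv by (intro mult_right_mono) auto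
    then show "?f t = 0" using s by simp
  qed
  moreover have "integral {s..1} ?f = integral {s..1} (\<lambda>t. u + t * (v - u))"
  proof (rule integral_cong)
    fix t assume "t \<in> {s..1}"
    then have "s * (v - u) \<le> t * (v - u)" using uv by (intro mult_right_mono) auto
    then show "?f t = u + t * (v - u)" using s by simp
  qed
  moreover have "((\<lambda>t. u + t * (v - u)) has_integral (G 1 - G s)) {s..1}"
    using s by (intro fundamental_theorem_of_calculus)
      (auto simp: G_def intro!: derivative_eq_intros simp flip: has_real_derivative_iff_has_vector_derivative)
  then have "integral {s..1} (\<lambda>t. u + t * (v - u)) = G 1 - G s" by (rule integral_unique)
  ultimately have "pos_avg u v = G 1 - G s" by simp
  moreover have "s * (v - u) = - u" using uv by (simp add: s_def)
  then have "2 * (v - u) * (G 1 - G s) = v\<^sup>2"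
    unfolding G_def by (simp add: power2_eq_square) algebra
  ultimately show ?thesis by (simp add: mult.commute)
qed (use assms pos_avg_nonpos in simp)

text \<open>Monotonicity in a form that does not ask for the sign of the increment; this is the
  inequality behind t \<ge> 0 on triangles.\<close>

lemma pos_avg_increment_sign: "0 \<le> k * (pos_avg (u + k) v - pos_avg u v)"
proof (cases "k \<ge> 0")
  case True then show ?thesis using pos_avg_mono[of u "u + k" v v] by simp
next
  case False then show ?thesis using pos_avg_mono[of "u + k" u v v]
    by (intro mult_nonpos_nonpos) auto
qed

text \<open>An affine function with centre value \<open>L\<close> and increments \<open>\<alpha>\<close>, \<open>\<beta>\<close> over the half widths of a rectangle has
  corner values \<open>L \<plusminus> \<alpha> \<plusminus> \<beta>\<close>; the following are the edge averages of its positive part.\<close>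

definition bot_avg where "bot_avg \<alpha> \<beta> L = pos_avg (L - \<alpha> - \<beta>) (L + \<alpha> - \<beta>)"
definition right_avg where "right_avg \<alpha> \<beta> L = pos_avg (L + \<alpha> - \<beta>) (L + \<alpha> + \<beta>)"
definition top_avg where "top_avg \<alpha> \<beta> L = pos_avg (L - \<alpha> + \<beta>) (L + \<alpha> + \<beta>)"
definition left_avg where "left_avg \<alpha> \<beta> L = pos_avg (L - \<alpha> - \<beta>) (L - \<alpha> + \<beta>)"

section \<open>The flux inequality on a rectangle cut by a line\<close>

lemmas side_avg_defs = bot_avg_def right_avg_def top_avg_def left_avg_def

text \<open>For half widths a and b this is -4/3 (a^2 + b^2) times the coefficient of x^2 - y^2 in
  the rotated \<open>Q\<^sub>1\<close> interpolant of the positive part.\<close>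

definition twist where
  "twist \<alpha> \<beta> L = bot_avg \<alpha> \<beta> L + top_avg \<alpha> \<beta> L - right_avg \<alpha> \<beta> L - left_avg \<alpha> \<beta> L"

text \<open>What remains of 2 (A + B) times the flux, with A and B the squared half widths, after
  removing the terms weighted by B / A and A / B. Those are nonnegative by monotonicity, and the
  remainder no longer involves the aspect ratio.\<close>

definition slack where
  "slack \<alpha> \<beta> L X Y = \<alpha> * (right_avg \<alpha> \<beta> L - left_avg \<alpha> \<beta> L) + \<beta> * (top_avg \<alpha> \<beta> L - bot_avg \<alpha> \<beta> L)
     - 3 * twist \<alpha> \<beta> L * (X - Y)"

text \<open>A reflection exchanges the left and right sides and reverses the other two. Together
  with the exchange of the axes it reduces the inequality to 0 \<le> \<beta> \<le> \<alpha>.\<close>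

lemma slack_uminus1: "slack (- \<alpha>) \<beta> L X Y = slack \<alpha> \<beta> L X Y"
proof -
  have "bot_avg (- \<alpha>) \<beta> L = bot_avg \<alpha> \<beta> L" "top_avg (- \<alpha>) \<beta> L = top_avg \<alpha> \<beta> L"
    unfolding side_avg_defs by (subst pos_avg_commute, simp)+
  moreover have "right_avg (- \<alpha>) \<beta> L = left_avg \<alpha> \<beta> L" "left_avg (- \<alpha>) \<beta> L = right_avg \<alpha> \<beta> L"
    unfolding side_avg_defs by simp_all
  ultimately show ?thesis by (simp add: slack_def twist_def algebra_simps)
qed

lemma slack_swap: "slack \<beta> \<alpha> L Y X = slack \<alpha> \<beta> L X Y"
  unfolding slack_def twist_def side_avg_defs
  by (simp add: algebra_simps)

lemma slack_uminus2: "slack \<alpha> (- \<beta>) L X Y = slack \<alpha> \<beta> L X Y"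
  by (metis slack_swap slack_uminus1)

text \<open>The case of a line through both horizontal sides: u = L + \<alpha> is the average over
  the right side, and W in the proof is -2 \<alpha> times \<open>twist\<close>.\<close>

lemma slack_two_vertices:
  fixes \<alpha> \<beta> u Y :: real
  assumes ab: "0 \<le> \<beta>" "\<beta> \<le> \<alpha>" and u: "\<beta> \<le> u" "u + \<beta> \<le> 2 * \<alpha>" and Y: "\<bar>Y\<bar> \<le> \<beta>"
  shows "0 \<le> 2 * u * (\<alpha>\<^sup>2 + \<beta>\<^sup>2) + 3 * (2 * \<alpha> * u - u\<^sup>2 - \<beta>\<^sup>2) * (\<alpha> - u - 2 * Y)"
proof -
  define W where "W = 2 * \<alpha> * u - u\<^sup>2 - \<beta>\<^sup>2"
  have "W = (u - \<beta>) * (2 * \<alpha> - u - \<beta>) + 2 * \<beta> * (\<alpha> - \<beta>)"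
    by (simp add: W_def algebra_simps power2_eq_square)
  moreover have "0 \<le> (u - \<beta>) * (2 * \<alpha> - u - \<beta>)" "0 \<le> 2 * \<beta> * (\<alpha> - \<beta>)" using assms by auto
  ultimately have W0: "0 \<le> W" by linarith
  \<comment> \<open>Since W is nonnegative, the expression decreases in Y, and the worst case is Y =
    \<beta>.\<close>
  have "W * (\<alpha> - u - 2 * \<beta>) \<le> W * (\<alpha> - u - 2 * Y)" using Y W0 by (intro mult_left_mono) auto
  moreover have "0 \<le> 2 * u * (\<alpha>\<^sup>2 + \<beta>\<^sup>2) + 3 * W * (\<alpha> - u - 2 * \<beta>)"
  proof (cases "\<alpha> - u - 2 * \<beta> \<ge> 0")
    case True
    then show ?thesis using W0 ab u by simp
  next
    case False
    define z where "z = u + 2 * \<beta> - \<alpha>"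
    have z: "z \<ge> 0" using False by (simp add: z_def)
    \<comment> \<open>Chosen so that u w exceeds W by a perfect square. Replacing W by u w brings
      out the factor u and leaves a quadratic form; completing its square in \<alpha> leaves
      nonnegative multiples of (u - \<beta>)^2, u \<beta> and \<beta>^2.\<close>
    define w where "w = 2 * \<alpha> - 3 / 4 * u - \<beta>"
    have "W = u * w - (\<beta> - u / 2)\<^sup>2"
      by (simp add: W_def w_def power2_eq_square algebra_simps)
    then have "W \<le> u * w" by simp
    then have 1: "3 * W * z \<le> 3 * (u * w) * z" using z by (intro mult_right_mono) auto
    have "2 * (\<alpha>\<^sup>2 + \<beta>\<^sup>2) - 3 * w * z
        = 8 * (\<alpha> - 33 / 64 * u - 15 / 16 * \<beta>)\<^sup>2 + 63 / 512 * (u - \<beta>)\<^sup>2 + 3 / 256 * (u * \<beta>) + (31 / 32 - 63 / 512) * \<beta>\<^sup>2"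
      by (simp add: w_def z_def power2_eq_square field_simps)
    also have "\<dots> \<ge> 0" using ab u by (intro add_nonneg_nonneg mult_nonneg_nonneg) auto
    finally have "u * (3 * w * z) \<le> u * (2 * (\<alpha>\<^sup>2 + \<beta>\<^sup>2))" using ab u by (intro mult_left_mono) auto
    then have "3 * W * z \<le> 2 * u * (\<alpha>\<^sup>2 + \<beta>\<^sup>2)" using 1 by (simp add: algebra_simps)
    moreover have "3 * W * (\<alpha> - u - 2 * \<beta>) = - (3 * W * z)" by (simp add: z_def algebra_simps)
    ultimately show ?thesis by linarith
  qed
  ultimately show ?thesis unfolding W_def[symmetric] by (simp add: mult.assoc)
qed

text \<open>With \<beta> \<le> \<alpha> the corner values are ordered, and |L| \<le> \<alpha> +
  \<beta> fixes the signs of the smallest and the largest. The signs of the two middle ones give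
  three configurations, with two, one or three positive corners; in each of them the side averages
  are explicit, and the condition that (X, Y) lies on the line leaves one free parameter.\<close>

lemma slack_nonneg_ordered:
  assumes ab: "0 \<le> \<beta>" "\<beta> \<le> \<alpha>" and L: "\<bar>L\<bar> \<le> \<alpha> + \<beta>" and X: "\<bar>X\<bar> \<le> \<alpha>" and Y: "\<bar>Y\<bar> \<le> \<beta>"
    and on: "L + X + Y = 0"
  shows "0 \<le> slack \<alpha> \<beta> L X Y"
proof -
  consider "\<alpha> = 0" | "\<alpha> > 0" "L + \<alpha> - \<beta> \<ge> 0" "L - \<alpha> + \<beta> \<le> 0" | "L + \<alpha> - \<beta> < 0" | "L - \<alpha> + \<beta> > 0"
    using ab by linarith
  then show ?thesis
  proof cases
    case 1
    then show ?thesis using X Y ab by (simp add: slack_def)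
  next
    case 2
    define u where "u = L + \<alpha>"
    have r: "right_avg \<alpha> \<beta> L = u" using 2 ab pos_avg_nonneg[of "L + \<alpha> - \<beta>" "L + \<alpha> + \<beta>"] by (simp add: right_avg_def u_def)
    have l: "left_avg \<alpha> \<beta> L = 0" using 2 ab L by (simp add: left_avg_def pos_avg_nonpos)
    have b: "4 * \<alpha> * bot_avg \<alpha> \<beta> L = (u - \<beta>)\<^sup>2"
      using pos_avg_mixed[of "L - \<alpha> - \<beta>" "L + \<alpha> - \<beta>"] 2 ab L by (simp add: bot_avg_def u_def algebra_simps)
    have t: "4 * \<alpha> * top_avg \<alpha> \<beta> L = (u + \<beta>)\<^sup>2"
      using pos_avg_mixed[of "L - \<alpha> + \<beta>" "L + \<alpha> + \<beta>"] 2 ab L by (simp add: top_avg_def u_def algebra_simps)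
    have X: "X = \<alpha> - u - Y" using on by (simp add: u_def)
    have "4 * \<alpha> * slack \<alpha> \<beta> L X Y = 4 * \<alpha> * \<alpha> * u + \<beta> * ((u + \<beta>)\<^sup>2 - (u - \<beta>)\<^sup>2)
        - 3 * ((u - \<beta>)\<^sup>2 + (u + \<beta>)\<^sup>2 - 4 * \<alpha> * u) * (\<alpha> - u - 2 * Y)"
      unfolding slack_def twist_def r l b[symmetric] t[symmetric] X by (simp add: algebra_simps)
    also have "\<dots> = 2 * (2 * u * (\<alpha>\<^sup>2 + \<beta>\<^sup>2) + 3 * (2 * \<alpha> * u - u\<^sup>2 - \<beta>\<^sup>2) * (\<alpha> - u - 2 * Y))"
      by (simp add: power2_eq_square algebra_simps)
    also have "\<dots> \<ge> 0" using slack_two_vertices[OF ab, of u Y] 2 Y by (simp add: u_def)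
    finally show ?thesis using 2(1) by (simp add: zero_le_mult_iff)
  next
    case 3
    \<comment> \<open>\<open>e\<close> is the largest corner value, here the only positive one; the
      slack becomes a multiple of e^2.\<close>
    define e where "e = L + \<alpha> + \<beta>"
    have e: "0 \<le> e" "e \<le> 2 * \<beta>" and pos: "\<alpha> > 0" "\<beta> > 0" using 3 L ab by (auto simp: e_def)
    have l: "left_avg \<alpha> \<beta> L = 0" using 3 ab L by (simp add: left_avg_def pos_avg_nonpos)
    have b: "bot_avg \<alpha> \<beta> L = 0" using 3 ab L by (simp add: bot_avg_def pos_avg_nonpos)
    have r: "4 * \<beta> * right_avg \<alpha> \<beta> L = e\<^sup>2"
      using pos_avg_mixed[of "L + \<alpha> - \<beta>" "L + \<alpha> + \<beta>"] 3 e by (simp add: right_avg_def e_def algebra_simps)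
    have t: "4 * \<alpha> * top_avg \<alpha> \<beta> L = e\<^sup>2"
      using pos_avg_mixed[of "L - \<alpha> + \<beta>" "L + \<alpha> + \<beta>"] 3 ab e by (simp add: top_avg_def e_def algebra_simps)
    have "4 * \<alpha> * \<beta> * slack \<alpha> \<beta> L X Y = \<alpha>\<^sup>2 * (4 * \<beta> * right_avg \<alpha> \<beta> L) + \<beta>\<^sup>2 * (4 * \<alpha> * top_avg \<alpha> \<beta> L)
        - 3 * (\<beta> * (4 * \<alpha> * top_avg \<alpha> \<beta> L) - \<alpha> * (4 * \<beta> * right_avg \<alpha> \<beta> L)) * (X - Y)"
      unfolding slack_def twist_def l b by (simp add: algebra_simps power2_eq_square)
    also have "\<dots> = e\<^sup>2 * (\<alpha>\<^sup>2 + \<beta>\<^sup>2 + 3 * (\<alpha> - \<beta>) * (X - Y))"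
      unfolding r t by (simp add: algebra_simps)
    also have "\<dots> \<ge> 0"
    proof -
      \<comment> \<open>On the line X - Y = - L - 2 Y = \<alpha> + \<beta> - e - 2 Y, and both e and
        2 Y are at most 2 \<beta>.\<close>
      have "X - Y \<ge> \<alpha> - 3 * \<beta>" using on Y e by (simp add: e_def)
      then have "3 * (\<alpha> - \<beta>) * (\<alpha> - 3 * \<beta>) \<le> 3 * (\<alpha> - \<beta>) * (X - Y)" using ab by (intro mult_left_mono) auto
      moreover have "\<alpha>\<^sup>2 + \<beta>\<^sup>2 + 3 * (\<alpha> - \<beta>) * (\<alpha> - 3 * \<beta>) = (2 * \<alpha> - 3 * \<beta>)\<^sup>2 + \<beta>\<^sup>2"
        by (simp add: power2_eq_square algebra_simps)
      ultimately have "0 \<le> \<alpha>\<^sup>2 + \<beta>\<^sup>2 + 3 * (\<alpha> - \<beta>) * (X - Y)"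
        by (smt (verit) zero_le_power2)
      then show ?thesis by simp
    qed
    finally have "4 * \<alpha> * \<beta> * 0 \<le> 4 * \<alpha> * \<beta> * slack \<alpha> \<beta> L X Y" by simp
    then show ?thesis by (rule mult_left_le_imp_le) (use pos in simp)
  next
    case 4
    \<comment> \<open>Now -e is the smallest corner value, the only negative one. The slack is that
      of the affine function itself, whose flux has no twist, minus a multiple of e^2.\<close>
    define e where "e = \<alpha> + \<beta> - L"
    have e: "0 \<le> e" "e \<le> 2 * \<beta>" and pos: "\<alpha> > 0" "\<beta> > 0" using 4 L ab by (auto simp: e_def)
    have r: "right_avg \<alpha> \<beta> L = L + \<alpha>" using 4 ab L pos_avg_nonneg[of "L + \<alpha> - \<beta>" "L + \<alpha> + \<beta>"] by (simp add: right_avg_def)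
    have t: "top_avg \<alpha> \<beta> L = L + \<beta>" using 4 ab L pos_avg_nonneg[of "L - \<alpha> + \<beta>" "L + \<alpha> + \<beta>"] by (simp add: top_avg_def)
    have b: "4 * \<alpha> * bot_avg \<alpha> \<beta> L = (2 * \<alpha> - e)\<^sup>2"
      using pos_avg_mixed[of "L - \<alpha> - \<beta>" "L + \<alpha> - \<beta>"] 4 ab e by (simp add: bot_avg_def e_def algebra_simps)
    have l: "4 * \<beta> * left_avg \<alpha> \<beta> L = (2 * \<beta> - e)\<^sup>2"
      using pos_avg_mixed[of "L - \<alpha> - \<beta>" "L - \<alpha> + \<beta>"] 4 e by (simp add: left_avg_def e_def algebra_simps)
    have Le: "L = \<alpha> + \<beta> - e" by (simp add: e_def)
    have "4 * \<alpha> * \<beta> * slack \<alpha> \<beta> L X Y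
        = \<alpha>\<^sup>2 * (4 * \<beta> * (L + \<alpha>) - 4 * \<beta> * left_avg \<alpha> \<beta> L) + \<beta>\<^sup>2 * (4 * \<alpha> * (L + \<beta>) - 4 * \<alpha> * bot_avg \<alpha> \<beta> L)
        - 3 * (\<beta> * (4 * \<alpha> * bot_avg \<alpha> \<beta> L) + 4 * \<alpha> * \<beta> * (L + \<beta>) - 4 * \<alpha> * \<beta> * (L + \<alpha>)
            - \<alpha> * (4 * \<beta> * left_avg \<alpha> \<beta> L)) * (X - Y)"
      unfolding slack_def twist_def r t by (simp add: algebra_simps power2_eq_square)
    also have "\<dots> = 8 * \<alpha> * \<beta> * (\<alpha>\<^sup>2 + \<beta>\<^sup>2) - e\<^sup>2 * (\<alpha>\<^sup>2 + \<beta>\<^sup>2 - 3 * (\<alpha> - \<beta>) * (X - Y))"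
      unfolding b l unfolding Le by (simp add: algebra_simps power2_eq_square power3_eq_cube)
    also have "\<dots> \<ge> 0"
    proof -
      \<comment> \<open>Here X - Y = 2 X + L, bounded below through X \<ge> -\<alpha> and e \<le> 2
        \<beta>.\<close>
      have "X - Y \<ge> - \<alpha> - \<beta>" using on X e by (simp add: e_def)
      then have "3 * (\<alpha> - \<beta>) * (- \<alpha> - \<beta>) \<le> 3 * (\<alpha> - \<beta>) * (X - Y)" using ab by (intro mult_left_mono) auto
      moreover have "\<alpha>\<^sup>2 + \<beta>\<^sup>2 - 3 * (\<alpha> - \<beta>) * (- \<alpha> - \<beta>) = 4 * \<alpha>\<^sup>2 - 2 * \<beta>\<^sup>2"
        by (simp add: power2_eq_square algebra_simps)
      ultimately have "\<alpha>\<^sup>2 + \<beta>\<^sup>2 - 3 * (\<alpha> - \<beta>) * (X - Y) \<le> 4 * \<alpha>\<^sup>2 - 2 * \<beta>\<^sup>2" by linarith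
      then have "e\<^sup>2 * (\<alpha>\<^sup>2 + \<beta>\<^sup>2 - 3 * (\<alpha> - \<beta>) * (X - Y)) \<le> e\<^sup>2 * (4 * \<alpha>\<^sup>2 - 2 * \<beta>\<^sup>2)"
        by (intro mult_left_mono) auto
      also have "\<dots> \<le> (2 * \<beta>)\<^sup>2 * (4 * \<alpha>\<^sup>2 - 2 * \<beta>\<^sup>2)"
      proof (intro mult_right_mono power_mono)
        have "\<beta>\<^sup>2 \<le> \<alpha>\<^sup>2" using ab by (intro power_mono) auto
        then show "0 \<le> 4 * \<alpha>\<^sup>2 - 2 * \<beta>\<^sup>2" using zero_le_power2[of \<alpha>] by linarith
      qed (use e in auto)
      also have "\<dots> \<le> 8 * \<alpha> * \<beta> * (\<alpha>\<^sup>2 + \<beta>\<^sup>2)"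
      proof -
        have "8 * \<alpha> * \<beta> * (\<alpha>\<^sup>2 + \<beta>\<^sup>2) - (2 * \<beta>)\<^sup>2 * (4 * \<alpha>\<^sup>2 - 2 * \<beta>\<^sup>2)
            = 8 * \<alpha> * \<beta> * (\<alpha> - \<beta>)\<^sup>2 + 8 * (\<beta>\<^sup>2 * \<beta>\<^sup>2)"
          by (simp add: power2_eq_square algebra_simps)
        moreover have "0 \<le> 8 * \<alpha> * \<beta> * (\<alpha> - \<beta>)\<^sup>2" using pos by simp
        moreover have "0 \<le> 8 * (\<beta>\<^sup>2 * \<beta>\<^sup>2)" by simp
        ultimately show ?thesis by linarith
      qed
      finally show ?thesis by linarith
    qed
    finally have "4 * \<alpha> * \<beta> * 0 \<le> 4 * \<alpha> * \<beta> * slack \<alpha> \<beta> L X Y" by simp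
    then show ?thesis by (rule mult_left_le_imp_le) (use pos in simp)
  qed
qed

lemma slack_nonneg:
  assumes L: "\<bar>L\<bar> \<le> \<bar>\<alpha>\<bar> + \<bar>\<beta>\<bar>" and X: "\<bar>X\<bar> \<le> \<bar>\<alpha>\<bar>" and Y: "\<bar>Y\<bar> \<le> \<bar>\<beta>\<bar>" and on: "L + X + Y = 0"
  shows "0 \<le> slack \<alpha> \<beta> L X Y"
proof -
  have "slack \<alpha> \<beta> L X Y = slack \<bar>\<alpha>\<bar> \<bar>\<beta>\<bar> L X Y" by (simp add: abs_if slack_uminus1 slack_uminus2)
  also have "\<dots> \<ge> 0"
  proof (cases "\<bar>\<beta>\<bar> \<le> \<bar>\<alpha>\<bar>")
    case True
    then show ?thesis using assms by (intro slack_nonneg_ordered) auto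
  next
    case False
    then have "0 \<le> slack \<bar>\<beta>\<bar> \<bar>\<alpha>\<bar> L Y X" using assms by (intro slack_nonneg_ordered) auto
    then show ?thesis by (simp add: slack_swap)
  qed
  finally show ?thesis .
qed

text \<open>Moving \<open>(X, Y)\<close> to the line towards the corner where the affine function is extremal changes
  both coordinates in the same direction, so \<open>X - Y\<close> changes by at most the value to be removed.\<close>

lemma slack_near_line:
  assumes L: "\<bar>L\<bar> \<le> \<bar>\<alpha>\<bar> + \<bar>\<beta>\<bar>" and X: "\<bar>X\<bar> \<le> \<bar>\<alpha>\<bar>" and Y: "\<bar>Y\<bar> \<le> \<bar>\<beta>\<bar>"
  shows "- 3 * \<bar>twist \<alpha> \<beta> L\<bar> * \<bar>L + X + Y\<bar> \<le> slack \<alpha> \<beta> L X Y"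
proof -
  define l where "l = L + X + Y"
  have "\<exists>X' Y'. \<bar>X'\<bar> \<le> \<bar>\<alpha>\<bar> \<and> \<bar>Y'\<bar> \<le> \<bar>\<beta>\<bar> \<and> L + X' + Y' = 0 \<and> \<bar>(X - Y) - (X' - Y')\<bar> \<le> \<bar>l\<bar>"
  proof (cases "l = 0")
    case True
    then show ?thesis using X Y by (intro exI[of _ X] exI[of _ Y]) (simp add: l_def)
  next
    case False
    define s where "s = sgn l"
    have s: "\<bar>s\<bar> = 1" "s * \<bar>l\<bar> = l" "s * l = \<bar>l\<bar>" using False by (auto simp: s_def sgn_if)
    have sl: "s * L \<le> \<bar>\<alpha>\<bar> + \<bar>\<beta>\<bar>" "- (s * X) \<le> \<bar>\<alpha>\<bar>" "- (s * Y) \<le> \<bar>\<beta>\<bar>"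
      using L X Y s(1) by (auto simp: abs_if split: if_splits)
    define A where "A = \<bar>\<alpha>\<bar> + s * X"
    define B where "B = \<bar>\<beta>\<bar> + s * Y"
    have AB: "A \<ge> 0" "B \<ge> 0" "\<bar>l\<bar> \<le> A + B"
      using sl s(3) by (auto simp: A_def B_def l_def algebra_simps)
    \<comment> \<open>\<open>A\<close> and \<open>B\<close> are the coordinate distances from (X, Y)
      to the corner where s times the affine function is smallest. Going all the way there lowers s
      l by A + B, so \<theta> is the fraction of the way at which the function vanishes.\<close>
    define \<theta> where "\<theta> = \<bar>l\<bar> / (A + B)"
    have pos: "A + B > 0" using AB False by linarith
    have "\<theta> * (A + B) = \<bar>l\<bar>" using pos by (simp add: \<theta>_def)
    then have th: "0 \<le> \<theta>" "\<theta> \<le> 1" "\<theta> * A + \<theta> * B = \<bar>l\<bar>"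
      using AB pos by (auto simp: \<theta>_def distrib_left)
    have ss: "s * s = 1" using s(1) by (metis abs_mult_self_eq mult_1)
    have bd: "\<bar>Z - \<theta> * (s * (\<bar>z\<bar> + s * Z))\<bar> \<le> \<bar>z\<bar>" if "\<bar>Z\<bar> \<le> \<bar>z\<bar>" for Z z
    proof -
      have "Z - \<theta> * (s * (\<bar>z\<bar> + s * Z)) = (1 - \<theta>) * Z - \<theta> * s * \<bar>z\<bar>"
      proof -
        have "\<theta> * (s * (\<bar>z\<bar> + s * Z)) = \<theta> * s * \<bar>z\<bar> + \<theta> * (s * s) * Z" by (simp add: algebra_simps)
        then show ?thesis using ss by (simp add: algebra_simps)
      qed
      also have "\<bar>\<dots>\<bar> \<le> \<bar>(1 - \<theta>) * Z\<bar> + \<bar>\<theta> * s * \<bar>z\<bar>\<bar>" by (rule abs_triangle_ineq4)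
      also have "\<dots> = (1 - \<theta>) * \<bar>Z\<bar> + \<theta> * \<bar>z\<bar>" using th s by (simp add: abs_mult)
      also have "\<dots> \<le> (1 - \<theta>) * \<bar>z\<bar> + \<theta> * \<bar>z\<bar>" using that th by (intro add_mono mult_left_mono) auto
      finally show ?thesis by (simp add: algebra_simps)
    qed
    show ?thesis
    proof (intro exI conjI)
      show "\<bar>X - \<theta> * (s * A)\<bar> \<le> \<bar>\<alpha>\<bar>" unfolding A_def by (rule bd[OF X])
      show "\<bar>Y - \<theta> * (s * B)\<bar> \<le> \<bar>\<beta>\<bar>" unfolding B_def by (rule bd[OF Y])
      have "L + (X - \<theta> * (s * A)) + (Y - \<theta> * (s * B)) = l - s * (\<theta> * A + \<theta> * B)"
        by (simp add: l_def algebra_simps)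
      then show "L + (X - \<theta> * (s * A)) + (Y - \<theta> * (s * B)) = 0" using th(3) s(2) by simp
      have "(X - Y) - ((X - \<theta> * (s * A)) - (Y - \<theta> * (s * B))) = s * (\<theta> * A - \<theta> * B)" by (simp add: algebra_simps)
      then have "\<bar>(X - Y) - ((X - \<theta> * (s * A)) - (Y - \<theta> * (s * B)))\<bar> = \<bar>\<theta> * A - \<theta> * B\<bar>" using s(1) by (simp add: abs_mult)
      also have "\<dots> \<le> \<theta> * A + \<theta> * B" using mult_nonneg_nonneg[OF th(1) AB(1)] mult_nonneg_nonneg[OF th(1) AB(2)] by linarith
      finally show "\<bar>(X - Y) - ((X - \<theta> * (s * A)) - (Y - \<theta> * (s * B)))\<bar> \<le> \<bar>l\<bar>" using th by simp
    qed
  qed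
  then obtain X' Y' where XY: "\<bar>X'\<bar> \<le> \<bar>\<alpha>\<bar>" "\<bar>Y'\<bar> \<le> \<bar>\<beta>\<bar>" "L + X' + Y' = 0" "\<bar>(X - Y) - (X' - Y')\<bar> \<le> \<bar>l\<bar>"
    by blast
  have "slack \<alpha> \<beta> L X Y = slack \<alpha> \<beta> L X' Y' - 3 * twist \<alpha> \<beta> L * ((X - Y) - (X' - Y'))"
    by (simp add: slack_def algebra_simps)
  moreover have "0 \<le> slack \<alpha> \<beta> L X' Y'" by (rule slack_nonneg[OF L XY(1-3)])
  moreover have "twist \<alpha> \<beta> L * ((X - Y) - (X' - Y')) \<le> \<bar>twist \<alpha> \<beta> L\<bar> * \<bar>l\<bar>"
  proof -
    have "twist \<alpha> \<beta> L * ((X - Y) - (X' - Y')) \<le> \<bar>twist \<alpha> \<beta> L\<bar> * \<bar>(X - Y) - (X' - Y')\<bar>"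
      by (simp flip: abs_mult)
    also have "\<dots> \<le> \<bar>twist \<alpha> \<beta> L\<bar> * \<bar>l\<bar>" using XY(4) by (intro mult_left_mono) auto
    finally show ?thesis .
  qed
  ultimately show ?thesis unfolding l_def[symmetric] by simp
qed

section \<open>Quadratic functions and the jump coefficient\<close>

text \<open>The normal derivative of the rotated \<open>Q\<^sub>1\<close> interpolant of the positive part, with \<open>A\<close> and \<open>B\<close> the squared
  half widths and \<open>X\<close>, \<open>Y\<close> the increments of the affine function from the centre to \<open>F\<close>.\<close>

definition rect_flux where
  "rect_flux \<alpha> \<beta> L X Y A B = (\<alpha> * (right_avg \<alpha> \<beta> L - left_avg \<alpha> \<beta> L) / A
     + \<beta> * (top_avg \<alpha> \<beta> L - bot_avg \<alpha> \<beta> L) / B) / 2 - 3 / 2 * twist \<alpha> \<beta> L * (X - Y) / (A + B)"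

text \<open>On the line the flux is nonnegative. Off the line the loss is the slope of the flux in X
  - Y, which is proportional to \<open>twist\<close>, times the value of the affine function at the
  point.\<close>

lemma rect_flux_ge:
  assumes L: "\<bar>L\<bar> \<le> \<bar>\<alpha>\<bar> + \<bar>\<beta>\<bar>" and X: "\<bar>X\<bar> \<le> \<bar>\<alpha>\<bar>" and Y: "\<bar>Y\<bar> \<le> \<bar>\<beta>\<bar>" and AB: "A > 0" "B > 0"
  shows "- (3 / 2 * \<bar>twist \<alpha> \<beta> L\<bar> * \<bar>L + X + Y\<bar> / (A + B)) \<le> rect_flux \<alpha> \<beta> L X Y A B"
proof -
  define P where "P = \<alpha> * (right_avg \<alpha> \<beta> L - left_avg \<alpha> \<beta> L)"
  define Q where "Q = \<beta> * (top_avg \<alpha> \<beta> L - bot_avg \<alpha> \<beta> L)"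
  have P: "0 \<le> P"
    unfolding P_def side_avg_defs zero_le_mult_iff
    by (cases "\<alpha> \<ge> 0") (auto intro!: pos_avg_mono)
  have Q: "0 \<le> Q"
    unfolding Q_def side_avg_defs zero_le_mult_iff
    by (cases "\<beta> \<ge> 0") (auto intro!: pos_avg_mono)
  \<comment> \<open>Multiplying P / A + Q / B by A + B gives P + Q, the part kept in
    \<open>slack\<close>, and the two nonnegative cross terms.\<close>
  have "slack \<alpha> \<beta> L X Y + (P * (B / A) + Q * (A / B)) = 2 * (A + B) * rect_flux \<alpha> \<beta> L X Y A B"
  proof -
    have "2 * (A + B) * ((P / A + Q / B) / 2) = P + Q + (P * (B / A) + Q * (A / B))"
      using AB by (simp add: field_simps)
    moreover have "2 * (A + B) * (3 / 2 * twist \<alpha> \<beta> L * (X - Y) / (A + B)) = 3 * twist \<alpha> \<beta> L * (X - Y)"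
      using AB by simp
    ultimately show ?thesis
      unfolding slack_def rect_flux_def P_def[symmetric] Q_def[symmetric] right_diff_distrib[of "2 * (A + B)"]
      by linarith
  qed
  moreover have "0 \<le> P * (B / A) + Q * (A / B)" using P Q AB by simp
  ultimately have "- 3 * \<bar>twist \<alpha> \<beta> L\<bar> * \<bar>L + X + Y\<bar> \<le> 2 * (A + B) * rect_flux \<alpha> \<beta> L X Y A B"
    using slack_near_line[OF L X Y] by linarith
  then show ?thesis using AB by (simp add: field_simps)
qed

lemma abs_twist_le:
  assumes "\<bar>L\<bar> + \<bar>\<alpha>\<bar> + \<bar>\<beta>\<bar> \<le> k"
  shows "\<bar>twist \<alpha> \<beta> L\<bar> \<le> 2 * k"
proof -
  have "0 \<le> bot_avg \<alpha> \<beta> L \<and> bot_avg \<alpha> \<beta> L \<le> k" "0 \<le> top_avg \<alpha> \<beta> L \<and> top_avg \<alpha> \<beta> L \<le> k"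
    "0 \<le> left_avg \<alpha> \<beta> L \<and> left_avg \<alpha> \<beta> L \<le> k" "0 \<le> right_avg \<alpha> \<beta> L \<and> right_avg \<alpha> \<beta> L \<le> k"
    using assms unfolding side_avg_defs by (auto intro!: pos_avg_ge_0 pos_avg_le)
  then show ?thesis unfolding twist_def by linarith
qed

text \<open>One family for both local spaces, with d = 0 on triangles; it is closed under partial
  derivatives.\<close>

definition quad :: "real \<Rightarrow> real \<Rightarrow> real \<Rightarrow> real \<Rightarrow> pt \<Rightarrow> real" where
  "quad a b c d = (\<lambda>(x, y). a + b * x + c * y + d * (x\<^sup>2 - y\<^sup>2))"

lemma Pi_T_quad:
  assumes "f \<in> Pi_T rect"
  obtains a b c d where "f = quad a b c d" "\<not> rect \<Longrightarrow> d = 0"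
proof (cases rect)
  case True
  with assms obtain a b c d where "f = (\<lambda>(x, y). a + b * x + c * y + d * (x\<^sup>2 - y\<^sup>2))" unfolding Pi_T_def by auto
  then show ?thesis using that[of a b c d] True by (simp add: quad_def)
next
  case False
  with assms obtain a b c where "f = (\<lambda>(x, y). a + b * x + c * y)" unfolding Pi_T_def by auto
  then show ?thesis using that[of a b c 0] False by (simp add: quad_def)
qed

lemma dx_quad: "dx (quad a b c d) = quad b (2 * d) 0 0"
proof
  fix p :: pt
  have "((\<lambda>t. a + b * t + c * snd p + d * (t\<^sup>2 - (snd p)\<^sup>2)) has_real_derivative b + 2 * d * fst p) (at (fst p))"
    by (auto intro!: derivative_eq_intros)
  from DERIV_imp_deriv[OF this] show "dx (quad a b c d) p = quad b (2 * d) 0 0 p"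
    by (cases p) (simp add: dx_def quad_def)
qed

lemma dy_quad: "dy (quad a b c d) = quad c 0 (- 2 * d) 0"
proof
  fix p :: pt
  have "((\<lambda>t. a + b * fst p + c * t + d * ((fst p)\<^sup>2 - t\<^sup>2)) has_real_derivative c - 2 * d * snd p) (at (snd p))"
    by (auto intro!: derivative_eq_intros)
  from DERIV_imp_deriv[OF this] show "dy (quad a b c d) p = quad c 0 (- 2 * d) 0 p"
    by (cases p) (simp add: dy_def quad_def)
qed

lemma grad_quad: "grad (quad a b c d) (x, y) = (b + 2 * d * x, c - 2 * d * y)"
  by (simp add: grad_def dx_quad dy_quad) (simp add: quad_def)

lemma continuous_on_quad_line: "continuous_on S (\<lambda>t. quad a b c d (P + t *\<^sub>R V))"
  unfolding quad_def case_prod_unfold by (intro continuous_intros)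

lemma edge_avg_quad:
  "edge_avg (quad a b c d) ((px, py), (qx, qy)) = a + b * (px + qx) / 2 + c * (py + qy) / 2
     + d * ((px\<^sup>2 + px * qx + qx\<^sup>2) - (py\<^sup>2 + py * qy + qy\<^sup>2)) / 3"
proof -
  define A where "A = a + b * px + c * py + d * (px\<^sup>2 - py\<^sup>2)"
  define B where "B = b * (qx - px) + c * (qy - py) + 2 * d * (px * (qx - px) - py * (qy - py))"
  define C where "C = d * ((qx - px)\<^sup>2 - (qy - py)\<^sup>2)"
  define G where "G t = A * t + B * (t\<^sup>2 / 2) + C * (t ^ 3 / 3)" for t :: real
  have "((\<lambda>t. A + B * t + C * t\<^sup>2) has_integral (G 1 - G 0)) {0..1}"
    by (intro fundamental_theorem_of_calculus)
      (auto simp: G_def intro!: derivative_eq_intros simp flip: has_real_derivative_iff_has_vector_derivative)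
  moreover have "quad a b c d ((px, py) + t *\<^sub>R ((qx, qy) - (px, py))) = A + B * t + C * t\<^sup>2" for t
    by (simp add: quad_def A_def B_def C_def power2_eq_square algebra_simps)
  ultimately have "edge_avg (quad a b c d) ((px, py), (qx, qy)) = G 1 - G 0"
    unfolding edge_avg_def by (simp add: integral_unique)
  also have "\<dots> = A + B / 2 + C / 3" by (simp add: G_def)
  finally show ?thesis by (simp add: A_def B_def C_def power2_eq_square field_simps)
qed

lemma edge_avg_quad_commute: "edge_avg (quad a b c d) (U, V) = edge_avg (quad a b c d) (V, U)"
  by (cases U, cases V) (simp add: edge_avg_quad algebra_simps)

text \<open>Edge average, from the end values, of the kink that the minus piece adds to the plus
  polynomial: the bits select the positive part, the negative part, the whole affine function or
  0.\<close>

definition kink_avg :: "real \<Rightarrow> real \<Rightarrow> real \<Rightarrow> real \<Rightarrow> real" where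
  "kink_avg e1 e2 u v = e1 * pos_avg u v + e2 * neg_avg u v"

lemma kink_avg_commute: "kink_avg e1 e2 u v = kink_avg e1 e2 v u"
  by (simp add: kink_avg_def neg_avg_eq pos_avg_commute)

lemma kink_avg_le:
  assumes "e1 \<in> {0, 1}" "e2 \<in> {0, 1}" "\<bar>u\<bar> \<le> k" "\<bar>v\<bar> \<le> k"
  shows "\<bar>kink_avg e1 e2 u v\<bar> \<le> k"
proof -
  have "pos_avg u v \<le> k" "pos_avg (- u) (- v) \<le> k" using assms by (auto intro!: pos_avg_le)
  then show ?thesis
    using assms pos_avg_ge_0[of u v] pos_avg_ge_0[of "- u" "- v"] by (auto simp: kink_avg_def neg_avg_eq)
qed

lemma edge_avg_kink:
  fixes n D U V :: pt
  assumes g: "\<And>p. p \<in> closed_segment U V \<Longrightarrow>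
    g p = quad a b c' d p + c * (e1 * max 0 (inner n (p - D)) + e2 * min 0 (inner n (p - D)))"
  shows "edge_avg g (U, V) = edge_avg (quad a b c' d) (U, V) + c * kink_avg e1 e2 (inner n (U - D)) (inner n (V - D))"
proof -
  define u where "u = inner n (U - D)"
  define v where "v = inner n (V - D)"
  have "edge_avg g (U, V) = integral {0..1} (\<lambda>t. quad a b c' d (U + t *\<^sub>R (V - U))
      + c * (e1 * max 0 (u + t * (v - u)) + e2 * min 0 (u + t * (v - u))))"
    unfolding edge_avg_def prod.case
  proof (rule integral_cong)
    fix t :: real assume t: "t \<in> {0..1}"
    have "U + t *\<^sub>R (V - U) = (1 - t) *\<^sub>R U + t *\<^sub>R V" by (simp add: algebra_simps)
    then have "U + t *\<^sub>R (V - U) \<in> closed_segment U V" using t unfolding closed_segment_def by auto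
    moreover have "inner n (U + t *\<^sub>R (V - U) - D) = u + t * (v - u)"
      by (simp add: u_def v_def inner_diff_right inner_add_right algebra_simps)
    ultimately show "g (U + t *\<^sub>R (V - U)) = quad a b c' d (U + t *\<^sub>R (V - U))
      + c * (e1 * max 0 (u + t * (v - u)) + e2 * min 0 (u + t * (v - u)))" using g by simp
  qed
  also have "\<dots> = integral {0..1} (\<lambda>t. quad a b c' d (U + t *\<^sub>R (V - U)))
      + integral {0..1} (\<lambda>t. c * (e1 * max 0 (u + t * (v - u)) + e2 * min 0 (u + t * (v - u))))"
    by (intro integral_add integrable_continuous_real continuous_intros continuous_on_quad_line)
  also have "integral {0..1} (\<lambda>t. c * (e1 * max 0 (u + t * (v - u)) + e2 * min 0 (u + t * (v - u))))
      = c * integral {0..1} (\<lambda>t. e1 * max 0 (u + t * (v - u)) + e2 * min 0 (u + t * (v - u)))"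
    by simp
  also have "integral {0..1} (\<lambda>t. e1 * max 0 (u + t * (v - u)) + e2 * min 0 (u + t * (v - u)))
      = integral {0..1} (\<lambda>t. e1 * max 0 (u + t * (v - u))) + integral {0..1} (\<lambda>t. e2 * min 0 (u + t * (v - u)))"
    by (intro integral_add integrable_continuous_real continuous_intros)
  finally show ?thesis by (simp add: edge_avg_def kink_avg_def pos_avg_def neg_avg_def u_def v_def)
qed

text \<open>\<open>GM\<close> is the gradient at \<open>F\<close> of the interpolant of the
  prescribed edge averages, \<open>G\<mu>\<close> that of the kink. Inserting g = GM - c G\<mu> into
  the flux condition gives a linear equation for c. Its coefficient is 1 + (r - 1) t up to
  \<epsilon>, which measures the tilt of \<open>v\<close> against \<open>n\<close>, and it is at
  least half of min 1 r by the smallness hypothesis.\<close>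

lemma jump_coefficient_bound:
  fixes n v GM G\<mu> g :: pt
  assumes \<beta>: "\<beta>p > 0" "\<beta>m > 0" and n: "norm n = 1" and nv: "inner n v > 0"
    and cr: "\<bar>cross2 v n\<bar> \<le> \<epsilon> * inner n v"
    and g: "g = GM - c *\<^sub>R G\<mu>" and t: "- \<delta> \<le> inner G\<mu> n" "inner G\<mu> n \<le> 1 + \<delta>" "0 \<le> \<delta>" "0 \<le> \<epsilon>"
    and jump: "\<beta>m * inner (g + c *\<^sub>R n) v = \<beta>p * inner g v"
    and small: "\<bar>\<beta>p / \<beta>m - 1\<bar> * (\<delta> + \<epsilon> * norm G\<mu>) \<le> min 1 (\<beta>p / \<beta>m) / 2"
  shows "\<bar>c\<bar> * (min 1 (\<beta>p / \<beta>m) / 2) \<le> \<bar>\<beta>p / \<beta>m - 1\<bar> * (1 + \<epsilon>) * norm GM"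
proof -
  define r where "r = \<beta>p / \<beta>m"
  define k where "k = cross2 v n / inner n v"
  have r0: "r > 0" using \<beta> by (simp add: r_def)
  have k: "\<bar>k\<bar> \<le> \<epsilon>" using cr nv by (simp add: k_def abs_divide divide_le_eq)
  \<comment> \<open>Up to the positive factor \<open>inner n v\<close>, the direction v is n plus k
    times a unit vector along the chord, with |k| \<le> \<epsilon>. The factor cancels in the jump
    condition, so no lower bound for it is required.\<close>
  have dec: "inner q v = inner n v * (inner q n + k * cross2 q n)" for q
    using nv inner_pt_frame(1)[OF n, of q v] by (simp add: k_def inner_commute field_simps)
  have "\<beta>m * (inner g v + c * inner n v) = \<beta>p * inner g v" using jump by (simp add: inner_add_left)
  then have "c * inner n v = (r - 1) * inner g v" using \<beta> by (simp add: r_def field_simps)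
  then have "c * inner n v = inner n v * ((r - 1) * (inner g n + k * cross2 g n))" unfolding dec[of g] by simp
  then have c: "c = (r - 1) * (inner g n + k * cross2 g n)" using nv by simp
  have cg: "cross2 g n = cross2 GM n - c * cross2 G\<mu> n" by (simp add: g cross2_minus)
  have ig: "inner g n = inner GM n - c * inner G\<mu> n" by (simp add: g inner_diff_left)
  define s where "s = (r - 1) * (k * cross2 G\<mu> n)"
  have main: "c * (1 + (r - 1) * inner G\<mu> n + s) = (r - 1) * (inner GM n + k * cross2 GM n)"
    using c unfolding cg ig s_def by (simp add: algebra_simps)
  have crle: "\<bar>cross2 q n\<bar> \<le> norm q" "\<bar>inner q n\<bar> \<le> norm q" for q :: pt
  proof -
    have "(inner q n)\<^sup>2 + (cross2 q n)\<^sup>2 = (norm q)\<^sup>2" using lagrange_pt[of q n] n by simp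
    then have "(cross2 q n)\<^sup>2 \<le> (norm q)\<^sup>2" using zero_le_power2[of "inner q n"] by linarith
    then show "\<bar>cross2 q n\<bar> \<le> norm q" by (simp add: abs_le_square_iff[symmetric])
    show "\<bar>inner q n\<bar> \<le> norm q" using Cauchy_Schwarz_ineq2[of q n] n by simp
  qed
  have kc: "\<bar>k * cross2 q n\<bar> \<le> \<epsilon> * norm q" for q :: pt
    unfolding abs_mult using k crle(1)[of q] t(4) by (intro mult_mono) auto
  have s: "\<bar>s\<bar> \<le> \<bar>r - 1\<bar> * (\<epsilon> * norm G\<mu>)"
    unfolding s_def abs_mult[of "r - 1"] by (intro mult_left_mono kc) auto
  \<comment> \<open>Which end of the interval for t is critical depends on the sign of r - 1: the
    lower bound serves r \<ge> 1, the upper one r < 1.\<close>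
  have low: "min 1 r - \<bar>r - 1\<bar> * \<delta> \<le> 1 + (r - 1) * inner G\<mu> n"
  proof (cases "r \<ge> 1")
    case True
    then have "(r - 1) * (- \<delta>) \<le> (r - 1) * inner G\<mu> n" using t by (intro mult_left_mono) auto
    then show ?thesis using True by simp
  next
    case False
    then have "(1 - r) * inner G\<mu> n \<le> (1 - r) * (1 + \<delta>)" using t by (intro mult_left_mono) auto
    then show ?thesis using False by (simp add: algebra_simps)
  qed
  have "\<bar>r - 1\<bar> * \<delta> + \<bar>r - 1\<bar> * (\<epsilon> * norm G\<mu>) \<le> min 1 r / 2"
    using small by (simp add: r_def distrib_left)
  then have den: "min 1 r / 2 \<le> 1 + (r - 1) * inner G\<mu> n + s" using low s by linarith
  have "\<bar>c\<bar> * (min 1 r / 2) \<le> \<bar>c\<bar> * (1 + (r - 1) * inner G\<mu> n + s)"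
    using den by (intro mult_left_mono) auto
  also have "\<dots> \<le> \<bar>c * (1 + (r - 1) * inner G\<mu> n + s)\<bar>"
    unfolding abs_mult by (intro mult_left_mono) auto
  also have "\<dots> = \<bar>r - 1\<bar> * \<bar>inner GM n + k * cross2 GM n\<bar>" unfolding main abs_mult ..
  also have "\<dots> \<le> \<bar>r - 1\<bar> * ((1 + \<epsilon>) * norm GM)"
  proof (rule mult_left_mono)
    have "\<bar>inner GM n + k * cross2 GM n\<bar> \<le> norm GM + \<epsilon> * norm GM"
      using crle(2)[of GM] kc[of GM] by linarith
    then show "\<bar>inner GM n + k * cross2 GM n\<bar> \<le> (1 + \<epsilon>) * norm GM" by (simp add: algebra_simps)
  qed auto
  finally show ?thesis by (simp add: r_def mult.assoc)
qed

section \<open>Recovering gradients from edge averages\<close>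

lemma norm_pt_le: "norm (p::pt) \<le> \<bar>fst p\<bar> + \<bar>snd p\<bar>"
  by (simp add: norm_prod_def sqrt_sum_squares_le_sum_abs)

text \<open>An affine function has its midpoint values as edge averages, and the midpoints of the
  hypotenuse and of a leg differ by half of the other leg.\<close>

lemma tri_coefficients:
  fixes a b :: real
  assumes "a \<noteq> 0" "b \<noteq> 0" and f: "f = quad r s t 0"
  shows "s = 2 / a * (edge_avg f (P + (a, 0), P + (0, b)) - edge_avg f (P, P + (0, b)))"
    and "t = 2 / b * (edge_avg f (P + (a, 0), P + (0, b)) - edge_avg f (P, P + (a, 0)))"
  using assms by (cases P, simp add: edge_avg_quad field_simps)+

text \<open>The gradient is a linear map \<open>G\<close> of the three edge averages, so it splits
  into prescribed data and c times the kink. The flux of the kink is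
  \<open>e1 * tp + e2 * tn\<close> with tp and tn nonnegative by monotonicity. They add up to 1
  because the affine function, which has unit gradient n, is its own interpolant. The gradient being
  constant, the position of \<open>F\<close> does not enter.\<close>

lemma tri_gradient_split:
  fixes n D :: pt
  assumes t: "tri_shape vs P a b" and h: "h > 0" "\<kappa> \<ge> 1" and ab: "h / \<kappa> \<le> \<bar>a\<bar>" "h / \<kappa> \<le> \<bar>b\<bar>"
    and n: "norm n = 1" and e: "e1 \<in> {0, 1}" "e2 \<in> {0, 1}"
    and L: "\<And>U. U \<in> set vs \<Longrightarrow> \<bar>inner n (U - D)\<bar> \<le> 2 * h"
    and M: "\<And>U V. (U, V) \<in> set (edges vs) \<Longrightarrow>
      \<bar>edge_avg (quad a0 b0 c0 0) (U, V) + c * kink_avg e1 e2 (inner n (U - D)) (inner n (V - D))\<bar> \<le> 1"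
  shows "\<exists>GM G\<mu>. grad (quad a0 b0 c0 0) F = GM - c *\<^sub>R G\<mu> \<and> norm GM \<le> 28 * \<kappa> / h \<and> norm G\<mu> \<le> 56 * \<kappa>
      \<and> 0 \<le> inner G\<mu> n \<and> inner G\<mu> n \<le> 1"
proof -
  let ?f = "quad a0 b0 c0 0"
  define A where "A = P + (a, 0)"
  define B where "B = P + (0, b)"
  have vs: "set vs = {P, A, B}" and ab0: "a \<noteq> 0" "b \<noteq> 0"
    and adj: "\<And>U V. U \<in> set vs \<Longrightarrow> V \<in> set vs \<Longrightarrow> U \<noteq> V \<Longrightarrow> (U, V) \<in> set (edges vs) \<or> (V, U) \<in> set (edges vs)"
    using t by (auto simp: tri_shape_def A_def B_def)
  have ne: "A \<noteq> B" "P \<noteq> B" "P \<noteq> A" using ab0 by (auto simp: A_def B_def prod_eq_iff)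
  define l where "l = inner n (P - D)"
  define \<alpha> where "\<alpha> = fst n * a"
  define \<beta> where "\<beta> = snd n * b"
  have LA: "inner n (A - D) = l + \<alpha>" and LB: "inner n (B - D) = l + \<beta>"
    by (simp_all add: A_def B_def l_def \<alpha>_def \<beta>_def inner_pt algebra_simps)
  define w where "w U V = kink_avg e1 e2 (inner n (U - D)) (inner n (V - D))" for U V
  define m where "m U V = edge_avg ?f (U, V) + c * w U V" for U V
  have m: "\<bar>m U V\<bar> \<le> 1" if "U \<in> set vs" "V \<in> set vs" "U \<noteq> V" for U V
    using adj[OF that] M[of U V] M[of V U] unfolding m_def w_def
    by (auto simp: kink_avg_commute[of _ _ "inner n (V - D)"] edge_avg_quad_commute[of _ _ _ _ V])
  have w: "\<bar>w U V\<bar> \<le> 2 * h" if "U \<in> set vs" "V \<in> set vs" for U V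
    unfolding w_def using e L that by (intro kink_avg_le)
  define G where "G k = (2 / a * (k A B - k P B), 2 / b * (k A B - k P A))" for k :: "pt \<Rightarrow> pt \<Rightarrow> real"
  have ia: "\<bar>2 / a\<bar> \<le> 2 * \<kappa> / h" "\<bar>2 / b\<bar> \<le> 2 * \<kappa> / h"
    using ab h ab0 by (auto simp: abs_divide field_simps)
  have G_le: "norm (G k) \<le> 8 * \<kappa> / h * K" if k: "\<bar>k A B\<bar> \<le> K" "\<bar>k P B\<bar> \<le> K" "\<bar>k P A\<bar> \<le> K" for k K
  proof -
    have "\<bar>fst (G k)\<bar> \<le> (2 * \<kappa> / h) * (2 * K)" "\<bar>snd (G k)\<bar> \<le> (2 * \<kappa> / h) * (2 * K)"
      unfolding G_def fst_conv snd_conv abs_mult using k ia h by (intro mult_mono; simp)+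
    moreover have "2 * \<kappa> / h * (2 * K) + 2 * \<kappa> / h * (2 * K) = 8 * \<kappa> / h * K" by simp
    ultimately show ?thesis using norm_pt_le[of "G k"] by linarith
  qed
  have kap: "\<kappa> > 0" using h by simp
  have split: "grad ?f F = G m - c *\<^sub>R G w"
  proof -
    have "grad ?f F = (b0, c0)" by (cases F) (simp add: grad_quad)
    also have "\<dots> = G m - c *\<^sub>R G w"
      unfolding prod_eq_iff
      using tri_coefficients[OF ab0 refl, where P = P and r = a0 and s = b0 and t = c0]
      by (simp add: G_def m_def A_def[symmetric] B_def[symmetric] algebra_simps)
    finally show ?thesis .
  qed
  \<comment> \<open>The factors 28 and 56 come from the rectangle and are adopted here, so that both
    shapes deliver the same bounds.\<close>
  have GM: "norm (G m) \<le> 28 * \<kappa> / h"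
  proof -
    have "norm (G m) \<le> 8 * \<kappa> / h * 1" using m ne vs by (intro G_le) auto
    also have "\<dots> \<le> 28 * \<kappa> / h" using h kap by (simp add: field_simps)
    finally show ?thesis .
  qed
  have Gw: "norm (G w) \<le> 56 * \<kappa>"
  proof -
    have "norm (G w) \<le> 8 * \<kappa> / h * (2 * h)" using w vs by (intro G_le) auto
    also have "\<dots> \<le> 56 * \<kappa>" using h kap by simp
    finally show ?thesis .
  qed
  define tp where "tp = 2 / a\<^sup>2 * (\<alpha> * (pos_avg (l + \<alpha>) (l + \<beta>) - pos_avg l (l + \<beta>)))
      + 2 / b\<^sup>2 * (\<beta> * (pos_avg (l + \<beta>) (l + \<alpha>) - pos_avg l (l + \<alpha>)))"
  \<comment> \<open>This is \<open>tp\<close> for the opposite affine function: the negative part is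
    minus the positive part of the negative.\<close>
  define tn where "tn = 2 / a\<^sup>2 * ((- \<alpha>) * (pos_avg (- l + - \<alpha>) (- (l + \<beta>)) - pos_avg (- l) (- (l + \<beta>))))
      + 2 / b\<^sup>2 * ((- \<beta>) * (pos_avg (- l + - \<beta>) (- (l + \<alpha>)) - pos_avg (- l) (- (l + \<alpha>))))"
  have tp: "tp \<ge> 0" unfolding tp_def
    by (intro add_nonneg_nonneg mult_nonneg_nonneg pos_avg_increment_sign) auto
  have tn: "tn \<ge> 0" unfolding tn_def
    by (intro add_nonneg_nonneg mult_nonneg_nonneg pos_avg_increment_sign) auto
  have n1: "fst n * fst n + snd n * snd n = 1"
    using n power2_norm_eq_inner[of n] by (simp add: inner_pt)
  have sum: "tp + tn = 1"
  proof -
    have d: "pos_avg u v - pos_avg (- u) (- v) = (u + v) / 2" for u v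
      using pos_avg_add_neg_avg[of u v] neg_avg_eq[of u v] by simp
    have "tp + tn = 2 / a\<^sup>2 * (\<alpha> * ((pos_avg (l + \<alpha>) (l + \<beta>) - pos_avg (- (l + \<alpha>)) (- (l + \<beta>)))
          - (pos_avg l (l + \<beta>) - pos_avg (- l) (- (l + \<beta>)))))
      + 2 / b\<^sup>2 * (\<beta> * ((pos_avg (l + \<beta>) (l + \<alpha>) - pos_avg (- (l + \<beta>)) (- (l + \<alpha>)))
          - (pos_avg l (l + \<alpha>) - pos_avg (- l) (- (l + \<alpha>)))))"
      by (simp add: tp_def tn_def algebra_simps)
    also have "\<dots> = \<alpha>\<^sup>2 / a\<^sup>2 + \<beta>\<^sup>2 / b\<^sup>2"
    proof -
      have e: "(l + \<alpha> + (l + \<beta>)) / 2 - (l + (l + \<beta>)) / 2 = \<alpha> / 2" "(l + \<beta> + (l + \<alpha>)) / 2 - (l + (l + \<alpha>)) / 2 = \<beta> / 2"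
        by (simp_all add: field_simps)
      show ?thesis unfolding d e by (simp add: power2_eq_square)
    qed
    also have "\<dots> = 1" using ab0 n1 by (simp add: \<alpha>_def \<beta>_def power2_eq_square)
    finally show ?thesis .
  qed
  have "inner (G w) n = e1 * tp + e2 * tn"
  proof -
    have k: "kink_avg e1 e2 u v = e1 * pos_avg u v - e2 * pos_avg (- u) (- v)" for u v
      by (simp add: kink_avg_def neg_avg_eq)
    have neg: "- l + - \<alpha> = - (l + \<alpha>)" "- l + - \<beta> = - (l + \<beta>)" by simp_all
    have c: "2 / a * fst n = 2 / a\<^sup>2 * \<alpha>" "2 / b * snd n = 2 / b\<^sup>2 * \<beta>"
      using ab0 by (simp_all add: \<alpha>_def \<beta>_def power2_eq_square)
    have "inner (G w) n = (2 / a * fst n) * (w A B - w P B) + (2 / b * snd n) * (w A B - w P A)"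
      unfolding inner_pt[of "G w" n] unfolding G_def fst_conv snd_conv by (simp only: mult_ac)
    also have "\<dots> = e1 * tp + e2 * tn"
      unfolding c w_def LA LB l_def[symmetric] k tp_def tn_def neg
        pos_avg_commute[of "l + \<beta>" "l + \<alpha>"] pos_avg_commute[of "- (l + \<beta>)" "- (l + \<alpha>)"]
      by (simp only: ring_distribs mult_ac add_ac diff_conv_add_uminus mult_minus_left mult_minus_right minus_minus minus_add_distrib)
    finally show ?thesis .
  qed
  then have "0 \<le> inner (G w) n" "inner (G w) n \<le> 1" using e tp tn sum by auto
  with split GM Gw show ?thesis by blast
qed

lemma tri_quad_bounds:
  assumes t: "tri_shape vs P a b" and h: "h > 0" "\<kappa> \<ge> 1" and ab: "h / \<kappa> \<le> \<bar>a\<bar>" "h / \<kappa> \<le> \<bar>b\<bar>"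
    and box: "set vs \<subseteq> cbox (x0, y0) (x1, y1)" "x1 - x0 \<le> h" "y1 - y0 \<le> h" and p: "p \<in> cbox (x0, y0) (x1, y1)"
    and m: "\<And>U V. (U, V) \<in> set (edges vs) \<Longrightarrow> \<bar>edge_avg (quad a0 b0 c0 0) (U, V)\<bar> \<le> K"
  shows "\<bar>quad a0 b0 c0 0 p\<bar> \<le> 9 * \<kappa> * K" "\<bar>b0\<bar> \<le> 4 * \<kappa> * K / h" "\<bar>c0\<bar> \<le> 4 * \<kappa> * K / h"
proof -
  let ?f = "quad a0 b0 c0 0"
  define A where "A = P + (a, 0)"
  define B where "B = P + (0, b)"
  have vs: "set vs = {P, A, B}" and ab0: "a \<noteq> 0" "b \<noteq> 0"
    and adj: "\<And>U V. U \<in> set vs \<Longrightarrow> V \<in> set vs \<Longrightarrow> U \<noteq> V \<Longrightarrow> (U, V) \<in> set (edges vs) \<or> (V, U) \<in> set (edges vs)"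
    using t by (auto simp: tri_shape_def A_def B_def)
  have ne: "A \<noteq> B" "P \<noteq> B" "P \<noteq> A" using ab0 by (auto simp: A_def B_def prod_eq_iff)
  have m': "\<bar>edge_avg ?f (U, V)\<bar> \<le> K" if "U \<in> set vs" "V \<in> set vs" "U \<noteq> V" for U V
    using adj[OF that] m[of U V] m[of V U] by (auto simp: edge_avg_quad_commute[of _ _ _ _ V])
  have mm: "\<bar>edge_avg ?f (A, B)\<bar> \<le> K" "\<bar>edge_avg ?f (P, B)\<bar> \<le> K" "\<bar>edge_avg ?f (P, A)\<bar> \<le> K"
    using m' ne vs by auto
  have ia: "\<bar>2 / a\<bar> \<le> 2 * \<kappa> / h" "\<bar>2 / b\<bar> \<le> 2 * \<kappa> / h"
    using ab h ab0 by (auto simp: abs_divide field_simps)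
  note co = tri_coefficients[OF ab0 refl, where P = P and r = a0 and s = b0 and t = c0, folded A_def B_def]
  have "\<bar>b0\<bar> \<le> (2 * \<kappa> / h) * (2 * K)"
    by (subst co(1), subst abs_mult) (use mm ia h in \<open>intro mult_mono; simp\<close>)
  then show b: "\<bar>b0\<bar> \<le> 4 * \<kappa> * K / h" by simp
  have "\<bar>c0\<bar> \<le> (2 * \<kappa> / h) * (2 * K)"
    by (subst co(2), subst abs_mult) (use mm ia h in \<open>intro mult_mono; simp\<close>)
  then show c: "\<bar>c0\<bar> \<le> 4 * \<kappa> * K / h" by simp
  have K: "K \<ge> 0" using mm by linarith
  obtain px py where pp: "p = (px, py)" by fastforce
  \<comment> \<open>Offsets are taken from the midpoint of the hypotenuse, where an affine function
    equals its average over that edge.\<close>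
  define X where "X = px - (fst A + fst B) / 2"
  define Y where "Y = py - (snd A + snd B) / 2"
  have XY: "\<bar>X\<bar> \<le> h" "\<bar>Y\<bar> \<le> h"
    using box p vs unfolding X_def Y_def pp by (cases A, cases B, auto simp: cbox_Pair_eq abs_le_iff field_simps)+
  have "?f p = edge_avg ?f (A, B) + b0 * X + c0 * Y"
  proof -
    obtain ax ay bx bz where AB: "A = (ax, ay)" "B = (bx, bz)" by fastforce
    show ?thesis unfolding AB pp edge_avg_quad
      by (simp add: quad_def X_def Y_def AB algebra_simps add_divide_distrib)
  qed
  then have "\<bar>?f p\<bar> \<le> K + \<bar>b0 * X\<bar> + \<bar>c0 * Y\<bar>" using mm by linarith
  also have "\<dots> \<le> K + (4 * \<kappa> * K / h) * h + (4 * \<kappa> * K / h) * h"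
    unfolding abs_mult using b c XY K h by (intro add_mono mult_mono) auto
  also have "\<dots> = K + 8 * \<kappa> * K" using h by simp
  also have "\<dots> \<le> 9 * \<kappa> * K" using mult_right_mono[OF h(2) K] by (simp add: mult_ac)
  finally show "\<bar>?f p\<bar> \<le> 9 * \<kappa> * K" .
qed

text \<open>Gradient, at offset (X, Y) from the centre of a rectangle with half widths a and b, of
  the rotated \<open>Q\<^sub>1\<close> function with averages m1, m2, m3, m4 on the bottom, right,
  top and left sides. The explicit formula makes linearity in the averages visible.\<close>

definition rect_grad :: "real \<Rightarrow> real \<Rightarrow> real \<Rightarrow> real \<Rightarrow> real \<Rightarrow> real \<Rightarrow> real \<Rightarrow> real \<Rightarrow> pt" where
  "rect_grad a b X Y m1 m2 m3 m4 =
     ((m2 - m4) / (2 * a) + 3 / 2 * (m2 + m4 - m1 - m3) / (a\<^sup>2 + b\<^sup>2) * X,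
      (m3 - m1) / (2 * b) - 3 / 2 * (m2 + m4 - m1 - m3) / (a\<^sup>2 + b\<^sup>2) * Y)"

lemma rect_coefficients:
  fixes a b cx cy a0 b0 c0 d :: real
  defines "m1 \<equiv> edge_avg (quad a0 b0 c0 d) ((cx - a, cy - b), (cx + a, cy - b))"
    and "m2 \<equiv> edge_avg (quad a0 b0 c0 d) ((cx + a, cy - b), (cx + a, cy + b))"
    and "m3 \<equiv> edge_avg (quad a0 b0 c0 d) ((cx + a, cy + b), (cx - a, cy + b))"
    and "m4 \<equiv> edge_avg (quad a0 b0 c0 d) ((cx - a, cy + b), (cx - a, cy - b))"
  shows "m2 - m4 = 2 * a * (b0 + 2 * d * cx)" "m3 - m1 = 2 * b * (c0 - 2 * d * cy)"
    "m2 + m4 - m1 - m3 = 4 / 3 * d * (a\<^sup>2 + b\<^sup>2)"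
    "m2 + m4 = 2 * (quad a0 b0 c0 d (cx, cy) + d * (a\<^sup>2 - b\<^sup>2 / 3))"
  unfolding m1_def m2_def m3_def m4_def edge_avg_quad
  by (simp_all add: quad_def power2_eq_square field_simps)

lemma rect_grad_eq:
  fixes a b cx cy :: real
  assumes "a > 0" "b > 0"
  shows "grad (quad a0 b0 c0 d) (cx + X, cy + Y) = rect_grad a b X Y
     (edge_avg (quad a0 b0 c0 d) ((cx - a, cy - b), (cx + a, cy - b)))
     (edge_avg (quad a0 b0 c0 d) ((cx + a, cy - b), (cx + a, cy + b)))
     (edge_avg (quad a0 b0 c0 d) ((cx + a, cy + b), (cx - a, cy + b)))
     (edge_avg (quad a0 b0 c0 d) ((cx - a, cy + b), (cx - a, cy - b)))"
proof -
  have nz: "a\<^sup>2 + b\<^sup>2 \<noteq> 0" using assms by (simp add: sum_power2_eq_zero_iff)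
  have "3 / 2 * (4 / 3 * d * N) / N = 2 * d" if "N \<noteq> 0" for N :: real using that by simp
  note s = this[OF nz]
  have q: "2 * a * (b0 + 2 * d * cx) / (2 * a) = b0 + 2 * d * cx" "2 * b * (c0 - 2 * d * cy) / (2 * b) = c0 - 2 * d * cy"
    using assms by simp_all
  show ?thesis unfolding rect_grad_def grad_quad rect_coefficients(1-3) s q
    by (simp add: algebra_simps)
qed

lemma rect_grad_linear:
  "rect_grad a b X Y (m1 - c * w1) (m2 - c * w2) (m3 - c * w3) (m4 - c * w4)
   = rect_grad a b X Y m1 m2 m3 m4 - c *\<^sub>R rect_grad a b X Y w1 w2 w3 w4"
proof -
  have lin: "(k - c * k') / z + 3 / 2 * (s - c * s') / N * Z = (k / z + 3 / 2 * s / N * Z) - c * (k' / z + 3 / 2 * s' / N * Z)"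
    for k k' s s' z Z N :: real
    by (simp add: diff_divide_distrib left_diff_distrib right_diff_distrib distrib_left)
  have d: "(m2 - c * w2) - (m4 - c * w4) = (m2 - m4) - c * (w2 - w4)"
    "(m3 - c * w3) - (m1 - c * w1) = (m3 - m1) - c * (w3 - w1)"
    "(m2 - c * w2) + (m4 - c * w4) - (m1 - c * w1) - (m3 - c * w3) = (m2 + m4 - m1 - m3) - c * (w2 + w4 - w1 - w3)"
    by (simp_all add: right_diff_distrib distrib_left)
  show ?thesis
    unfolding rect_grad_def d prod_eq_iff fst_diff snd_diff fst_scaleR snd_scaleR fst_conv snd_conv real_scaleR_def
    using lin[of "m2 - m4" "w2 - w4" "2 * a" "m2 + m4 - m1 - m3" "w2 + w4 - w1 - w3" "a\<^sup>2 + b\<^sup>2" X]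
      lin[of "m3 - m1" "w3 - w1" "2 * b" "m2 + m4 - m1 - m3" "w2 + w4 - w1 - w3" "a\<^sup>2 + b\<^sup>2" "- Y"]
    by (simp only: mult_minus_right add_uminus_conv_diff)
qed

lemma rect_grad_bound:
  assumes h: "h > 0" "\<kappa> \<ge> 1" and ab: "h / \<kappa> \<le> 2 * a" "h / \<kappa> \<le> 2 * b" and XY: "\<bar>X\<bar> \<le> a" "\<bar>Y\<bar> \<le> b"
    and m: "\<bar>m1\<bar> \<le> K" "\<bar>m2\<bar> \<le> K" "\<bar>m3\<bar> \<le> K" "\<bar>m4\<bar> \<le> K"
  shows "\<bar>fst (rect_grad a b X Y m1 m2 m3 m4)\<bar> \<le> 14 * \<kappa> * K / h" "\<bar>snd (rect_grad a b X Y m1 m2 m3 m4)\<bar> \<le> 14 * \<kappa> * K / h"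
proof -
  have hk: "h / \<kappa> > 0" using h by simp
  then have ab0: "a > 0" "b > 0" using ab by linarith+
  have K: "K \<ge> 0" using m by linarith
  define s where "s = 3 / 2 * (m2 + m4 - m1 - m3) / (a\<^sup>2 + b\<^sup>2)"
  have pos: "a\<^sup>2 + b\<^sup>2 > 0" using ab0 by (simp add: sum_power2_gt_zero_iff)
  have s: "\<bar>s\<bar> \<le> 6 * K / (a\<^sup>2 + b\<^sup>2)"
  proof -
    have "\<bar>m2 + m4 - m1 - m3\<bar> \<le> 4 * K" using m by linarith
    then have "\<bar>3 / 2 * (m2 + m4 - m1 - m3)\<bar> \<le> 6 * K" by (simp only: abs_mult) simp
    then have "\<bar>3 / 2 * (m2 + m4 - m1 - m3)\<bar> / (a\<^sup>2 + b\<^sup>2) \<le> 6 * K / (a\<^sup>2 + b\<^sup>2)"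
      using pos by (intro divide_right_mono) auto
    then show ?thesis unfolding s_def abs_divide using pos by (simp only: abs_of_pos)
  qed
  \<comment> \<open>z is the half width in the direction of the component. The quadratic term costs
    6 K / z since |Z| \<le> z and z^2 \<le> a^2 + b^2, the linear term K / z, and 1 / z \<le> 2
    \<kappa> / h turns the sum into 14 \<kappa> K / h.\<close>
  have main: "\<bar>u / (2 * z) + s' * Z\<bar> \<le> 14 * \<kappa> * K / h"
    if z: "z > 0" "h / \<kappa> \<le> 2 * z" "\<bar>Z\<bar> \<le> z" "z\<^sup>2 \<le> a\<^sup>2 + b\<^sup>2" and u: "\<bar>u\<bar> \<le> 2 * K" and s': "\<bar>s'\<bar> = \<bar>s\<bar>" for u z s' Z
  proof -
    have "\<bar>s' * Z\<bar> \<le> 6 * K / (a\<^sup>2 + b\<^sup>2) * z" unfolding abs_mult s' using s z K pos by (intro mult_mono) auto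
    also have "\<dots> \<le> 6 * K / z\<^sup>2 * z" using z K pos by (intro mult_right_mono divide_left_mono mult_pos_pos) auto
    also have "\<dots> = 6 * K / z" using z by (simp add: power2_eq_square)
    finally have 1: "\<bar>s' * Z\<bar> \<le> 6 * K / z" .
    have "\<bar>u / (2 * z)\<bar> \<le> 2 * K / (2 * z)" unfolding abs_divide using u z by (intro divide_mono) auto
    then have "\<bar>u / (2 * z) + s' * Z\<bar> \<le> K / z + 6 * K / z" using 1 abs_triangle_ineq[of "u / (2 * z)" "s' * Z"] by simp
    also have "\<dots> = 7 * K * (1 / z)" by simp
    also have "\<dots> \<le> 7 * K * (2 * \<kappa> / h)" using z h K by (intro mult_left_mono) (auto simp: field_simps)
    finally show ?thesis by (simp add: mult_ac)
  qed
  show "\<bar>fst (rect_grad a b X Y m1 m2 m3 m4)\<bar> \<le> 14 * \<kappa> * K / h"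
    unfolding rect_grad_def fst_conv s_def[symmetric] using ab0 ab XY m by (intro main) auto
  have "\<bar>(m3 - m1) / (2 * b) + (- s) * Y\<bar> \<le> 14 * \<kappa> * K / h"
    using ab0 ab XY m by (intro main) auto
  then show "\<bar>snd (rect_grad a b X Y m1 m2 m3 m4)\<bar> \<le> 14 * \<kappa> * K / h"
    unfolding rect_grad_def snd_conv s_def[symmetric] by (simp only: mult_minus_left add_uminus_conv_diff)
qed

text \<open>Positive parts of u and -u differ by u, and the interpolant of an affine function is
  that function, with no twist. The right-hand side is its own flux, equal to 1 for a unit normal
  and the true half widths.\<close>

lemma rect_flux_complement:
  "rect_flux \<alpha> \<beta> L X Y A B + rect_flux (- \<alpha>) (- \<beta>) (- L) (- X) (- Y) A B = \<alpha>\<^sup>2 / A + \<beta>\<^sup>2 / B"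
proof -
  have d: "pos_avg (- u) (- v) = pos_avg u v - (u + v) / 2" for u v
    using pos_avg_add_neg_avg[of u v] neg_avg_eq[of u v] by linarith
  have e: "right_avg (- \<alpha>) (- \<beta>) (- L) = right_avg \<alpha> \<beta> L - (L + \<alpha>)"
    "left_avg (- \<alpha>) (- \<beta>) (- L) = left_avg \<alpha> \<beta> L - (L - \<alpha>)"
    "top_avg (- \<alpha>) (- \<beta>) (- L) = top_avg \<alpha> \<beta> L - (L + \<beta>)"
    "bot_avg (- \<alpha>) (- \<beta>) (- L) = bot_avg \<alpha> \<beta> L - (L - \<beta>)"
  proof -
    have a: "- L - - \<alpha> - - \<beta> = - (L - \<alpha> - \<beta>)" "- L + - \<alpha> - - \<beta> = - (L + \<alpha> - \<beta>)"
      "- L + - \<alpha> + - \<beta> = - (L + \<alpha> + \<beta>)" "- L - - \<alpha> + - \<beta> = - (L - \<alpha> + \<beta>)"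
      by simp_all
    have m: "(L + \<alpha> - \<beta> + (L + \<alpha> + \<beta>)) / 2 = L + \<alpha>" "(L - \<alpha> - \<beta> + (L - \<alpha> + \<beta>)) / 2 = L - \<alpha>"
      "(L - \<alpha> + \<beta> + (L + \<alpha> + \<beta>)) / 2 = L + \<beta>" "(L - \<alpha> - \<beta> + (L + \<alpha> - \<beta>)) / 2 = L - \<beta>"
      by (simp_all add: field_simps)
    show "right_avg (- \<alpha>) (- \<beta>) (- L) = right_avg \<alpha> \<beta> L - (L + \<alpha>)"
      "left_avg (- \<alpha>) (- \<beta>) (- L) = left_avg \<alpha> \<beta> L - (L - \<alpha>)"
      "top_avg (- \<alpha>) (- \<beta>) (- L) = top_avg \<alpha> \<beta> L - (L + \<beta>)"
      "bot_avg (- \<alpha>) (- \<beta>) (- L) = bot_avg \<alpha> \<beta> L - (L - \<beta>)"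
      unfolding side_avg_defs a d m by (rule refl)+
  qed
  have tw: "twist (- \<alpha>) (- \<beta>) (- L) = twist \<alpha> \<beta> L" unfolding twist_def e by simp
  show ?thesis unfolding rect_flux_def tw e
    by (simp add: power2_eq_square algebra_simps diff_divide_distrib add_divide_distrib)
qed

text \<open>Identifies \<open>rect_flux\<close> as the normal component of the gradient of an
  interpolant, which brings the polynomial inequality to bear on the element.\<close>

lemma inner_rect_grad:
  fixes a b :: real
  assumes "a > 0" "b > 0"
  shows "inner (rect_grad a b X Y (bot_avg (n1 * a) (n2 * b) L) (right_avg (n1 * a) (n2 * b) L)
      (top_avg (n1 * a) (n2 * b) L) (left_avg (n1 * a) (n2 * b) L)) (n1, n2)
    = rect_flux (n1 * a) (n2 * b) L (n1 * X) (n2 * Y) (a\<^sup>2) (b\<^sup>2)"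
proof -
  have 1: "n1 * a * (right_avg (n1 * a) (n2 * b) L - left_avg (n1 * a) (n2 * b) L) / a\<^sup>2
      = 2 * ((right_avg (n1 * a) (n2 * b) L - left_avg (n1 * a) (n2 * b) L) / (2 * a) * n1)"
    "n2 * b * (top_avg (n1 * a) (n2 * b) L - bot_avg (n1 * a) (n2 * b) L) / b\<^sup>2
      = 2 * ((top_avg (n1 * a) (n2 * b) L - bot_avg (n1 * a) (n2 * b) L) / (2 * b) * n2)"
    using assms by (simp_all add: power2_eq_square field_simps)
  define s where "s = 3 / 2 * (right_avg (n1 * a) (n2 * b) L + left_avg (n1 * a) (n2 * b) L
      - bot_avg (n1 * a) (n2 * b) L - top_avg (n1 * a) (n2 * b) L) / (a\<^sup>2 + b\<^sup>2)"
  have 2: "3 / 2 * twist (n1 * a) (n2 * b) L * (n1 * X - n2 * Y) / (a\<^sup>2 + b\<^sup>2) = - s * (n1 * X - n2 * Y)"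
  proof -
    have "3 / 2 * z * Z / N = - (3 / 2 * (- z) / N) * Z" for z Z N :: real by simp
    moreover have "- twist (n1 * a) (n2 * b) L = right_avg (n1 * a) (n2 * b) L + left_avg (n1 * a) (n2 * b) L
      - bot_avg (n1 * a) (n2 * b) L - top_avg (n1 * a) (n2 * b) L" by (simp add: twist_def)
    ultimately show ?thesis unfolding s_def by metis
  qed
  have gen: "(p + s * X) * n1 + (q - s * Y) * n2 = (2 * (p * n1) + 2 * (q * n2)) / 2 - (- s * (n1 * X - n2 * Y))" for p q
    by (simp add: algebra_simps)
  show ?thesis
    unfolding rect_flux_def rect_grad_def s_def[symmetric] 1 2 inner_pt fst_conv snd_conv
    by (rule gen)
qed

lemma kink_avg_sides:
  "kink_avg e1 e2 (L - \<alpha> - \<beta>) (L + \<alpha> - \<beta>) = e1 * bot_avg \<alpha> \<beta> L - e2 * bot_avg (- \<alpha>) (- \<beta>) (- L)"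
  "kink_avg e1 e2 (L + \<alpha> - \<beta>) (L + \<alpha> + \<beta>) = e1 * right_avg \<alpha> \<beta> L - e2 * right_avg (- \<alpha>) (- \<beta>) (- L)"
  "kink_avg e1 e2 (L + \<alpha> + \<beta>) (L - \<alpha> + \<beta>) = e1 * top_avg \<alpha> \<beta> L - e2 * top_avg (- \<alpha>) (- \<beta>) (- L)"
  "kink_avg e1 e2 (L - \<alpha> + \<beta>) (L - \<alpha> - \<beta>) = e1 * left_avg \<alpha> \<beta> L - e2 * left_avg (- \<alpha>) (- \<beta>) (- L)"
proof -
  have k: "kink_avg e1 e2 u v = e1 * pos_avg u v - e2 * pos_avg (- u) (- v)" for u v
    by (simp add: kink_avg_def neg_avg_eq)
  have a: "- L - - \<alpha> - - \<beta> = - (L - \<alpha> - \<beta>)" "- L + - \<alpha> - - \<beta> = - (L + \<alpha> - \<beta>)"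
    "- L + - \<alpha> + - \<beta> = - (L + \<alpha> + \<beta>)" "- L - - \<alpha> + - \<beta> = - (L - \<alpha> + \<beta>)"
    by simp_all
  show "kink_avg e1 e2 (L - \<alpha> - \<beta>) (L + \<alpha> - \<beta>) = e1 * bot_avg \<alpha> \<beta> L - e2 * bot_avg (- \<alpha>) (- \<beta>) (- L)"
    "kink_avg e1 e2 (L + \<alpha> - \<beta>) (L + \<alpha> + \<beta>) = e1 * right_avg \<alpha> \<beta> L - e2 * right_avg (- \<alpha>) (- \<beta>) (- L)"
    unfolding side_avg_defs a k by (rule refl)+
  show "kink_avg e1 e2 (L + \<alpha> + \<beta>) (L - \<alpha> + \<beta>) = e1 * top_avg \<alpha> \<beta> L - e2 * top_avg (- \<alpha>) (- \<beta>) (- L)"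
    unfolding kink_avg_commute[of e1 e2 "L + \<alpha> + \<beta>" "L - \<alpha> + \<beta>"] unfolding side_avg_defs a k by (rule refl)
  show "kink_avg e1 e2 (L - \<alpha> + \<beta>) (L - \<alpha> - \<beta>) = e1 * left_avg \<alpha> \<beta> L - e2 * left_avg (- \<alpha>) (- \<beta>) (- L)"
    unfolding kink_avg_commute[of e1 e2 "L - \<alpha> + \<beta>" "L - \<alpha> - \<beta>"] unfolding side_avg_defs a k by (rule refl)
qed

lemma rect_grad_combine:
  "rect_grad a b X Y (e1 * m1 - e2 * w1) (e1 * m2 - e2 * w2) (e1 * m3 - e2 * w3) (e1 * m4 - e2 * w4)
   = e1 *\<^sub>R rect_grad a b X Y m1 m2 m3 m4 - e2 *\<^sub>R rect_grad a b X Y w1 w2 w3 w4"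
proof -
  have 0: "rect_grad a b X Y 0 0 0 0 = 0" by (simp add: rect_grad_def zero_prod_def)
  have 1: "rect_grad a b X Y (e * m1) (e * m2) (e * m3) (e * m4) = e *\<^sub>R rect_grad a b X Y m1 m2 m3 m4" for e
    using rect_grad_linear[of a b X Y 0 "- e" m1 0 m2 0 m3 0 m4] by (simp add: 0)
  show ?thesis unfolding rect_grad_linear 1 ..
qed

lemma abs_unit_le_1: "norm (n :: pt) = 1 \<Longrightarrow> \<bar>fst n\<bar> \<le> 1 \<and> \<bar>snd n\<bar> \<le> 1"
  using norm_fst_le[of "fst n" "snd n"] norm_snd_le[of "snd n" "fst n"] by simp

text \<open>As on triangles, the flux of the kink is \<open>e1 * tp + e2 * tn\<close> with tp + tn =
  1. Here the gradient varies with the point, and nonnegativity holds on the chord line only;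
  \<delta> is the price for a point \<open>F\<close> off that line.\<close>

lemma rect_gradient_split:
  fixes n :: pt and a b X Y :: real
  assumes h: "h > 0" "\<kappa> \<ge> 1" and ab: "h / \<kappa> \<le> 2 * a" "h / \<kappa> \<le> 2 * b" "2 * a \<le> h" "2 * b \<le> h"
    and XY: "\<bar>X\<bar> \<le> a" "\<bar>Y\<bar> \<le> b" and D: "\<bar>Dx - cx\<bar> \<le> a" "\<bar>Dy - cy\<bar> \<le> b"
    and vs: "vs = rect_elem (cx - a) (cy - b) (cx + a) (cy + b)"
    and n: "norm n = 1" and e: "e1 \<in> {0, 1}" "e2 \<in> {0, 1}"
    and M: "\<And>U V. (U, V) \<in> set (edges vs) \<Longrightarrow>
      \<bar>edge_avg (quad a0 b0 c0 d) (U, V) + c * kink_avg e1 e2 (inner n (U - (Dx, Dy))) (inner n (V - (Dx, Dy)))\<bar> \<le> 1"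
    and \<delta>: "\<delta> = 12 * \<kappa>\<^sup>2 * \<bar>inner n ((cx + X, cy + Y) - (Dx, Dy))\<bar> / h"
  shows "\<exists>GM G\<mu>. grad (quad a0 b0 c0 d) (cx + X, cy + Y) = GM - c *\<^sub>R G\<mu> \<and> norm GM \<le> 28 * \<kappa> / h
      \<and> norm G\<mu> \<le> 56 * \<kappa> \<and> - \<delta> \<le> inner G\<mu> n \<and> inner G\<mu> n \<le> 1 + \<delta>"
proof -
  let ?f = "quad a0 b0 c0 d"
  have hk: "h / \<kappa> > 0" using h by simp
  then have ab0: "a > 0" "b > 0" using ab by linarith+
  obtain n1 n2 where nn: "n = (n1, n2)" by fastforce
  have n1: "\<bar>n1\<bar> \<le> 1" "\<bar>n2\<bar> \<le> 1" using abs_unit_le_1[OF n] by (auto simp: nn)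
  have nsq: "n1 * n1 + n2 * n2 = 1" using n power2_norm_eq_inner[of n] by (simp add: inner_pt nn)
  define \<alpha> where "\<alpha> = n1 * a"
  define \<beta> where "\<beta> = n2 * b"
  define L where "L = n1 * (cx - Dx) + n2 * (cy - Dy)"
  have corner: "inner n ((cx - a, cy - b) - (Dx, Dy)) = L - \<alpha> - \<beta>" "inner n ((cx + a, cy - b) - (Dx, Dy)) = L + \<alpha> - \<beta>"
    "inner n ((cx + a, cy + b) - (Dx, Dy)) = L + \<alpha> + \<beta>" "inner n ((cx - a, cy + b) - (Dx, Dy)) = L - \<alpha> + \<beta>"
    by (simp_all add: nn L_def \<alpha>_def \<beta>_def algebra_simps)
  have F: "inner n ((cx + X, cy + Y) - (Dx, Dy)) = L + n1 * X + n2 * Y"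
    by (simp add: nn L_def algebra_simps)
  have al: "\<bar>\<alpha>\<bar> = \<bar>n1\<bar> * a" "\<bar>\<beta>\<bar> = \<bar>n2\<bar> * b" using ab0 by (simp_all add: \<alpha>_def \<beta>_def abs_mult)
  have al_le: "\<bar>\<alpha>\<bar> \<le> a" "\<bar>\<beta>\<bar> \<le> b"
    unfolding al using mult_right_mono[OF n1(1), of a] mult_right_mono[OF n1(2), of b] ab0 by auto
  have L: "\<bar>L\<bar> \<le> \<bar>\<alpha>\<bar> + \<bar>\<beta>\<bar>"
  proof -
    have "\<bar>L\<bar> \<le> \<bar>n1 * (cx - Dx)\<bar> + \<bar>n2 * (cy - Dy)\<bar>" unfolding L_def by (rule abs_triangle_ineq)
    also have "\<dots> \<le> \<bar>n1\<bar> * a + \<bar>n2\<bar> * b"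
      unfolding abs_mult using D by (intro add_mono mult_left_mono) (auto simp: abs_minus_commute)
    finally show ?thesis unfolding al .
  qed
  have nX: "\<bar>n1 * X\<bar> \<le> \<bar>\<alpha>\<bar>" "\<bar>n2 * Y\<bar> \<le> \<bar>\<beta>\<bar>" unfolding al abs_mult using XY by (auto intro: mult_left_mono)
  have Lsum: "\<bar>L\<bar> + \<bar>\<alpha>\<bar> + \<bar>\<beta>\<bar> \<le> 2 * h" using L al_le ab by linarith
  define w1 where "w1 = kink_avg e1 e2 (L - \<alpha> - \<beta>) (L + \<alpha> - \<beta>)"
  define w2 where "w2 = kink_avg e1 e2 (L + \<alpha> - \<beta>) (L + \<alpha> + \<beta>)"
  define w3 where "w3 = kink_avg e1 e2 (L + \<alpha> + \<beta>) (L - \<alpha> + \<beta>)"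
  define w4 where "w4 = kink_avg e1 e2 (L - \<alpha> + \<beta>) (L - \<alpha> - \<beta>)"
  have w: "\<bar>w1\<bar> \<le> 2 * h" "\<bar>w2\<bar> \<le> 2 * h" "\<bar>w3\<bar> \<le> 2 * h" "\<bar>w4\<bar> \<le> 2 * h"
    unfolding w1_def w2_def w3_def w4_def by (rule kink_avg_le[OF e]; use Lsum in linarith)+
  define m1 where "m1 = edge_avg ?f ((cx - a, cy - b), (cx + a, cy - b)) + c * w1"
  define m2 where "m2 = edge_avg ?f ((cx + a, cy - b), (cx + a, cy + b)) + c * w2"
  define m3 where "m3 = edge_avg ?f ((cx + a, cy + b), (cx - a, cy + b)) + c * w3"
  define m4 where "m4 = edge_avg ?f ((cx - a, cy + b), (cx - a, cy - b)) + c * w4"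
  have es: "set (edges vs) = {((cx - a, cy - b), (cx + a, cy - b)), ((cx + a, cy - b), (cx + a, cy + b)),
      ((cx + a, cy + b), (cx - a, cy + b)), ((cx - a, cy + b), (cx - a, cy - b))}"
    unfolding vs rect_elem_def edges_set4 ..
  have m: "\<bar>m1\<bar> \<le> 1" "\<bar>m2\<bar> \<le> 1" "\<bar>m3\<bar> \<le> 1" "\<bar>m4\<bar> \<le> 1"
    unfolding m1_def m2_def m3_def m4_def w1_def w2_def w3_def w4_def corner[symmetric]
    by (rule M, unfold es, blast)+
  define GM where "GM = rect_grad a b X Y m1 m2 m3 m4"
  define G\<mu> where "G\<mu> = rect_grad a b X Y w1 w2 w3 w4"
  have split: "grad ?f (cx + X, cy + Y) = GM - c *\<^sub>R G\<mu>"
    unfolding rect_grad_eq[OF ab0] GM_def G\<mu>_def rect_grad_linear[symmetric]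
    by (simp add: m1_def m2_def m3_def m4_def)
  have GM: "norm GM \<le> 28 * \<kappa> / h"
    using norm_pt_le[of GM] rect_grad_bound[OF h ab(1,2) XY m] unfolding GM_def[symmetric] by simp
  have Gw: "norm G\<mu> \<le> 56 * \<kappa>"
  proof -
    have "14 * \<kappa> * (2 * h) / h = 28 * \<kappa>" using h by simp
    then show ?thesis
      using norm_pt_le[of G\<mu>] rect_grad_bound[OF h ab(1,2) XY w] unfolding G\<mu>_def[symmetric] by simp
  qed
  define tp where "tp = rect_flux \<alpha> \<beta> L (n1 * X) (n2 * Y) (a\<^sup>2) (b\<^sup>2)"
  define tn where "tn = rect_flux (- \<alpha>) (- \<beta>) (- L) (- (n1 * X)) (- (n2 * Y)) (a\<^sup>2) (b\<^sup>2)"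
  have sum: "tp + tn = 1"
    unfolding tp_def tn_def rect_flux_complement using ab0 nsq by (simp add: \<alpha>_def \<beta>_def power2_eq_square)
  have lower: "- \<delta> \<le> rect_flux \<alpha>' \<beta>' L' X' Y' (a\<^sup>2) (b\<^sup>2)"
    if "\<bar>\<alpha>'\<bar> = \<bar>\<alpha>\<bar>" "\<bar>\<beta>'\<bar> = \<bar>\<beta>\<bar>" "\<bar>L'\<bar> = \<bar>L\<bar>" "\<bar>X'\<bar> = \<bar>n1 * X\<bar>" "\<bar>Y'\<bar> = \<bar>n2 * Y\<bar>"
      "\<bar>L' + X' + Y'\<bar> = \<bar>L + n1 * X + n2 * Y\<bar>" for \<alpha>' \<beta>' L' X' Y'
  proof -
    define l where "l = \<bar>L + n1 * X + n2 * Y\<bar>"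
    define N where "N = a\<^sup>2 + b\<^sup>2"
    have "(h / \<kappa>)\<^sup>2 \<le> (2 * a)\<^sup>2" "(h / \<kappa>)\<^sup>2 \<le> (2 * b)\<^sup>2" by (rule power_mono; use hk ab in linarith)+
    then have N: "h\<^sup>2 / (2 * \<kappa>\<^sup>2) \<le> N" by (simp add: N_def power_divide field_simps)
    have Np: "0 < h\<^sup>2 / (2 * \<kappa>\<^sup>2)" using h by simp
    \<comment> \<open>Source of the factor 12: 3/2 times a twist of at most 4 h, divided by a^2 +
      b^2 \<ge> h^2 / (2 \<kappa>^2).\<close>
    have "\<bar>twist \<alpha>' \<beta>' L'\<bar> \<le> 2 * (2 * h)" using Lsum by (intro abs_twist_le) (simp only: that(1-3))
    then have "3 / 2 * \<bar>twist \<alpha>' \<beta>' L'\<bar> * l / N \<le> 3 / 2 * (2 * (2 * h)) * l / (h\<^sup>2 / (2 * \<kappa>\<^sup>2))"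
      using N Np h by (intro frac_le mult_right_mono mult_left_mono) (auto simp: l_def)
    also have "\<dots> = \<delta>" unfolding \<delta> F l_def[symmetric] using h by (simp add: power2_eq_square field_simps)
    finally have "3 / 2 * \<bar>twist \<alpha>' \<beta>' L'\<bar> * l / N \<le> \<delta>" .
    moreover have "- (3 / 2 * \<bar>twist \<alpha>' \<beta>' L'\<bar> * \<bar>L' + X' + Y'\<bar> / (a\<^sup>2 + b\<^sup>2)) \<le> rect_flux \<alpha>' \<beta>' L' X' Y' (a\<^sup>2) (b\<^sup>2)"
    proof (rule rect_flux_ge)
      show "\<bar>L'\<bar> \<le> \<bar>\<alpha>'\<bar> + \<bar>\<beta>'\<bar>" unfolding that(1-3) by (rule L)
      show "\<bar>X'\<bar> \<le> \<bar>\<alpha>'\<bar>" unfolding that(1,4) by (rule nX)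
      show "\<bar>Y'\<bar> \<le> \<bar>\<beta>'\<bar>" unfolding that(2,5) by (rule nX)
    qed (use ab0 in simp_all)
    ultimately show ?thesis unfolding that(6) l_def[symmetric] N_def[symmetric] by linarith
  qed
  have tp: "- \<delta> \<le> tp" unfolding tp_def by (rule lower) (rule refl)+
  have "- L + - (n1 * X) + - (n2 * Y) = - (L + n1 * X + n2 * Y)" by simp
  then have tn: "- \<delta> \<le> tn" unfolding tn_def by (intro lower) (simp_all only: abs_minus_cancel)
  have d0: "0 \<le> \<delta>" unfolding \<delta> using h by simp
  have "inner G\<mu> n = e1 * tp + e2 * tn"
  proof -
    have 1: "inner (rect_grad a b X Y (bot_avg \<alpha> \<beta> L) (right_avg \<alpha> \<beta> L) (top_avg \<alpha> \<beta> L) (left_avg \<alpha> \<beta> L)) n = tp"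
      unfolding tp_def \<alpha>_def \<beta>_def nn by (rule inner_rect_grad[OF ab0])
    have "inner (rect_grad a b X Y (bot_avg (- \<alpha>) (- \<beta>) (- L)) (right_avg (- \<alpha>) (- \<beta>) (- L))
        (top_avg (- \<alpha>) (- \<beta>) (- L)) (left_avg (- \<alpha>) (- \<beta>) (- L))) (- n) = tn"
      using inner_rect_grad[OF ab0, of X Y "- n1" "- n2" "- L"] by (simp add: tn_def \<alpha>_def \<beta>_def nn)
    then have 2: "inner (rect_grad a b X Y (bot_avg (- \<alpha>) (- \<beta>) (- L)) (right_avg (- \<alpha>) (- \<beta>) (- L))
        (top_avg (- \<alpha>) (- \<beta>) (- L)) (left_avg (- \<alpha>) (- \<beta>) (- L))) n = - tn" by simp
    show ?thesis
      unfolding G\<mu>_def w1_def w2_def w3_def w4_def kink_avg_sides rect_grad_combine inner_diff_left inner_scaleR_left 1 2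
      by simp
  qed
  then have "- \<delta> \<le> inner G\<mu> n" "inner G\<mu> n \<le> 1 + \<delta>" using e tp tn sum d0 by auto
  with split GM Gw show ?thesis by blast
qed

lemma rect_quad_bounds:
  fixes a b X Y :: real
  assumes h: "h > 0" "\<kappa> \<ge> 1" and ab: "h / \<kappa> \<le> 2 * a" "h / \<kappa> \<le> 2 * b" "2 * a \<le> h" "2 * b \<le> h"
    and XY: "\<bar>X\<bar> \<le> a" "\<bar>Y\<bar> \<le> b"
    and vs: "vs = rect_elem (cx - a) (cy - b) (cx + a) (cy + b)"
    and m: "\<And>U V. (U, V) \<in> set (edges vs) \<Longrightarrow> \<bar>edge_avg (quad a0 b0 c0 d) (U, V)\<bar> \<le> K"
  shows "\<bar>quad a0 b0 c0 d (cx + X, cy + Y)\<bar> \<le> 9 * \<kappa>\<^sup>2 * K" "\<bar>b0 + 2 * d * (cx + X)\<bar> \<le> 14 * \<kappa> * K / h"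
    "\<bar>c0 - 2 * d * (cy + Y)\<bar> \<le> 14 * \<kappa> * K / h" "\<bar>d\<bar> \<le> 6 * \<kappa>\<^sup>2 * K / h\<^sup>2"
proof -
  let ?f = "quad a0 b0 c0 d"
  have hk: "h / \<kappa> > 0" using h by simp
  then have ab0: "a > 0" "b > 0" using ab by linarith+
  define m1 where "m1 = edge_avg ?f ((cx - a, cy - b), (cx + a, cy - b))"
  define m2 where "m2 = edge_avg ?f ((cx + a, cy - b), (cx + a, cy + b))"
  define m3 where "m3 = edge_avg ?f ((cx + a, cy + b), (cx - a, cy + b))"
  define m4 where "m4 = edge_avg ?f ((cx - a, cy + b), (cx - a, cy - b))"
  have es: "set (edges vs) = {((cx - a, cy - b), (cx + a, cy - b)), ((cx + a, cy - b), (cx + a, cy + b)),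
      ((cx + a, cy + b), (cx - a, cy + b)), ((cx - a, cy + b), (cx - a, cy - b))}"
    unfolding vs rect_elem_def edges_set4 ..
  have mb: "\<bar>m1\<bar> \<le> K" "\<bar>m2\<bar> \<le> K" "\<bar>m3\<bar> \<le> K" "\<bar>m4\<bar> \<le> K"
    unfolding m1_def m2_def m3_def m4_def by (rule m, unfold es, blast)+
  have K: "K \<ge> 0" using mb by linarith
  note co = rect_coefficients[where cx = cx and cy = cy and a = a and b = b, of a0 b0 c0 d,
      folded m1_def m2_def m3_def m4_def]
  have g: "grad ?f (cx + X, cy + Y) = rect_grad a b X Y m1 m2 m3 m4"
    unfolding m1_def m2_def m3_def m4_def by (rule rect_grad_eq[OF ab0])
  show "\<bar>b0 + 2 * d * (cx + X)\<bar> \<le> 14 * \<kappa> * K / h" "\<bar>c0 - 2 * d * (cy + Y)\<bar> \<le> 14 * \<kappa> * K / h"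
    using rect_grad_bound[OF h ab(1,2) XY mb] unfolding g[symmetric] grad_quad by simp_all
  have "(h / \<kappa>)\<^sup>2 \<le> (2 * a)\<^sup>2" "(h / \<kappa>)\<^sup>2 \<le> (2 * b)\<^sup>2" by (rule power_mono; use hk ab in linarith)+
  then have N: "h\<^sup>2 / (2 * \<kappa>\<^sup>2) \<le> a\<^sup>2 + b\<^sup>2" by (simp add: power_divide field_simps)
  have Np: "0 < a\<^sup>2 + b\<^sup>2" "0 < h\<^sup>2 / (2 * \<kappa>\<^sup>2)" using ab0 h by (simp_all add: sum_power2_gt_zero_iff)
  have dN: "\<bar>d\<bar> * (a\<^sup>2 + b\<^sup>2) \<le> 3 * K"
  proof -
    have "\<bar>m2 + m4 - m1 - m3\<bar> \<le> 4 * K" using mb by linarith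
    then have "\<bar>4 / 3 * d * (a\<^sup>2 + b\<^sup>2)\<bar> \<le> 4 * K" unfolding co(3) .
    moreover have "\<bar>4 / 3 * d * (a\<^sup>2 + b\<^sup>2)\<bar> = 4 / 3 * (\<bar>d\<bar> * (a\<^sup>2 + b\<^sup>2))" using Np by (simp add: abs_mult)
    ultimately show ?thesis by linarith
  qed
  then have "\<bar>d\<bar> * (h\<^sup>2 / (2 * \<kappa>\<^sup>2)) \<le> 3 * K" using mult_left_mono[OF N, of "\<bar>d\<bar>"] by linarith
  then show "\<bar>d\<bar> \<le> 6 * \<kappa>\<^sup>2 * K / h\<^sup>2" using h by (simp add: field_simps)
  define q where "q = b0 + 2 * d * cx"
  define r where "r = c0 - 2 * d * cy"
  have "?f (cx + X, cy + Y) = ?f (cx, cy) + q * X + r * Y + d * (X\<^sup>2 - Y\<^sup>2)"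
    by (simp add: quad_def q_def r_def power2_eq_square algebra_simps)
  moreover have "\<bar>q * X\<bar> \<le> K"
  proof -
    have "\<bar>2 * a * q\<bar> \<le> 2 * K" using co(1) mb unfolding q_def by linarith
    then have "a * \<bar>q\<bar> \<le> K" using ab0 by (simp add: abs_mult)
    moreover have "\<bar>q\<bar> * \<bar>X\<bar> \<le> \<bar>q\<bar> * a" using XY by (intro mult_left_mono) auto
    ultimately show ?thesis by (simp add: abs_mult mult.commute)
  qed
  moreover have "\<bar>r * Y\<bar> \<le> K"
  proof -
    have "\<bar>2 * b * r\<bar> \<le> 2 * K" using co(2) mb unfolding r_def by linarith
    then have "b * \<bar>r\<bar> \<le> K" using ab0 by (simp add: abs_mult)
    moreover have "\<bar>r\<bar> * \<bar>Y\<bar> \<le> \<bar>r\<bar> * b" using XY by (intro mult_left_mono) auto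
    ultimately show ?thesis by (simp add: abs_mult mult.commute)
  qed
  moreover have sq: "\<bar>d * z\<bar> \<le> 3 * K" if "\<bar>z\<bar> \<le> a\<^sup>2 + b\<^sup>2" for z
    using mult_left_mono[OF that, of "\<bar>d\<bar>"] dN by (simp add: abs_mult)
  have "X\<^sup>2 \<le> a\<^sup>2" "Y\<^sup>2 \<le> b\<^sup>2" using XY ab0 by (auto simp flip: abs_le_square_iff)
  then have "\<bar>X\<^sup>2 - Y\<^sup>2\<bar> \<le> a\<^sup>2 + b\<^sup>2" using zero_le_power2[of X] zero_le_power2[of Y] unfolding abs_le_iff by linarith
  note dXY = sq[OF this]
  have "\<bar>a\<^sup>2 - b\<^sup>2 / 3\<bar> \<le> a\<^sup>2 + b\<^sup>2" using zero_le_power2[of a] zero_le_power2[of b] unfolding abs_le_iff by linarith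
  note dab = sq[OF this]
  have "\<bar>?f (cx, cy)\<bar> \<le> 4 * K"
  proof -
    have "?f (cx, cy) = (m2 + m4) / 2 - d * (a\<^sup>2 - b\<^sup>2 / 3)" using co(4) by (simp add: field_simps)
    moreover have "\<bar>m2 + m4\<bar> \<le> 2 * K" using mb(2,4) by linarith
    then have "\<bar>(m2 + m4) / 2\<bar> \<le> K" by simp
    ultimately show ?thesis using dab abs_triangle_ineq4[of "(m2 + m4) / 2" "d * (a\<^sup>2 - b\<^sup>2 / 3)"] by linarith
  qed
  \<comment> \<open>4 K from the centre value, K from each linear term and 3 K from the quadratic
    term.\<close>
  ultimately have "\<bar>?f (cx + X, cy + Y)\<bar> \<le> 9 * K" using dXY by linarith
  also have "\<dots> \<le> 9 * \<kappa>\<^sup>2 * K" using K h(2) mult_right_mono[of 1 "\<kappa>\<^sup>2" K] by simp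
  finally show "\<bar>?f (cx + X, cy + Y)\<bar> \<le> 9 * \<kappa>\<^sup>2 * K" .
qed

section \<open>The estimate on one element\<close>

lemma cbox_pt: "(x, y) \<in> cbox (x0, y0) (x1, y1) \<longleftrightarrow> x0 \<le> x \<and> x \<le> x1 \<and> y0 \<le> y \<and> y \<le> (y1::real)" for x :: real
  by (auto simp: cbox_Pair_eq)

lemma box_dist_le:
  fixes x0 y0 x1 y1 h :: real
  assumes "p \<in> cbox (x0, y0) (x1, y1)" "q \<in> cbox (x0, y0) (x1, y1)" "x1 - x0 \<le> h" "y1 - y0 \<le> h"
  shows "dist p q \<le> 2 * h"
proof -
  obtain a b c d where pq: "p = (a, b)" "q = (c, d)" by fastforce
  have "\<bar>a - c\<bar> \<le> h" "\<bar>b - d\<bar> \<le> h" using assms unfolding pq cbox_pt by auto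
  then show ?thesis using norm_pt_le[of "p - q"] by (simp add: dist_norm pq)
qed

lemma element_gradient_split:
  fixes n D F :: pt and x0 y0 x1 y1 :: real
  assumes h: "h > 0" "\<kappa> \<ge> 1"
    and box: "h / \<kappa> \<le> x1 - x0" "h / \<kappa> \<le> y1 - y0" "x1 - x0 \<le> h" "y1 - y0 \<le> h"
    and shape: "if rect then vs = rect_elem x0 y0 x1 y1 else \<exists>P a b. tri_shape vs P a b \<and> \<bar>a\<bar> = x1 - x0 \<and> \<bar>b\<bar> = y1 - y0"
    and vs: "set vs \<subseteq> cbox (x0, y0) (x1, y1)" and d: "\<not> rect \<Longrightarrow> d = 0"
    and D: "D \<in> cbox (x0, y0) (x1, y1)" and F: "F \<in> cbox (x0, y0) (x1, y1)"
    and n: "norm n = 1" and e: "e1 \<in> {0, 1}" "e2 \<in> {0, 1}"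
    and M: "\<And>U V. (U, V) \<in> set (edges vs) \<Longrightarrow>
      \<bar>edge_avg (quad a0 b0 c0 d) (U, V) + c * kink_avg e1 e2 (inner n (U - D)) (inner n (V - D))\<bar> \<le> 1"
    and \<delta>: "\<delta> = 12 * \<kappa>\<^sup>2 * \<bar>inner n (F - D)\<bar> / h"
  shows "\<exists>GM G\<mu>. grad (quad a0 b0 c0 d) F = GM - c *\<^sub>R G\<mu> \<and> norm GM \<le> 28 * \<kappa> / h
      \<and> norm G\<mu> \<le> 56 * \<kappa> \<and> - \<delta> \<le> inner G\<mu> n \<and> inner G\<mu> n \<le> 1 + \<delta>"
proof (cases rect)
  case True
  define cx where "cx = (x0 + x1) / 2"
  define cy where "cy = (y0 + y1) / 2"
  define a where "a = (x1 - x0) / 2"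
  define b where "b = (y1 - y0) / 2"
  obtain Dx Dy where DD: "D = (Dx, Dy)" by fastforce
  obtain Fx Fy where FF: "F = (Fx, Fy)" by fastforce
  have vs': "vs = rect_elem (cx - a) (cy - b) (cx + a) (cy + b)"
    using shape True by (simp add: cx_def cy_def a_def b_def field_simps)
  have Fc: "F = (cx + (Fx - cx), cy + (Fy - cy))" by (simp add: FF)
  have ab: "h / \<kappa> \<le> 2 * a" "h / \<kappa> \<le> 2 * b" "2 * a \<le> h" "2 * b \<le> h"
  proof -
    have "2 * a = x1 - x0" "2 * b = y1 - y0" by (simp_all add: a_def b_def)
    then show "h / \<kappa> \<le> 2 * a" "h / \<kappa> \<le> 2 * b" "2 * a \<le> h" "2 * b \<le> h" using box by simp_all
  qed
  have in_box: "\<bar>x - cx\<bar> \<le> a \<and> \<bar>y - cy\<bar> \<le> b" if "(x, y) \<in> cbox (x0, y0) (x1, y1)" for x y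
    using that unfolding cbox_pt cx_def cy_def a_def b_def abs_le_iff by (auto simp: field_simps)
  show ?thesis
    unfolding Fc DD
    by (rule rect_gradient_split[where Dx = Dx and Dy = Dy, OF h ab _ _ _ _ vs' n e])
      (use in_box[OF D[unfolded DD]] in_box[OF F[unfolded FF]] M \<delta> in \<open>simp_all add: DD FF\<close>)
next
  case False
  then obtain P a b where t: "tri_shape vs P a b" "\<bar>a\<bar> = x1 - x0" "\<bar>b\<bar> = y1 - y0" using shape by auto
  have L: "\<bar>inner n (U - D)\<bar> \<le> 2 * h" if "U \<in> set vs" for U
    using Cauchy_Schwarz_ineq2[of n "U - D"] n box_dist_le[OF subsetD[OF vs that] D box(3,4)] by (simp add: dist_norm)
  have d0: "0 \<le> \<delta>" unfolding \<delta> using h by simp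
  have "\<exists>GM G\<mu>. grad (quad a0 b0 c0 0) F = GM - c *\<^sub>R G\<mu> \<and> norm GM \<le> 28 * \<kappa> / h \<and> norm G\<mu> \<le> 56 * \<kappa>
      \<and> 0 \<le> inner G\<mu> n \<and> inner G\<mu> n \<le> 1"
    using M d[OF False] box t by (intro tri_gradient_split[OF t(1) h _ _ n e L]) simp_all
  then obtain GM G\<mu> where G: "grad (quad a0 b0 c0 d) F = GM - c *\<^sub>R G\<mu>" "norm GM \<le> 28 * \<kappa> / h" "norm G\<mu> \<le> 56 * \<kappa>"
    "0 \<le> inner G\<mu> n" "inner G\<mu> n \<le> 1"
    unfolding d[OF False] by blast
  have "- \<delta> \<le> inner G\<mu> n" "inner G\<mu> n \<le> 1 + \<delta>" using G(4,5) d0 by linarith+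
  with G(1-3) show ?thesis by blast
qed

lemma element_quad_bounds:
  fixes x0 y0 x1 y1 :: real
  assumes h: "h > 0" "\<kappa> \<ge> 1"
    and box: "h / \<kappa> \<le> x1 - x0" "h / \<kappa> \<le> y1 - y0" "x1 - x0 \<le> h" "y1 - y0 \<le> h"
    and shape: "if rect then vs = rect_elem x0 y0 x1 y1 else \<exists>P a b. tri_shape vs P a b \<and> \<bar>a\<bar> = x1 - x0 \<and> \<bar>b\<bar> = y1 - y0"
    and vs: "set vs \<subseteq> cbox (x0, y0) (x1, y1)" and d: "\<not> rect \<Longrightarrow> d = 0"
    and p: "(x, y) \<in> cbox (x0, y0) (x1, y1)" and K: "K \<ge> 0"
    and m: "\<And>U V. (U, V) \<in> set (edges vs) \<Longrightarrow> \<bar>edge_avg (quad a0 b0 c0 d) (U, V)\<bar> \<le> K"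
  shows "\<bar>quad a0 b0 c0 d (x, y)\<bar> \<le> 9 * \<kappa>\<^sup>2 * K \<and> \<bar>b0 + 2 * d * x\<bar> \<le> 14 * \<kappa> * K / h
    \<and> \<bar>c0 - 2 * d * y\<bar> \<le> 14 * \<kappa> * K / h \<and> \<bar>d\<bar> \<le> 6 * \<kappa>\<^sup>2 * K / h\<^sup>2"
proof (cases rect)
  case True
  define cx where "cx = (x0 + x1) / 2"
  define cy where "cy = (y0 + y1) / 2"
  define a where "a = (x1 - x0) / 2"
  define b where "b = (y1 - y0) / 2"
  have vs': "vs = rect_elem (cx - a) (cy - b) (cx + a) (cy + b)"
    using shape True by (simp add: cx_def cy_def a_def b_def field_simps)
  have ab: "h / \<kappa> \<le> 2 * a" "h / \<kappa> \<le> 2 * b" "2 * a \<le> h" "2 * b \<le> h"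
  proof -
    have "2 * a = x1 - x0" "2 * b = y1 - y0" by (simp_all add: a_def b_def)
    then show "h / \<kappa> \<le> 2 * a" "h / \<kappa> \<le> 2 * b" "2 * a \<le> h" "2 * b \<le> h" using box by simp_all
  qed
  have XY: "\<bar>x - cx\<bar> \<le> a" "\<bar>y - cy\<bar> \<le> b"
    using p unfolding cbox_pt cx_def cy_def a_def b_def abs_le_iff by (auto simp: field_simps)
  show ?thesis using rect_quad_bounds[OF h ab XY vs' m] by simp
next
  case False
  then obtain P a b where t: "tri_shape vs P a b" "\<bar>a\<bar> = x1 - x0" "\<bar>b\<bar> = y1 - y0" using shape by auto
  have d0: "d = 0" by (rule d[OF False])
  have ab: "h / \<kappa> \<le> \<bar>a\<bar>" "h / \<kappa> \<le> \<bar>b\<bar>" using box t by simp_all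
  note b = tri_quad_bounds[OF t(1) h ab vs box(3,4) p m[unfolded d0]]
  have "\<kappa> \<le> \<kappa>\<^sup>2" using h by (simp add: power2_eq_square)
  then have "9 * \<kappa> * K \<le> 9 * \<kappa>\<^sup>2 * K" using K by (intro mult_right_mono) auto
  moreover have "4 * \<kappa> * K / h \<le> 14 * \<kappa> * K / h" using h K by (intro divide_right_mono mult_right_mono) auto
  ultimately show ?thesis unfolding d0 using b h K by auto
qed

text \<open>Nothing so far excludes an empty piece, and over the reals \<open>Sup {}\<close> is a
  fixed number about which nothing is known; its absolute value is therefore built into the
  constant.\<close>

lemma sup_abs_le:
  assumes "\<And>p. p \<in> S \<Longrightarrow> \<bar>g p\<bar> \<le> B" "\<bar>Sup {} :: real\<bar> \<le> B"
  shows "sup_abs S g \<le> B"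
proof (cases "S = {}")
  case True then show ?thesis using assms(2) by (simp add: sup_abs_def)
next
  case False then show ?thesis unfolding sup_abs_def using assms(1) by (intro cSUP_least) auto
qed

lemma seminorm_quad_le:
  assumes f: "\<And>x y. (x, y) \<in> S \<Longrightarrow> \<bar>quad a b c d (x, y)\<bar> \<le> Z"
    and fx: "\<And>x y. (x, y) \<in> S \<Longrightarrow> \<bar>b + 2 * d * x\<bar> \<le> Z / h"
    and fy: "\<And>x y. (x, y) \<in> S \<Longrightarrow> \<bar>c - 2 * d * y\<bar> \<le> Z / h"
    and dd: "\<And>x y. (x, y) \<in> S \<Longrightarrow> \<bar>2 * d\<bar> \<le> Z / h\<^sup>2"
    and h: "0 < h" "h \<le> 1" and Z: "\<bar>Sup {} :: real\<bar> \<le> Z" and k: "k \<le> 2"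
  shows "seminorm_inf k S (quad a b c d) \<le> Z / h ^ k"
proof -
  have Z0: "0 \<le> Z" using Z by linarith
  \<comment> \<open>For h \<le> 1 a constant is absorbed by its quotient with a power of h, which
    takes care of \<open>Sup {}\<close> in the higher seminorms.\<close>
  have le: "Z \<le> Z / h ^ j" for j
  proof -
    have "h ^ j \<le> 1" "0 < h ^ j" using h by (auto intro: power_le_one)
    then show ?thesis using mult_left_mono[OF \<open>h ^ j \<le> 1\<close> Z0] by (simp add: le_divide_eq)
  qed
  have S: "\<bar>Sup {} :: real\<bar> \<le> Z / h ^ j" for j using Z le[of j] by linarith
  consider "k = 0" | "k = 1" | "k = 2" using k by linarith
  then show ?thesis
  proof cases
    case 1
    then show ?thesis using f Z by (auto simp: seminorm_inf_def intro!: sup_abs_le)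
  next
    case 2
    have "sup_abs S (dx (quad a b c d)) \<le> Z / h" "sup_abs S (dy (quad a b c d)) \<le> Z / h"
      unfolding dx_quad dy_quad using fx fy S[of 1] by (auto simp: quad_def intro!: sup_abs_le)
    then show ?thesis using 2 by (simp add: seminorm_inf_def)
  next
    case 3
    have "0 \<le> Z / h\<^sup>2" using Z0 by simp
    then have "sup_abs S (dx (dx (quad a b c d))) \<le> Z / h\<^sup>2" "sup_abs S (dx (dy (quad a b c d))) \<le> Z / h\<^sup>2"
      "sup_abs S (dy (dx (quad a b c d))) \<le> Z / h\<^sup>2" "sup_abs S (dy (dy (quad a b c d))) \<le> Z / h\<^sup>2"
      unfolding dx_quad dy_quad using dd S[of 2] by (auto simp: quad_def intro!: sup_abs_le)
    then show ?thesis using 3 by (simp add: seminorm_inf_def)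
  qed
qed

lemma parallel_to_normal:
  fixes G n w :: pt
  assumes n: "norm n = 1" "inner n w = 0" and G: "inner G w = 0" and w: "w \<noteq> 0"
  shows "G = inner G n *\<^sub>R n"
proof -
  have n1: "fst n * fst n + snd n * snd n = 1"
    using n power2_norm_eq_inner[of n] by (simp add: inner_pt)
  have "cross2 w n \<noteq> 0"
    using w lagrange_pt[of w n] n by (auto simp: inner_commute)
  moreover have "cross2 G n * cross2 w n = 0"
    using inner_pt_frame(1)[OF n(1), of G w] G n(2) by (simp add: inner_commute)
  ultimately have "cross2 G n = 0" by simp
  then show ?thesis using n1 unfolding prod_eq_iff cross2_def inner_pt fst_scaleR snd_scaleR real_scaleR_def
    by (intro conjI; algebra)
qed

text \<open>With equal quadratic parts the difference is affine and vanishes at \<open>D\<close> and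
  \<open>E\<close>, hence on their line; \<open>k\<close> becomes the jump coefficient c.\<close>

lemma ife_pieces_differ_by_normal_multiple:
  fixes D E n :: pt
  assumes n: "norm n = 1" "inner n (E - D) = 0" and DE: "D \<noteq> E"
    and eq: "quad a' b' c' d D = quad a b c d D" "quad a' b' c' d E = quad a b c d E"
  obtains k where "b' = b + k * fst n" "c' = c + k * snd n" "\<And>p. quad a' b' c' d p = quad a b c d p + k * inner n (p - D)"
proof -
  define G where "G = (b' - b, c' - c)"
  have diff: "quad a' b' c' d p - quad a b c d p = (a' - a) + inner G p" for p
    by (cases p) (simp add: quad_def G_def algebra_simps)
  have GD: "(a' - a) + inner G D = 0" "(a' - a) + inner G E = 0" using eq diff[of D] diff[of E] by simp_all
  then have "inner G (E - D) = 0" by (simp add: inner_diff_right)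
  then have G: "G = inner G n *\<^sub>R n" using DE by (intro parallel_to_normal[OF n]) auto
  define k where "k = inner G n"
  have Gk: "G = k *\<^sub>R n" using G by (simp add: k_def)
  show ?thesis
  proof (rule that[of k])
    show "b' = b + k * fst n" "c' = c + k * snd n"
      using arg_cong[OF Gk, of fst] arg_cong[OF Gk, of snd] by (simp_all add: G_def)
    fix p
    have "quad a' b' c' d p - quad a b c d p = inner G p - inner G D" using diff[of p] GD(1) by simp
    also have "\<dots> = k * inner n (p - D)" by (simp add: Gk inner_diff_right algebra_simps)
    finally show "quad a' b' c' d p = quad a b c d p + k * inner n (p - D)" by simp
  qed
qed

text \<open>Merges the two variants: on the line both geometric defects are zero, on the curve they
  are bounded by near-straightness with diameter bound 2 h, which \<open>near\<close>
  provides.\<close>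

lemma ife_config_geometry:
  fixes h :: real
  assumes near: "D \<in> \<Gamma> \<inter> elem_set vs \<and> E \<in> \<Gamma> \<inter> elem_set vs \<and> D \<noteq> E \<and> F \<in> \<Gamma> \<inter> elem_set vs \<and>
      norm n = 1 \<and> inner n (E - D) = 0 \<and> is_normal \<Gamma> (elem_set vs) F v \<and> inner n v > 0 \<longrightarrow>
      \<bar>inner n (F - D)\<bar> \<le> K * (2 * h)\<^sup>2 \<and> \<bar>cross2 v n\<bar> \<le> K * (2 * h) * inner n v"
    and K: "K > 0" and h: "h > 0"
    and cfg: "ife_config \<Gamma> \<Omega>p \<Omega>m vs D E n Tp Tm F v"
  shows "D \<in> elem_set vs" "F \<in> elem_set vs" "Tp \<subseteq> elem_set vs" "Tm \<subseteq> elem_set vs"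
    "norm n = 1" "inner n (E - D) = 0" "D \<noteq> E"
    "inner n v > 0" "\<bar>inner n (F - D)\<bar> \<le> 4 * K * h\<^sup>2" "\<bar>cross2 v n\<bar> \<le> 2 * K * h * inner n v"
proof -
  define T where "T = elem_set vs"
  have "compact T" by (simp add: T_def elem_set_def finite_imp_compact_convex_hull)
  then have clT: "closed T" by (rule compact_imp_closed)
  have convT: "convex T" by (simp add: T_def elem_set_def)
  have c: "D \<noteq> E" "\<Gamma> \<inter> frontier T = {D, E}" "norm n = 1" "inner n (E - D) = 0"
    using cfg unfolding ife_config_def Let_def T_def[symmetric] by blast+
  have DE: "D \<in> \<Gamma> \<inter> T" "E \<in> \<Gamma> \<inter> T" using c(2) clT unfolding frontier_def by auto
  consider (curve) "Tp = T \<inter> \<Omega>p" "Tm = T \<inter> \<Omega>m" "F \<in> \<Gamma> \<inter> T" "is_normal \<Gamma> T F v" "inner n v > 0"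
    | (line) \<sigma> where "F \<in> closed_segment D E" "v = n" "Tp = {p \<in> T. \<sigma> * inner (p - D) n > 0}"
      "Tm = {p \<in> T. \<sigma> * inner (p - D) n < 0}"
    using cfg unfolding ife_config_def Let_def T_def[symmetric] by blast
  then have *: "F \<in> T \<and> Tp \<subseteq> T \<and> Tm \<subseteq> T \<and> inner n v > 0 \<and> \<bar>inner n (F - D)\<bar> \<le> 4 * K * h\<^sup>2
      \<and> \<bar>cross2 v n\<bar> \<le> 2 * K * h * inner n v"
  proof cases
    case curve
    have "\<bar>inner n (F - D)\<bar> \<le> K * (2 * h)\<^sup>2 \<and> \<bar>cross2 v n\<bar> \<le> K * (2 * h) * inner n v"
      using near DE c(1,3,4) curve(3-5) unfolding T_def by blast
    then have "\<bar>inner n (F - D)\<bar> \<le> 4 * K * h\<^sup>2" "\<bar>cross2 v n\<bar> \<le> 2 * K * h * inner n v"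
      by (simp_all add: power_mult_distrib mult_ac)
    then show ?thesis using curve by blast
  next
    case line
    have "inner n v = 1" using c(3) unfolding line(2) by (simp add: norm_eq_1)
    moreover have "cross2 v n = 0" unfolding line(2) by (simp add: cross2_def)
    moreover have "inner n (F - D) = 0"
    proof -
      obtain t where "F = (1 - t) *\<^sub>R D + t *\<^sub>R E" using line(1) unfolding closed_segment_def by blast
      then have "F - D = t *\<^sub>R (E - D)" by (simp add: algebra_simps)
      then show ?thesis using c(4) by simp
    qed
    moreover have "F \<in> T" using line(1) DE convT closed_segment_subset[of D T E] by blast
    ultimately show ?thesis using line(3,4) K h by auto
  qed
  then show "D \<in> elem_set vs" "F \<in> elem_set vs" "Tp \<subseteq> elem_set vs" "Tm \<subseteq> elem_set vs"
    "norm n = 1" "inner n (E - D) = 0" "D \<noteq> E"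
    "inner n v > 0" "\<bar>inner n (F - D)\<bar> \<le> 4 * K * h\<^sup>2" "\<bar>cross2 v n\<bar> \<le> 2 * K * h * inner n v"
    using c DE unfolding T_def by auto
qed

text \<open>\<open>C3 / h\<close> bounds |c|: the jump estimate gives |c| \<mu> / 2 \<le> r (1 +
  \<epsilon>) 28 \<kappa> / h with \<epsilon> \<le> 1. In \<open>Z\<close>, the factor 1 + 2 C3
  bounds the edge averages of the plus polynomial, 14 \<kappa>^2 is the largest factor from averages
  to derivatives, and the extra 2 C3 pays for passing to the minus piece.\<close>

lemma ife_basis_bound_element:
  fixes \<beta>p \<beta>m \<kappa> K h x0 y0 x1 y1 :: real and n D E F v :: pt
  defines "r \<equiv> \<bar>\<beta>p / \<beta>m - 1\<bar>" and "\<mu> \<equiv> min 1 (\<beta>p / \<beta>m)"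
  defines "C3 \<equiv> 112 * \<kappa> * r / \<mu>"
  defines "Z \<equiv> 14 * \<kappa>\<^sup>2 * (1 + 2 * C3) + 2 * C3 + \<bar>Sup {} :: real\<bar>"
  assumes \<beta>: "\<beta>p > 0" "\<beta>m > 0" and \<kappa>: "\<kappa> \<ge> 1" and K: "K > 0"
    and h: "h > 0" "h \<le> 1" "K * (2 * h) \<le> 1" "r * (160 * \<kappa>\<^sup>2 * K * h) \<le> \<mu> / 2"
    and box: "h / \<kappa> \<le> x1 - x0" "h / \<kappa> \<le> y1 - y0" "x1 - x0 \<le> h" "y1 - y0 \<le> h"
    and shape: "if rect then vs = rect_elem x0 y0 x1 y1 else \<exists>P a b. tri_shape vs P a b \<and> \<bar>a\<bar> = x1 - x0 \<and> \<bar>b\<bar> = y1 - y0"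
    and inbox: "elem_set vs \<subseteq> cbox (x0, y0) (x1, y1)"
    and geo: "D \<in> elem_set vs" "F \<in> elem_set vs" "Tp \<subseteq> elem_set vs" "Tm \<subseteq> elem_set vs"
      "norm n = 1" "inner n (E - D) = 0" "D \<noteq> E"
      "inner n v > 0" "\<bar>inner n (F - D)\<bar> \<le> 4 * K * h\<^sup>2" "\<bar>cross2 v n\<bar> \<le> 2 * K * h * inner n v"
    and basis: "ife_basis rect \<beta>p \<beta>m vs D E Tp F v i fp fm"
    and edge: "\<And>c. (\<And>p. fm p = fp p + c * inner n (p - D)) \<Longrightarrow>
      \<exists>e1\<in>{0, 1}. \<exists>e2\<in>{0, 1::real}. \<forall>U V p. (U, V) \<in> set (edges vs) \<longrightarrow> p \<in> closed_segment U V \<longrightarrow>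
        pw_fun Tp fp fm p = fp p + c * (e1 * max 0 (inner n (p - D)) + e2 * min 0 (inner n (p - D)))"
    and k: "k \<le> 2"
  shows "max (seminorm_inf k Tp fp) (seminorm_inf k Tm fm) \<le> Z / h ^ k"
proof -
  have B: "fp \<in> Pi_T rect" "fm \<in> Pi_T rect" "\<And>p. p \<in> closed_segment D E \<Longrightarrow> fm p = fp p"
    "rect \<Longrightarrow> dx (dx fm) 0 = dx (dx fp) 0" "\<beta>m * inner (grad fm F) v = \<beta>p * inner (grad fp F) v"
    "\<And>j. j < length vs \<Longrightarrow> edge_avg (pw_fun Tp fp fm) (edges vs ! j) = (if j = i then 1 else 0)"
    using basis unfolding ife_basis_def by blast+
  obtain a0 b0 c0 d where fp: "fp = quad a0 b0 c0 d" and d0: "\<not> rect \<Longrightarrow> d = 0" by (rule Pi_T_quad[OF B(1)]) (rule that; simp)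
  obtain a0' b0' c0' d' where fm': "fm = quad a0' b0' c0' d'" and d0': "\<not> rect \<Longrightarrow> d' = 0" by (rule Pi_T_quad[OF B(2)]) (rule that; simp)
  \<comment> \<open>The second derivative condition equates the quadratic coefficients on
    rectangles; on triangles both are 0.\<close>
  have dd: "d' = d"
  proof (cases rect)
    case True
    have "dx (dx (quad a0' b0' c0' d')) 0 = dx (dx (quad a0 b0 c0 d)) 0" using B(4)[OF True] unfolding fp fm' .
    then show ?thesis unfolding dx_quad by (simp add: quad_def zero_prod_def)
  next
    case False then show ?thesis using d0 d0' by simp
  qed
  note fm = fm'[unfolded dd]
  obtain c where c: "b0' = b0 + c * fst n" "c0' = c0 + c * snd n"
    "\<And>p. quad a0' b0' c0' d p = quad a0 b0 c0 d p + c * inner n (p - D)"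
    using ife_pieces_differ_by_normal_multiple[OF geo(5,6,7), of a0' b0' c0' d a0 b0 c0]
      B(3)[of D] B(3)[of E] unfolding fp fm by blast
  obtain e1 e2 :: real where e: "e1 \<in> {0, 1}" "e2 \<in> {0, 1}" and pw: "\<And>U V p. (U, V) \<in> set (edges vs) \<Longrightarrow> p \<in> closed_segment U V \<Longrightarrow>
        pw_fun Tp fp fm p = fp p + c * (e1 * max 0 (inner n (p - D)) + e2 * min 0 (inner n (p - D)))"
    using edge[of c] c(3) unfolding fp fm by blast
  have M: "\<bar>edge_avg (quad a0 b0 c0 d) (U, V) + c * kink_avg e1 e2 (inner n (U - D)) (inner n (V - D))\<bar> \<le> 1"
    if UV: "(U, V) \<in> set (edges vs)" for U V
  proof -
    obtain j where j: "j < length (edges vs)" "edges vs ! j = (U, V)" using UV by (auto simp: in_set_conv_nth)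
    then have "j < length vs" by (simp add: edges_def)
    then have "\<bar>edge_avg (pw_fun Tp fp fm) (U, V)\<bar> \<le> 1" using B(6)[of j] j(2) by auto
    moreover have "edge_avg (pw_fun Tp fp fm) (U, V)
        = edge_avg (quad a0 b0 c0 d) (U, V) + c * kink_avg e1 e2 (inner n (U - D)) (inner n (V - D))"
      by (rule edge_avg_kink) (unfold fp[symmetric], rule pw[OF UV])
    ultimately show ?thesis by simp
  qed
  have vs: "set vs \<subseteq> cbox (x0, y0) (x1, y1)"
    using inbox hull_subset[of "set vs" convex] unfolding elem_set_def by blast
  have Lb: "\<bar>inner n (p - D)\<bar> \<le> 2 * h" if "p \<in> cbox (x0, y0) (x1, y1)" for p
  proof -
    have "dist p D \<le> 2 * h" by (rule box_dist_le[OF that _ box(3,4)]) (use geo(1) inbox in blast)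
    then show ?thesis using Cauchy_Schwarz_ineq2[of n "p - D"] geo(5) by (simp add: dist_norm)
  qed
  define \<delta> where "\<delta> = 12 * \<kappa>\<^sup>2 * \<bar>inner n (F - D)\<bar> / h"
  obtain GM G\<mu> where G: "grad (quad a0 b0 c0 d) F = GM - c *\<^sub>R G\<mu>" "norm GM \<le> 28 * \<kappa> / h" "norm G\<mu> \<le> 56 * \<kappa>"
    "- \<delta> \<le> inner G\<mu> n" "inner G\<mu> n \<le> 1 + \<delta>"
    using element_gradient_split[OF h(1) \<kappa> box shape vs d0 _ _ geo(5) e M \<delta>_def] geo(1,2) inbox by blast
  have \<delta>: "0 \<le> \<delta>" "\<delta> \<le> 48 * \<kappa>\<^sup>2 * K * h"
  proof -
    show "0 \<le> \<delta>" unfolding \<delta>_def using h by simp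
    have "\<delta> \<le> 12 * \<kappa>\<^sup>2 * (4 * K * h\<^sup>2) / h"
      unfolding \<delta>_def using geo(9) h by (intro divide_right_mono mult_left_mono) auto
    then show "\<delta> \<le> 48 * \<kappa>\<^sup>2 * K * h" using h by (simp add: power2_eq_square mult_ac)
  qed
  define \<epsilon> where "\<epsilon> = 2 * K * h"
  have \<epsilon>: "0 \<le> \<epsilon>" "\<epsilon> \<le> 1" using h K by (simp_all add: \<epsilon>_def mult_ac)
  have r0: "r \<ge> 0" and \<mu>0: "\<mu> > 0" using \<beta> by (simp_all add: r_def \<mu>_def)
  \<comment> \<open>160 = 48 + 112: the defect of \<open>F\<close> contributes 48 \<kappa>^2 K h,
    the tilt of the normal 2 K h times 56 \<kappa>.\<close>
  have "r * (\<delta> + \<epsilon> * norm G\<mu>) \<le> r * (160 * \<kappa>\<^sup>2 * K * h)"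
  proof (rule mult_left_mono[OF _ r0])
    have "\<epsilon> * norm G\<mu> \<le> \<epsilon> * (56 * \<kappa>)" using G(3) \<epsilon>(1) by (rule mult_left_mono)
    also have "\<dots> \<le> \<epsilon> * (56 * \<kappa>\<^sup>2)" using \<epsilon>(1) \<kappa> by (intro mult_left_mono) (simp_all add: power2_eq_square)
    finally show "\<delta> + \<epsilon> * norm G\<mu> \<le> 160 * \<kappa>\<^sup>2 * K * h" using \<delta>(2) by (simp add: \<epsilon>_def mult_ac)
  qed
  with h(4) have small: "r * (\<delta> + \<epsilon> * norm G\<mu>) \<le> \<mu> / 2" by linarith
  have gm: "grad fm F = grad (quad a0 b0 c0 d) F + c *\<^sub>R n"
    unfolding fm c(1,2) by (cases F, cases n) (simp add: grad_quad)
  have jump: "\<beta>m * inner (grad (quad a0 b0 c0 d) F + c *\<^sub>R n) v = \<beta>p * inner (grad (quad a0 b0 c0 d) F) v"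
    using B(5) unfolding gm unfolding fp .
  have "\<bar>c\<bar> * (\<mu> / 2) \<le> r * (1 + \<epsilon>) * norm GM"
    unfolding r_def \<mu>_def
    by (rule jump_coefficient_bound[OF \<beta> geo(5,8) geo(10)[folded \<epsilon>_def] G(1,4,5) \<delta>(1) \<epsilon>(1) jump
          small[unfolded r_def \<mu>_def]])
  also have "\<dots> \<le> r * 2 * (28 * \<kappa> / h)"
    using G(2) \<epsilon> r0 by (intro mult_mono) auto
  finally have cb: "\<bar>c\<bar> \<le> C3 / h"
    using \<mu>0 h(1) by (simp add: C3_def field_simps)
  have C0: "C3 \<ge> 0" using r0 \<mu>0 \<kappa> by (simp add: C3_def)
  have ch: "\<bar>c\<bar> * (2 * h) \<le> 2 * C3" using cb h(1) by (simp add: field_simps)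
  \<comment> \<open>These are averages of the plus polynomial on whole edges, beyond its own piece:
    the prescribed 0 or 1, corrected by c times a kink of size at most 2 h.\<close>
  have m: "\<bar>edge_avg (quad a0 b0 c0 d) (U, V)\<bar> \<le> 1 + 2 * C3" if UV: "(U, V) \<in> set (edges vs)" for U V
  proof -
    have "U \<in> set vs" "V \<in> set vs" using edges_in_set[OF UV] by auto
    then have "\<bar>kink_avg e1 e2 (inner n (U - D)) (inner n (V - D))\<bar> \<le> 2 * h"
      using vs by (intro kink_avg_le[OF e] Lb) auto
    then have "\<bar>c * kink_avg e1 e2 (inner n (U - D)) (inner n (V - D))\<bar> \<le> \<bar>c\<bar> * (2 * h)"
      unfolding abs_mult by (intro mult_left_mono) auto
    then show ?thesis using M[OF UV] ch by linarith
  qed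
  have qb: "\<bar>quad a0 b0 c0 d (x, y)\<bar> \<le> 9 * \<kappa>\<^sup>2 * (1 + 2 * C3) \<and> \<bar>b0 + 2 * d * x\<bar> \<le> 14 * \<kappa> * (1 + 2 * C3) / h
    \<and> \<bar>c0 - 2 * d * y\<bar> \<le> 14 * \<kappa> * (1 + 2 * C3) / h \<and> \<bar>d\<bar> \<le> 6 * \<kappa>\<^sup>2 * (1 + 2 * C3) / h\<^sup>2"
    if "(x, y) \<in> elem_set vs" for x y
    by (rule element_quad_bounds[OF h(1) \<kappa> box shape vs d0 _ _ m]) (use that inbox C0 in auto)
  define W where "W = 14 * \<kappa>\<^sup>2 * (1 + 2 * C3)"
  have Zs: "\<bar>Sup {} :: real\<bar> \<le> Z" "W + 2 * C3 \<le> Z" unfolding Z_def W_def using C0 by (simp_all add: zero_le_mult_iff)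
  have W: "9 * \<kappa>\<^sup>2 * (1 + 2 * C3) \<le> W" "14 * \<kappa> * (1 + 2 * C3) \<le> W" "12 * \<kappa>\<^sup>2 * (1 + 2 * C3) \<le> W"
    unfolding W_def using C0 \<kappa> by (auto intro!: mult_right_mono simp: power2_eq_square)
  have q1: "\<bar>quad a0 b0 c0 d (x, y)\<bar> \<le> W" and q2: "\<bar>b0 + 2 * d * x\<bar> \<le> W / h"
    and q3: "\<bar>c0 - 2 * d * y\<bar> \<le> W / h" and q4: "\<bar>2 * d\<bar> \<le> Z / h\<^sup>2" if "(x, y) \<in> elem_set vs" for x y
  proof -
    note q = qb[OF that]
    show "\<bar>quad a0 b0 c0 d (x, y)\<bar> \<le> W" using q W(1) by linarith
    have "14 * \<kappa> * (1 + 2 * C3) / h \<le> W / h" using W(2) h(1) by (intro divide_right_mono) auto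
    then show "\<bar>b0 + 2 * d * x\<bar> \<le> W / h" "\<bar>c0 - 2 * d * y\<bar> \<le> W / h" using q by linarith+
    have "12 * \<kappa>\<^sup>2 * (1 + 2 * C3) / h\<^sup>2 \<le> Z / h\<^sup>2" using W(3) Zs C0 h(1) by (intro divide_right_mono) auto
    moreover have "12 * \<kappa>\<^sup>2 * (1 + 2 * C3) / h\<^sup>2 = 2 * (6 * \<kappa>\<^sup>2 * (1 + 2 * C3) / h\<^sup>2)" by simp
    moreover have "\<bar>2 * d\<bar> = 2 * \<bar>d\<bar>" by (simp only: abs_mult abs_numeral)
    ultimately show "\<bar>2 * d\<bar> \<le> Z / h\<^sup>2" using q by linarith
  qed
  have WZ: "W / h \<le> Z / h" "W / h + C3 / h \<le> Z / h"
    using Zs C0 h(1) by (auto simp: divide_right_mono simp flip: add_divide_distrib)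
  have n1: "\<bar>fst n\<bar> \<le> 1" "\<bar>snd n\<bar> \<le> 1" using abs_unit_le_1[OF geo(5)] by auto
  have cn: "\<bar>c * fst n\<bar> \<le> C3 / h" "\<bar>c * snd n\<bar> \<le> C3 / h"
    unfolding abs_mult using mult_left_mono[OF n1(1), of "\<bar>c\<bar>"] mult_left_mono[OF n1(2), of "\<bar>c\<bar>"] cb by auto
  have 1: "seminorm_inf k Tp fp \<le> Z / h ^ k"
    unfolding fp
  proof (rule seminorm_quad_le[OF _ _ _ _ h(1,2) Zs(1) k])
    fix x y assume "(x, y) \<in> Tp"
    then have p: "(x, y) \<in> elem_set vs" using geo(3) by blast
    show "\<bar>quad a0 b0 c0 d (x, y)\<bar> \<le> Z" using q1[OF p] Zs C0 by linarith
    show "\<bar>b0 + 2 * d * x\<bar> \<le> Z / h" using q2[OF p] WZ by linarith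
    show "\<bar>c0 - 2 * d * y\<bar> \<le> Z / h" using q3[OF p] WZ by linarith
    show "\<bar>2 * d\<bar> \<le> Z / h\<^sup>2" by (rule q4[OF p])
  qed
  have 2: "seminorm_inf k Tm fm \<le> Z / h ^ k"
    unfolding fm
  proof (rule seminorm_quad_le[OF _ _ _ _ h(1,2) Zs(1) k])
    fix x y assume "(x, y) \<in> Tm"
    then have p: "(x, y) \<in> elem_set vs" using geo(4) by blast
    have "\<bar>c * inner n ((x, y) - D)\<bar> \<le> \<bar>c\<bar> * (2 * h)"
      unfolding abs_mult using Lb p inbox by (intro mult_left_mono) auto
    then have "\<bar>c * inner n ((x, y) - D)\<bar> \<le> 2 * C3" using ch by linarith
    then show "\<bar>quad a0' b0' c0' d (x, y)\<bar> \<le> Z" unfolding c(3) using q1[OF p] Zs(2) by linarith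
    have "b0' + 2 * d * x = (b0 + 2 * d * x) + c * fst n" "c0' - 2 * d * y = (c0 - 2 * d * y) + c * snd n"
      by (simp_all add: c(1,2))
    then show "\<bar>b0' + 2 * d * x\<bar> \<le> Z / h" "\<bar>c0' - 2 * d * y\<bar> \<le> Z / h"
      using q2[OF p] q3[OF p] WZ(2) cn abs_triangle_ineq[of "b0 + 2 * d * x" "c * fst n"]
        abs_triangle_ineq[of "c0 - 2 * d * y" "c * snd n"] by linarith+
    show "\<bar>2 * d\<bar> \<le> Z / h\<^sup>2" by (rule q4[OF p])
  qed
  show ?thesis using 1 2 by simp
qed

theorem mainTheorem6:
  fixes \<Omega> \<Omega>p \<Omega>m \<Gamma> :: "pt set" and \<beta>p \<beta>m \<kappa> :: real and rect :: bool
  assumes "ife_setting \<Omega> \<Omega>p \<Omega>m \<Gamma>" and "\<beta>p > 0" and "\<beta>m > 0" and "\<kappa> \<ge> 1"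
  shows "\<exists>h0>0. \<exists>C. \<forall>xs ys dg.
     (let Th = mesh_elements rect xs ys dg \<Omega>; h = mesh_size rect xs ys dg \<Omega> in
      cartesian_mesh xs ys \<Omega> \<and> h < h0 \<and> quasi_uniform \<kappa> xs ys \<Omega> h \<and> mesh_hyps \<Gamma> Th \<longrightarrow>
      (\<forall>vs\<in>Th. interface_elem \<Gamma> vs \<longrightarrow>
        (\<forall>D E nbar Tp Tm F v i fp fm.
           ife_config \<Gamma> \<Omega>p \<Omega>m vs D E nbar Tp Tm F v \<and>
           ife_basis rect \<beta>p \<beta>m vs D E Tp F v i fp fm \<longrightarrow>
           (\<forall>k\<le>2. max (seminorm_inf k Tp fp) (seminorm_inf k Tm fm) \<le> C / h ^ k))))"
proof -
  note set = assms(1) and \<beta> = assms(2,3) and \<kappa> = assms(4)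
  have pc: "piecewise_C2 \<Gamma>" using set unfolding ife_setting_def by blast
  show ?thesis
  proof (rule interface_nearly_straight[OF pc])
    fix K :: real
    assume K: "K > 0" and near: "\<And>T \<gamma> D E F n v \<delta>. c2_arc \<gamma> \<Longrightarrow> \<gamma> ` {0..1} = \<Gamma> \<inter> T \<Longrightarrow>
        (\<And>p q. p \<in> T \<Longrightarrow> q \<in> T \<Longrightarrow> dist p q \<le> \<delta>) \<Longrightarrow> K * \<delta> \<le> 1 \<Longrightarrow>
        D \<in> \<Gamma> \<inter> T \<Longrightarrow> E \<in> \<Gamma> \<inter> T \<Longrightarrow> D \<noteq> E \<Longrightarrow> F \<in> \<Gamma> \<inter> T \<Longrightarrow> norm n = 1 \<Longrightarrow> inner n (E - D) = 0 \<Longrightarrow>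
        is_normal \<Gamma> T F v \<Longrightarrow> inner n v > 0 \<Longrightarrow>
        \<bar>inner n (F - D)\<bar> \<le> K * \<delta>\<^sup>2 \<and> \<bar>cross2 v n\<bar> \<le> K * \<delta> * inner n v"
    define r where "r = \<bar>\<beta>p / \<beta>m - 1\<bar>"
    define \<mu> where "\<mu> = min 1 (\<beta>p / \<beta>m)"
    \<comment> \<open>The summand 1 keeps R positive when the coefficients agree and r = 0.\<close>
    define R where "R = r * (160 * \<kappa>\<^sup>2 * K) + 1"
    have r0: "r \<ge> 0" and \<mu>0: "\<mu> > 0" using \<beta> by (simp_all add: r_def \<mu>_def)
    have R: "R > 0" "r * (160 * \<kappa>\<^sup>2 * K) \<le> R" using r0 K by (simp_all add: R_def add_nonneg_pos)
    \<comment> \<open>The three restrictions are for absorbing constants into powers of h, for the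
      near-straightness of arcs in sets of diameter 2 h, and for keeping the error in the jump
      equation below \<mu> / 2.\<close>
    define h0 where "h0 = Min {1, 1 / (2 * K), \<mu> / (2 * R)}"
    have h0: "h0 \<le> 1" "h0 \<le> 1 / (2 * K)" "h0 \<le> \<mu> / (2 * R)" by (simp_all add: h0_def)
    \<comment> \<open>The curvature constant K does not occur here: the interface influences
      \<open>h0\<close> only.\<close>
    define C where "C = 14 * \<kappa>\<^sup>2 * (1 + 2 * (112 * \<kappa> * r / \<mu>)) + 2 * (112 * \<kappa> * r / \<mu>) + \<bar>Sup {} :: real\<bar>"
    show ?thesis
      unfolding Let_def
    proof (rule exI[of _ h0], rule conjI, goal_cases)
      case 1
      show "h0 > 0" using K R \<mu>0 by (simp add: h0_def)
    next
      case 2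
      show ?case
      proof (rule exI[of _ C], intro allI impI ballI)
        fix xs ys dg vs D E n Tp Tm F v i fp fm k
        define h where "h = mesh_size rect xs ys dg \<Omega>"
        assume "cartesian_mesh xs ys \<Omega> \<and> mesh_size rect xs ys dg \<Omega> < h0 \<and> quasi_uniform \<kappa> xs ys \<Omega> (mesh_size rect xs ys dg \<Omega>)
            \<and> mesh_hyps \<Gamma> (mesh_elements rect xs ys dg \<Omega>)"
          and vs: "vs \<in> mesh_elements rect xs ys dg \<Omega>" and int: "interface_elem \<Gamma> vs"
          and "ife_config \<Gamma> \<Omega>p \<Omega>m vs D E n Tp Tm F v \<and> ife_basis rect \<beta>p \<beta>m vs D E Tp F v i fp fm"
          and k: "k \<le> (2::nat)"
        then have cm: "cartesian_mesh xs ys \<Omega>" and hh: "h < h0" and qu: "quasi_uniform \<kappa> xs ys \<Omega> h"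
          and mh: "mesh_hyps \<Gamma> (mesh_elements rect xs ys dg \<Omega>)"
          and cfg: "ife_config \<Gamma> \<Omega>p \<Omega>m vs D E n Tp Tm F v"
          and basis: "ife_basis rect \<beta>p \<beta>m vs D E Tp F v i fp fm"
          by (simp_all add: h_def)
        obtain x0 y0 x1 y1 where lt: "x0 < x1" "y0 < y1" and box: "h / \<kappa> \<le> x1 - x0" "h / \<kappa> \<le> y1 - y0" "x1 - x0 \<le> h" "y1 - y0 \<le> h"
          and inbox: "elem_set vs \<subseteq> cbox (x0, y0) (x1, y1)" and in\<Omega>: "elem_set vs \<subseteq> closure \<Omega>"
          and shape: "if rect then vs = rect_elem x0 y0 x1 y1 else \<exists>P a b. tri_shape vs P a b \<and> \<bar>a\<bar> = x1 - x0 \<and> \<bar>b\<bar> = y1 - y0"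
          by (rule mesh_element_shape[OF h_def vs cm qu], rule that) assumption+
        have h: "h > 0" "h \<le> 1" using lt(1) box(3) hh h0(1) by linarith+
        have "h \<le> 1 / (2 * K)" using hh h0(2) by linarith
        then have hK: "K * (2 * h) \<le> 1" using K by (simp add: field_simps)
        have hR: "r * (160 * \<kappa>\<^sup>2 * K * h) \<le> \<mu> / 2"
        proof -
          have "r * (160 * \<kappa>\<^sup>2 * K) * h \<le> R * h" using R(2) h by (intro mult_right_mono) auto
          also have "\<dots> \<le> \<mu> / 2"
          proof -
            have "h \<le> \<mu> / (2 * R)" using hh h0(3) by linarith
            then show ?thesis using R(1) by (simp add: field_simps)
          qed
          finally show ?thesis by (simp add: mult.assoc)
        qed
        obtain \<gamma> where arc: "c2_arc \<gamma>" "\<gamma> ` {0..1} = \<Gamma> \<inter> elem_set vs"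
          using mh vs int unfolding mesh_hyps_def by blast
        have diam: "dist p q \<le> 2 * h" if "p \<in> elem_set vs" "q \<in> elem_set vs" for p q
          by (rule box_dist_le[OF _ _ box(3,4)]) (use that inbox in blast)+
        have "D \<in> \<Gamma> \<inter> elem_set vs \<and> E \<in> \<Gamma> \<inter> elem_set vs \<and> D \<noteq> E \<and> F \<in> \<Gamma> \<inter> elem_set vs \<and>
          norm n = 1 \<and> inner n (E - D) = 0 \<and> is_normal \<Gamma> (elem_set vs) F v \<and> inner n v > 0 \<longrightarrow>
          \<bar>inner n (F - D)\<bar> \<le> K * (2 * h)\<^sup>2 \<and> \<bar>cross2 v n\<bar> \<le> K * (2 * h) * inner n v"
          by (intro impI, elim conjE) (rule near[OF arc diam hK])
        note geo = ife_config_geometry[OF this K h(1) cfg]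
        have edge: "\<exists>e1\<in>{0, 1}. \<exists>e2\<in>{0, 1::real}. \<forall>U V p. (U, V) \<in> set (edges vs) \<longrightarrow> p \<in> closed_segment U V \<longrightarrow>
            pw_fun Tp fp fm p = fp p + c * (e1 * max 0 (inner n (p - D)) + e2 * min 0 (inner n (p - D)))"
          if fm: "\<And>p. fm p = fp p + c * inner n (p - D)" for c
        proof (cases rect)
          case True
          then have vs': "vs = rect_elem x0 y0 x1 y1" using shape by simp
          show ?thesis
          proof (rule ife_edge_values[OF set int in\<Omega> _ _ cfg fm])
            show "p \<in> frontier (elem_set vs)" if "(U, V) \<in> set (edges vs)" "p \<in> closed_segment U V" for U V p
              by (rule rect_edges_in_frontier[OF lt vs' that])
          next
            fix n D :: pt and Q :: "pt \<Rightarrow> bool"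
            assume Q: "\<And>U V p q. (U, V) \<in> set (edges vs) \<Longrightarrow> p \<in> closed_segment U V \<Longrightarrow> q \<in> closed_segment U V \<Longrightarrow>
              inner n (p - D) > 0 \<Longrightarrow> inner n (q - D) > 0 \<Longrightarrow> Q p = Q q"
            show "\<exists>e::bool. \<forall>(U, V)\<in>set (edges vs). \<forall>p\<in>closed_segment U V. inner n (p - D) > 0 \<longrightarrow> Q p = e"
              by (rule rect_edges_const[OF vs' Q])
          next
            fix e1 e2 :: real
            assume "e1 \<in> {0, 1}" "e2 \<in> {0, 1}" and "\<And>U V p. (U, V) \<in> set (edges vs) \<Longrightarrow> p \<in> closed_segment U V \<Longrightarrow>
              pw_fun Tp fp fm p = fp p + c * (e1 * max 0 (inner n (p - D)) + e2 * min 0 (inner n (p - D)))"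
            then show ?thesis by blast
          qed
        next
          case False
          then obtain P a b where t: "tri_shape vs P a b" using shape by auto
          show ?thesis
          proof (rule ife_edge_values[OF set int in\<Omega> _ _ cfg fm])
            show "p \<in> frontier (elem_set vs)" if "(U, V) \<in> set (edges vs)" "p \<in> closed_segment U V" for U V p
              by (rule tri_edges_in_frontier[OF t that])
          next
            fix n D :: pt and Q :: "pt \<Rightarrow> bool"
            assume Q: "\<And>U V p q. (U, V) \<in> set (edges vs) \<Longrightarrow> p \<in> closed_segment U V \<Longrightarrow> q \<in> closed_segment U V \<Longrightarrow>
              inner n (p - D) > 0 \<Longrightarrow> inner n (q - D) > 0 \<Longrightarrow> Q p = Q q"
            show "\<exists>e::bool. \<forall>(U, V)\<in>set (edges vs). \<forall>p\<in>closed_segment U V. inner n (p - D) > 0 \<longrightarrow> Q p = e"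
              by (rule tri_edges_const[OF t Q])
          next
            fix e1 e2 :: real
            assume "e1 \<in> {0, 1}" "e2 \<in> {0, 1}" and "\<And>U V p. (U, V) \<in> set (edges vs) \<Longrightarrow> p \<in> closed_segment U V \<Longrightarrow>
              pw_fun Tp fp fm p = fp p + c * (e1 * max 0 (inner n (p - D)) + e2 * min 0 (inner n (p - D)))"
            then show ?thesis by blast
          qed
        qed
        show "max (seminorm_inf k Tp fp) (seminorm_inf k Tm fm) \<le> C / mesh_size rect xs ys dg \<Omega> ^ k"
          unfolding C_def h_def[symmetric] r_def \<mu>_def
        proof (rule ife_basis_bound_element[OF \<beta> \<kappa> K h hK hR[unfolded r_def \<mu>_def] box shape inbox geo basis _ k])
          fix c assume "\<And>p. fm p = fp p + c * inner n (p - D)"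
          then show "\<exists>e1\<in>{0, 1}. \<exists>e2\<in>{0, 1::real}. \<forall>U V p. (U, V) \<in> set (edges vs) \<longrightarrow> p \<in> closed_segment U V \<longrightarrow>
            pw_fun Tp fp fm p = fp p + c * (e1 * max 0 (inner n (p - D)) + e2 * min 0 (inner n (p - D)))"
            by (rule edge)
        qed
      qed
    qed
  qed
qed

end
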